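(* Let $d\ge 1$, $\boldsymbol r\in\mathbb N^d$, $\boldsymbol\sigma=(\sigma_1,\dots,\sigma_d)\in\prod_{l=1}^d(0,r_l+1)$, $0<p<\infty$ and $1\le q\le\infty$ be such that $H(\boldsymbol\sigma)/d>(1/p-1/q)_+$, and let $p'=\infty$ if $0<p\le1$ or $p\ge q$, and $p'=p$ if $1<p<q$. There exist positive reals $C_1(d,\boldsymbol\sigma,p)$ and $C_3'(d,\boldsymbol r,\boldsymbol\sigma,p,q)$, depending only on the parameters indicated, such that for all $J\in\mathbb N$, all $R>0$ and all integers $D\ge C_1(d,\boldsymbol\sigma,p)$ for which $\mathcal M_D^J$ is nonempty, $$\sup_{s\in\mathcal S(\boldsymbol r,\boldsymbol\sigma,p,p',R)}\ \inf_{t\in\bigcup_{m\in\mathcal M_D^J}S_{(m,\boldsymbol r)}}\|s-t\|_q\le C_3'(d,\boldsymbol r,\boldsymbol\sigma,p,q)\,R\left(2^{-Jd\left(H(\boldsymbol\sigma)/d-(1/p-1/q)_+\right)\underline{\boldsymbol\sigma}/H(\boldsymbol\sigma)}+D^{-H(\boldsymbol\sigma)/d}\right).$$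
   Context: $\mathbb N=\{0,1,2,\dots\}$ and $(x)_+=\max\{x,0\}$. A dyadic rectangle of $[0,1]^d$ is a product $I_1\times\dots\times I_d$ where, for each $l$, $I_l=[0,2^{-j_l}]$ or $I_l=(k_l2^{-j_l},(k_l+1)2^{-j_l}]$ with $j_l\in\mathbb N$, $k_l\in\{1,\dots,2^{j_l}-1\}$. For $J\in\mathbb N$ and $D\ge1$, $\mathcal M_D^J$ is the set of all partitions of $[0,1]^d$ into $D$ dyadic rectangles with sidelengths $\ge2^{-J}$. For a partition $m$ into dyadic rectangles, $S_{(m,\boldsymbol r)}$ is the space of functions on $[0,1]^d$ which, on each rectangle of $m$, are polynomial of degree $\le r_l$ in the $l$-th variable, $l=1,\dots,d$. For $0<p\le\infty$, $\mathbb L_p([0,1]^d)$ is the space of real measurable functions with finite Lebesgue (quasi-)norm $\|\cdot\|_p$ (essential supremum if $p=\infty$), functions being identified when equal almost everywhere. For $\boldsymbol\sigma\in(0,\infty)^d$: $\underline{\boldsymbol\sigma}=\min_l\sigma_l$ and $H(\boldsymbol\sigma)=\big(\frac1d\sum_{l=1}^d\frac1{\sigma_l}\big)^{-1}$. For $j\in\mathbb N$, $\mathcal D_j^{\boldsymbol\sigma}$ is the set of all dyadic rectangles $I_1\times\dots\times I_d$ such that each $I_l$ has length $2^{-\lfloor j\underline{\boldsymbol\sigma}/\sigma_l\rfloor}$; it is a partition of $[0,1]^d$. $\Pi_k^{\boldsymbol r,\boldsymbol\sigma}$ is the set of functions on $[0,1]^d$ that are polynomial of degree $\le r_l$ in the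 $l$-th variable over each rectangle of $\mathcal D_k^{\boldsymbol\sigma}$. For $s\in\mathbb L_p([0,1]^d)$, $$e_{\boldsymbol r,\boldsymbol\sigma,p,k}(s)=\inf_{P\in\Pi_k^{\boldsymbol r,\boldsymbol\sigma}}\|s-P\|_p,$$ $$N_{\boldsymbol r,\boldsymbol\sigma,p,p'}(s)=\Big(\sum_{k\in\mathbb N}(2^{k\underline{\boldsymbol\sigma}}e_{\boldsymbol r,\boldsymbol\sigma,p,k}(s))^{p'}\Big)^{1/p'}\ (0<p'<\infty),\qquad N_{\boldsymbol r,\boldsymbol\sigma,p,\infty}(s)=\sup_{k\in\mathbb N}2^{k\underline{\boldsymbol\sigma}}e_{\boldsymbol r,\boldsymbol\sigma,p,k}(s),$$ and $\mathcal S(\boldsymbol r,\boldsymbol\sigma,p,p',R)=\{s\in\mathbb L_p([0,1]^d): N_{\boldsymbol r,\boldsymbol\sigma,p,p'}(s)\le R\}$. *)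

theory Defs
  imports "HOL-Analysis.Analysis" "HOL-Probability.Essential_Supremum" "HOL-Library.Disjoint_Sets"
begin

(* Vectors are indexed by a finite type 'n with d = CARD('n).  Functions on the unit cube are
   represented by functions on real^'n whose values outside the cube are irrelevant. *)

abbreviation unit_cube :: "(real^'n) set" where
  "unit_cube \<equiv> cbox 0 1"

definition dyadic_interval :: "nat \<Rightarrow> nat \<Rightarrow> real set" where
  "dyadic_interval j k =
     (if k = 0 then {0 .. (1/2)^j} else {real k * (1/2)^j <.. (real k + 1) * (1/2)^j})"

definition dyadic_rectangle :: "nat^'n \<Rightarrow> nat^'n \<Rightarrow> (real^'n) set" where
  "dyadic_rectangle j k = {x. \<forall>l. x $ l \<in> dyadic_interval (j $ l) (k $ l)}"

definition dyadic_partitions :: "nat \<Rightarrow> nat \<Rightarrow> (real^'n) set set set" where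
  "dyadic_partitions D J =
     {m. partition_on unit_cube m \<and> finite m \<and> card m = D \<and>
         (\<forall>K\<in>m. \<exists>j k. (\<forall>l. k $ l < 2 ^ (j $ l)) \<and> K = dyadic_rectangle j k \<and>
                       (\<forall>l. (1/2::real) ^ (j $ l) \<ge> (1/2) ^ J))}"

definition coord_polynomial :: "nat^'n \<Rightarrow> (real^'n \<Rightarrow> real) \<Rightarrow> bool" where
  "coord_polynomial r P \<longleftrightarrow>
     (\<exists>c :: nat^'n \<Rightarrow> real.
        \<forall>x. P x = (\<Sum>a \<in> {a. \<forall>l. a $ l \<le> r $ l}. c a * (\<Prod>l\<in>UNIV. (x $ l) ^ (a $ l))))"

definition piecewise_poly :: "(real^'n) set set \<Rightarrow> nat^'n \<Rightarrow> (real^'n \<Rightarrow> real) set" where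
  "piecewise_poly m r = {t. \<forall>K\<in>m. \<exists>P. coord_polynomial r P \<and> (\<forall>x\<in>K. t x = P x)}"

(* Power of an extended nonnegative real with a positive real exponent. *)
definition ennpowr :: "ennreal \<Rightarrow> real \<Rightarrow> ennreal" where
  "ennpowr x a = (if x = \<infinity> then \<infinity> else ennreal (enn2real x powr a))"

(* Exponents range over (0,\<infinity>].  The value is \<infinity> for functions outside the Lebesgue space. *)
definition Lnorm :: "ennreal \<Rightarrow> (real^'n \<Rightarrow> real) \<Rightarrow> ennreal" where
  "Lnorm p f =
     (if p = \<infinity> then esssup (lebesgue_on unit_cube) (\<lambda>x. ennreal \<bar>f x\<bar>)
      else ennpowr (\<integral>\<^sup>+x. ennreal (\<bar>f x\<bar> powr enn2real p) \<partial>lebesgue_on unit_cube)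
                   (1 / enn2real p))"

definition Lspace :: "ennreal \<Rightarrow> (real^'n \<Rightarrow> real) set" where
  "Lspace p = {f. f \<in> borel_measurable (lebesgue_on unit_cube) \<and> Lnorm p f < \<infinity>}"

definition smin :: "real^'n \<Rightarrow> real" where
  "smin \<sigma> = Min (range (\<lambda>l. \<sigma> $ l))"

definition harmonic_mean :: "real^'n \<Rightarrow> real" where
  "harmonic_mean \<sigma> = inverse (1 / real CARD('n) * (\<Sum>l\<in>UNIV. 1 / \<sigma> $ l))"

definition dyadic_grid :: "real^'n \<Rightarrow> nat \<Rightarrow> (real^'n) set set" where
  "dyadic_grid \<sigma> j =
     {dyadic_rectangle i k | i k.
        (\<forall>l. i $ l = nat \<lfloor>real j * smin \<sigma> / \<sigma> $ l\<rfloor>) \<and> (\<forall>l. k $ l < 2 ^ (i $ l))}"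

definition grid_poly :: "nat^'n \<Rightarrow> real^'n \<Rightarrow> nat \<Rightarrow> (real^'n \<Rightarrow> real) set" where
  "grid_poly r \<sigma> k = piecewise_poly (dyadic_grid \<sigma> k) r"

definition approx_error :: "nat^'n \<Rightarrow> real^'n \<Rightarrow> ennreal \<Rightarrow> nat \<Rightarrow> (real^'n \<Rightarrow> real) \<Rightarrow> ennreal" where
  "approx_error r \<sigma> p k s = (INF P\<in>grid_poly r \<sigma> k. Lnorm p (\<lambda>x. s x - P x))"

definition smoothness_norm ::
  "nat^'n \<Rightarrow> real^'n \<Rightarrow> ennreal \<Rightarrow> ennreal \<Rightarrow> (real^'n \<Rightarrow> real) \<Rightarrow> ennreal" where
  "smoothness_norm r \<sigma> p p' s =
     (if p' = \<infinity> then SUP k. ennreal (2 powr (real k * smin \<sigma>)) * approx_error r \<sigma> p k s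
      else ennpowr
             (\<Sum>k. ennpowr (ennreal (2 powr (real k * smin \<sigma>)) * approx_error r \<sigma> p k s)
                           (enn2real p'))
             (1 / enn2real p'))"

definition smoothness_ball ::
  "nat^'n \<Rightarrow> real^'n \<Rightarrow> ennreal \<Rightarrow> ennreal \<Rightarrow> real \<Rightarrow> (real^'n \<Rightarrow> real) set" where
  "smoothness_ball r \<sigma> p p' R = {s \<in> Lspace p. smoothness_norm r \<sigma> p p' s \<le> ennreal R}"

(* The positive part of 1/p - 1/q, with 1/\<infinity> = 0. *)
definition exponent_gap :: "real \<Rightarrow> ennreal \<Rightarrow> real" where
  "exponent_gap p q = max (1 / p - enn2real (1 / q)) 0"

end

theory Submission
  imports Defs
begin

text \<open>
  Only the bounds \<open>e\<^sub>k \<le> R 2\<^bsup>-k a\<^esup>\<close>, with \<open>a\<close> the minimum of \<open>\<sigma>\<close>, are used, and one may assume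
  \<open>p \<le> q\<close>.  Put \<open>V = a d / H(\<sigma>)\<close>, so that the grid of level \<open>k\<close> has at most \<open>2\<^bsup>k V\<^esup>\<close> cells.
  Take near-best approximants \<open>P\<^sub>k\<close> on the grids and split \<open>s\<close> into the
  increments \<open>Q\<^sub>k = P\<^sub>k - P\<^bsub>k-1\<^esub>\<close>.  A cell of level \<open>k\<close> is selected when \<open>\<bar>Q\<^sub>k\<bar>\<close> exceeds a threshold
  \<open>\<tau>\<^sub>k\<close> somewhere on it.  Since a polynomial stays comparable to its maximum on a fixed proportion of the
  cell, Markov's inequality bounds the number of selected cells, while the part of \<open>Q\<^sub>k\<close> that is not selected has
  \<open>L\<^sub>q\<close> norm at most \<open>\<tau>\<^sub>k\<^bsup>1-p/q\<^esup> \<parallel>Q\<^sub>k\<parallel>\<^sub>p\<^bsup>p/q\<^esup>\<close>.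
  For a base level \<open>k\<^sub>0\<close> with \<open>2\<^bsup>k\<^sub>0 V\<^esup>\<close> of order \<open>D\<close>, the thresholds are chosen so that
  level \<open>k\<close> has at most \<open>2\<^bsup>k\<^sub>0 V - \<epsilon>(k - k\<^sub>0)\<^esup>\<close> selected cells for \<open>k\<^sub>0 < k \<le> J\<close> and none for
  \<open>k > J\<close>.  Resolving the ancestors of the selected cells costs \<open>O(2\<^bsup>k\<^sub>0 V\<^esup>)\<close> cells altogether, and
  the errors of the levels are summed by Minkowski's inequality.  The strict inequality
  \<open>H(\<sigma>)/d > 1/p - 1/q\<close> leaves room for \<open>\<epsilon> > 0\<close>.
\<close>

section \<open>Polynomials on intervals and boxes\<close>

text \<open>Two rigid side conditions shape the construction. Cells with a side shorter than 2^-J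
  are forbidden, so nothing can be repaired at levels finer than \<open>J\<close>: thresholds there
  must exceed the whole increment. They can, because Markov's bound for the number of selected cells
  drops below 1 once the threshold exceeds a constant times 2^(k V / p) times the L_p size of the
  increment, and a natural number below 1 is 0. The price at level k is of order 2^(-k \<eta>) with
  \<eta> = a - V (1/p - 1/q), and its sum over k > J is the term in \<open>J\<close> of the theorem.
  The number \<open>D\<close> is also prescribed exactly, so a partition with fewer cells must be
  bisected until it has \<open>D\<close> cells; this works because nonemptiness of the set of
  partitions forces D <= 2^(J d). Up to level \<open>J\<close> the relative threshold grows like
  2^((k - k0)(V + \<epsilon>) / p): V cancels the growth of the number of cells and \<epsilon> makes
  the number of selected cells decay. The term D^(-H/d) is the error at the base level, since 2^(k0
  V) is of order D and V H / d = a. If p > q, then p is replaced by q, which is possible because the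
  cube has measure 1.\<close>

lemma polynomial_coeff_bound:
  "\<exists>L\<ge>0. \<forall>(c :: nat \<Rightarrow> real) M. (\<forall>x\<in>{0<..1}. \<bar>\<Sum>i\<le>r. c i * x ^ i\<bar> \<le> M) \<longrightarrow> (\<forall>i\<le>r. \<bar>c i\<bar> \<le> L * M)"
proof (induction r)
  case 0
  have "\<bar>c 0\<bar> \<le> 1 * M" if "\<forall>x\<in>{0<..1}. \<bar>\<Sum>i\<le>0. c i * x ^ i\<bar> \<le> M" for c :: "nat \<Rightarrow> real" and M
    using bspec[OF that, of 1] by simp
  then show ?case by (intro exI[of _ 1]) auto
next
  case (Suc r)
  then obtain L where L: "L \<ge> 0"
    and L_bound: "\<And>(c :: nat \<Rightarrow> real) M i. \<forall>x\<in>{0<..1}. \<bar>\<Sum>i\<le>r. c i * x ^ i\<bar> \<le> M \<Longrightarrow> i \<le> r \<Longrightarrow> \<bar>c i\<bar> \<le> L * M"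
    by blast
  define L1 where "L1 = L * (1 + 2 ^ Suc r)"
  define L2 where "L2 = L1 + (1 + real (Suc r) * L1)"
  have L1: "L1 \<ge> 0" using L by (simp add: L1_def)
  have "\<bar>c i\<bar> \<le> L2 * M"
    if bound: "\<forall>x\<in>{0<..1}. \<bar>\<Sum>i\<le>Suc r. c i * x ^ i\<bar> \<le> M" and i: "i \<le> Suc r" for c :: "nat \<Rightarrow> real" and M i
  proof -
    define f where "f x = (\<Sum>i\<le>Suc r. c i * x ^ i)" for x
    have M: "M \<ge> 0" using bspec[OF bound, of 1] by simp
    \<comment> \<open>The combination \<open>f x - 2 ^ n * f (x / 2)\<close> cancels the leading coefficient.\<close>
    define e where "e i = c i * (1 - 2 ^ Suc r / 2 ^ i)" for i
    have "(\<Sum>i\<le>r. e i * x ^ i) = f x - 2 ^ Suc r * f (x / 2)" for x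
    proof -
      have "f x - 2 ^ Suc r * f (x / 2) = (\<Sum>i\<le>Suc r. e i * x ^ i)"
        unfolding f_def sum_distrib_left sum_subtractf[symmetric] e_def
        by (intro sum.cong) (auto simp: field_simps power_divide)
      also have "\<dots> = (\<Sum>i\<le>r. e i * x ^ i)" by (simp add: e_def)
      finally show ?thesis by simp
    qed
    moreover have "\<bar>f x - 2 ^ Suc r * f (x / 2)\<bar> \<le> (1 + 2 ^ Suc r) * M" if "x \<in> {0<..1}" for x
    proof -
      have "\<bar>f x\<bar> \<le> M" "\<bar>f (x / 2)\<bar> \<le> M" using bspec[OF bound, of x] bspec[OF bound, of "x / 2"] that
        by (auto simp: f_def simp del: sum.atMost_Suc)
      then have "\<bar>f x\<bar> + 2 ^ Suc r * \<bar>f (x / 2)\<bar> \<le> M + 2 ^ Suc r * M"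
        by (intro add_mono mult_left_mono) auto
      moreover have "\<bar>f x - 2 ^ Suc r * f (x / 2)\<bar> \<le> \<bar>f x\<bar> + \<bar>2 ^ Suc r * f (x / 2)\<bar>"
        by (rule abs_triangle_ineq4)
      ultimately show ?thesis by (simp add: abs_mult algebra_simps)
    qed
    ultimately have e_bound: "\<bar>e i\<bar> \<le> L * ((1 + 2 ^ Suc r) * M)" if "i \<le> r" for i
      using that by (intro L_bound) auto
    \<comment> \<open>For i <= r the factor 1 - 2^(r+1-i) has absolute value at least 1, so a bound
      on \<open>e i\<close> is a bound on \<open>c i\<close>. Only the top coefficient is lost; it
      is recovered from the value at 1.\<close>
    have low: "\<bar>c i\<bar> \<le> L1 * M" if "i \<le> r" for i
    proof -
      have "(2::real) ^ Suc i \<le> 2 ^ Suc r" using that by (intro power_increasing) auto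
      then have "2 ^ Suc r / 2 ^ i \<ge> (2::real)" by (simp add: field_simps)
      then have "\<bar>c i\<bar> * 1 \<le> \<bar>c i\<bar> * \<bar>1 - 2 ^ Suc r / 2 ^ i\<bar>" by (intro mult_left_mono) auto
      also have "\<dots> = \<bar>e i\<bar>" by (simp add: e_def abs_mult)
      finally show ?thesis using e_bound[OF that] by (simp add: L1_def mult.assoc)
    qed
    have "c (Suc r) = f 1 - (\<Sum>i\<le>r. c i)" by (simp add: f_def)
    moreover have "\<bar>f 1\<bar> \<le> M"
      using bspec[OF bound, of 1] by (simp add: f_def del: sum.atMost_Suc)
    moreover have "\<bar>\<Sum>i\<le>r. c i\<bar> \<le> (\<Sum>i\<le>r. L1 * M)"
      by (rule order_trans[OF sum_abs sum_mono]) (use low in auto)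
    ultimately have top: "\<bar>c (Suc r)\<bar> \<le> (1 + real (Suc r) * L1) * M"
      by (simp add: algebra_simps)
    have "L1 * M \<ge> 0" "(1 + real (Suc r) * L1) * M \<ge> 0" using L1 M by simp_all
    with low[of i] top i show ?thesis
      by (cases "i = Suc r") (auto simp: L2_def algebra_simps)
  qed
  moreover have "L2 \<ge> 0" using L1 by (simp add: L2_def)
  ultimately show ?case by blast
qed

lemma abs_power_diff_le:
  fixes u v :: real
  assumes "u \<in> {0..1}" "v \<in> {0..1}"
  shows "\<bar>u ^ i - v ^ i\<bar> \<le> real i * \<bar>u - v\<bar>"
proof (induction i)
  case (Suc i)
  have "\<bar>u ^ Suc i - v ^ Suc i\<bar> = \<bar>u * (u ^ i - v ^ i) + (u - v) * v ^ i\<bar>" by (simp add: algebra_simps)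
  also have "\<dots> \<le> \<bar>u\<bar> * \<bar>u ^ i - v ^ i\<bar> + \<bar>u - v\<bar> * \<bar>v ^ i\<bar>"
    by (rule order_trans[OF abs_triangle_ineq]) (simp add: abs_mult)
  also have "\<dots> \<le> 1 * \<bar>u ^ i - v ^ i\<bar> + \<bar>u - v\<bar> * 1"
    using assms by (intro add_mono mult_right_mono mult_left_mono) (auto simp: power_le_one)
  finally show ?case using Suc by (simp add: algebra_simps)
qed simp

text \<open>An affine substitution moves the interval to [0,1], where the coefficients are
  controlled by the maximum and each monomial is Lipschitz. The result is a crude Markov inequality
  for derivatives; its constant depends on the degree bound only, hence serves for dyadic cells of
  all sizes and shapes.\<close>

lemma poly_lipschitz_on_interval:
  "\<exists>L\<ge>0. \<forall>(f :: real poly) a h M. degree f \<le> r \<longrightarrow> h > 0 \<longrightarrow> (\<forall>x\<in>{a..a+h}. \<bar>poly f x\<bar> \<le> M) \<longrightarrow>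
     (\<forall>x\<in>{a..a+h}. \<forall>y\<in>{a..a+h}. \<bar>poly f x - poly f y\<bar> \<le> L * M * \<bar>x - y\<bar> / h)"
proof -
  obtain L where L: "L \<ge> 0"
    and L_bound: "\<And>(c :: nat \<Rightarrow> real) M i. \<forall>x\<in>{0<..1}. \<bar>\<Sum>i\<le>r. c i * x ^ i\<bar> \<le> M \<Longrightarrow> i \<le> r \<Longrightarrow> \<bar>c i\<bar> \<le> L * M"
    using polynomial_coeff_bound[of r] by blast
  define L' where "L' = L * (\<Sum>i\<le>r. real i)"
  have "\<bar>poly f x - poly f y\<bar> \<le> L' * M * \<bar>x - y\<bar> / h"
    if deg: "degree f \<le> r" and h: "h > 0" and bound: "\<forall>x\<in>{a..a+h}. \<bar>poly f x\<bar> \<le> M"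
      and x: "x \<in> {a..a+h}" and y: "y \<in> {a..a+h}" for f a h M x y
  proof -
    define g where "g = pcompose f [:a, h:]"
    have g: "poly g u = poly f (a + h * u)" for u by (simp add: g_def poly_pcompose mult.commute)
    have "degree g \<le> degree f * 1"
      unfolding g_def by (rule order_trans[OF degree_pcompose_le]) (auto intro: mult_left_mono)
    then have "degree g \<le> r" using deg by simp
    then have g_sum: "poly g u = (\<Sum>i\<le>r. coeff g i * u ^ i)" for u
      unfolding poly_altdef by (intro sum.mono_neutral_left) (auto simp: coeff_eq_0)
    have "\<bar>poly g u\<bar> \<le> M" if "u \<in> {0<..1}" for u
      unfolding g using that h by (intro bspec[OF bound]) auto
    then have c: "\<bar>coeff g i\<bar> \<le> L * M" if "i \<le> r" for i
      using that by (intro L_bound) (auto simp: g_sum)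
    define u v where "u = (x - a) / h" and "v = (y - a) / h"
    have uv: "u \<in> {0..1}" "v \<in> {0..1}" using x y h by (auto simp: u_def v_def field_simps)
    have "poly f x - poly f y = poly g u - poly g v" using h by (simp add: g u_def v_def)
    also have "\<dots> = (\<Sum>i\<le>r. coeff g i * (u ^ i - v ^ i))"
      by (simp add: g_sum sum_subtractf right_diff_distrib)
    also have "\<bar>\<dots>\<bar> \<le> (\<Sum>i\<le>r. (L * M) * (real i * \<bar>u - v\<bar>))"
      by (rule order_trans[OF sum_abs sum_mono], unfold abs_mult, rule mult_mono)
        (use c abs_power_diff_le[OF uv] in \<open>auto intro: order_trans[OF abs_ge_zero]\<close>)
    also have "\<dots> = L' * M * \<bar>u - v\<bar>"
      by (simp add: L'_def sum_distrib_left sum_distrib_right algebra_simps)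
    also have "\<bar>u - v\<bar> = \<bar>x - y\<bar> / h"
      using h by (simp add: u_def v_def diff_divide_distrib[symmetric])
    finally show ?thesis by simp
  qed
  moreover have "L' \<ge> 0" using L by (simp add: L'_def sum_nonneg)
  ultimately show ?thesis by blast
qed

section \<open>Multi-index boxes and polynomials in several variables\<close>

lemma vec_box_eq_image_PiE:
  "{k :: 'a^'n. \<forall>l. k $ l \<in> A l} = vec_lambda ` (\<Pi>\<^sub>E l\<in>UNIV. A l)"
proof (intro equalityI subsetI)
  fix k :: "'a^'n" assume "k \<in> {k. \<forall>l. k $ l \<in> A l}"
  then show "k \<in> vec_lambda ` (\<Pi>\<^sub>E l\<in>UNIV. A l)"
    by (intro image_eqI[of _ _ "vec_nth k"]) (simp_all add: PiE_def)
next
  fix k :: "'a^'n" assume "k \<in> vec_lambda ` (\<Pi>\<^sub>E l\<in>UNIV. A l)"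
  then show "k \<in> {k. \<forall>l. k $ l \<in> A l}" by fastforce
qed

lemma finite_vec_box:
  "(\<And>l. finite (A l)) \<Longrightarrow> finite {k :: 'a^'n. \<forall>l. k $ l \<in> A l}"
  unfolding vec_box_eq_image_PiE by (intro finite_imageI finite_PiE) simp_all

lemma card_vec_box:
  "(\<And>l. finite (A l)) \<Longrightarrow> card {k :: 'a^'n. \<forall>l. k $ l \<in> A l} = (\<Prod>l\<in>UNIV. card (A l))"
  unfolding vec_box_eq_image_PiE
  by (subst card_image) (simp_all add: card_PiE inj_on_def vec_lambda_inject)

lemma coord_polynomial_univariate:
  fixes Q :: "real^'n \<Rightarrow> real"
  assumes "coord_polynomial r Q"
  shows "\<exists>f. degree f \<le> r $ l \<and> (\<forall>t. Q (\<chi> i. if i = l then t else x $ i) = poly f t)"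
proof -
  obtain c where c: "\<And>x. Q x = (\<Sum>a \<in> {a. \<forall>l. a $ l \<le> r $ l}. c a * (\<Prod>l\<in>UNIV. (x $ l) ^ (a $ l)))"
    using assms unfolding coord_polynomial_def by blast
  define f where "f = (\<Sum>a \<in> {a. \<forall>l. a $ l \<le> r $ l}. monom (c a * (\<Prod>i\<in>UNIV - {l}. (x $ i) ^ (a $ i))) (a $ l))"
  have "degree f \<le> r $ l"
    unfolding f_def using finite_vec_box[of "\<lambda>l. {..r $ l}"]
    by (intro degree_sum_le) (auto intro: order_trans[OF degree_monom_le])
  moreover have "Q (\<chi> i. if i = l then t else x $ i) = poly f t" for t
  proof -
    have "(\<Prod>i\<in>UNIV. ((\<chi> i. if i = l then t else x $ i) $ i) ^ (a $ i))
        = (\<Prod>i\<in>UNIV - {l}. (x $ i) ^ (a $ i)) * t ^ (a $ l)" for a :: "nat^'n"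
      by (subst prod.remove[of _ l]) (auto simp: mult.commute intro!: prod.cong)
    then show ?thesis
      unfolding c f_def poly_sum by (intro sum.cong) (auto simp: poly_monom mult.assoc)
  qed
  ultimately show ?thesis by blast
qed

lemma continuous_on_coord_polynomial:
  "coord_polynomial r Q \<Longrightarrow> continuous_on A Q"
  unfolding coord_polynomial_def fun_eq_iff[symmetric] by (auto intro!: continuous_intros)

lemma coord_polynomial_diff:
  assumes "coord_polynomial r P" "coord_polynomial r Q"
  shows "coord_polynomial r (\<lambda>x. P x - Q x)"
proof -
  obtain c d where
    "\<And>x. P x = (\<Sum>a \<in> {a. \<forall>l. a $ l \<le> r $ l}. c a * (\<Prod>l\<in>UNIV. (x $ l) ^ (a $ l)))"
    "\<And>x. Q x = (\<Sum>a \<in> {a. \<forall>l. a $ l \<le> r $ l}. d a * (\<Prod>l\<in>UNIV. (x $ l) ^ (a $ l)))"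
    using assms unfolding coord_polynomial_def by blast
  then show ?thesis unfolding coord_polynomial_def
    by (intro exI[of _ "\<lambda>a. c a - d a"]) (simp add: sum_subtractf left_diff_distrib)
qed

lemma coord_polynomial_add:
  assumes "coord_polynomial r P" "coord_polynomial r Q"
  shows "coord_polynomial r (\<lambda>x. P x + Q x)"
proof -
  obtain c d where
    "\<And>x. P x = (\<Sum>a \<in> {a. \<forall>l. a $ l \<le> r $ l}. c a * (\<Prod>l\<in>UNIV. (x $ l) ^ (a $ l)))"
    "\<And>x. Q x = (\<Sum>a \<in> {a. \<forall>l. a $ l \<le> r $ l}. d a * (\<Prod>l\<in>UNIV. (x $ l) ^ (a $ l)))"
    using assms unfolding coord_polynomial_def by blast
  then show ?thesis unfolding coord_polynomial_def
    by (intro exI[of _ "\<lambda>a. c a + d a"]) (simp add: sum.distrib distrib_right)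
qed

lemma coord_polynomial_zero: "coord_polynomial r (\<lambda>x. 0)"
  unfolding coord_polynomial_def by (intro exI[of _ "\<lambda>_. 0"]) simp

lemma coord_polynomial_sum:
  "(\<And>i. i \<in> I \<Longrightarrow> coord_polynomial r (F i)) \<Longrightarrow> coord_polynomial r (\<lambda>x. \<Sum>i\<in>I. F i x)"
  by (induction I rule: infinite_finite_induct)
    (auto simp: coord_polynomial_zero intro: coord_polynomial_add)

lemma mem_cbox_plus_vec:
  fixes a h x :: "real^'n"
  shows "x \<in> cbox a (a + h) \<longleftrightarrow> (\<forall>l. x $ l \<in> {a $ l..a $ l + h $ l})"
  by (auto simp: mem_box_cart)

text \<open>The coordinates of x are exchanged for those of y one at a time. Since a box is a
  product, every intermediate point and the whole segment between neighbours stay inside it, so the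
  bound \<open>M\<close> is available for each one-variable restriction.\<close>

lemma coord_polynomial_lipschitz_on_box:
  "\<exists>L\<ge>0. \<forall>(Q :: real^'n \<Rightarrow> real) a h M. coord_polynomial r Q \<longrightarrow> (\<forall>l. h $ l > 0) \<longrightarrow>
     (\<forall>x\<in>cbox a (a+h). \<bar>Q x\<bar> \<le> M) \<longrightarrow>
     (\<forall>x\<in>cbox a (a+h). \<forall>y\<in>cbox a (a+h). \<bar>Q x - Q y\<bar> \<le> L * M * (\<Sum>l\<in>UNIV. \<bar>x $ l - y $ l\<bar> / h $ l))"
proof -
  have "\<forall>l. \<exists>L\<ge>0. \<forall>(f :: real poly) a h M. degree f \<le> r $ l \<longrightarrow> h > 0 \<longrightarrow> (\<forall>x\<in>{a..a+h}. \<bar>poly f x\<bar> \<le> M) \<longrightarrow>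
     (\<forall>x\<in>{a..a+h}. \<forall>y\<in>{a..a+h}. \<bar>poly f x - poly f y\<bar> \<le> L * M * \<bar>x - y\<bar> / h)"
    using poly_lipschitz_on_interval by blast
  then obtain L where L: "\<And>l. L l \<ge> 0"
    and lip: "\<And>l (f :: real poly) a h M x y. degree f \<le> r $ l \<Longrightarrow> h > 0 \<Longrightarrow> \<forall>x\<in>{a..a+h}. \<bar>poly f x\<bar> \<le> M \<Longrightarrow>
      x\<in>{a..a+h} \<Longrightarrow> y\<in>{a..a+h} \<Longrightarrow> \<bar>poly f x - poly f y\<bar> \<le> L l * M * \<bar>x - y\<bar> / h"
    by metis
  define L' where "L' = (\<Sum>l\<in>UNIV. L l)"
  have L_le: "L l \<le> L'" for l unfolding L'_def by (rule member_le_sum) (use L in auto)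
  have "\<bar>Q x - Q y\<bar> \<le> L' * M * (\<Sum>l\<in>UNIV. \<bar>x $ l - y $ l\<bar> / h $ l)"
    if Q: "coord_polynomial r Q" and h: "\<forall>l. h $ l > 0" and bound: "\<forall>x\<in>cbox a (a+h). \<bar>Q x\<bar> \<le> M"
      and x: "x \<in> cbox a (a+h)" and y: "y \<in> cbox a (a+h)" for Q a h M and x y :: "real^'n"
  proof -
    have M: "M \<ge> 0" using bound x by force
    \<comment> \<open>\<open>z S\<close> agrees with y on the coordinates in \<open>S\<close> and
      with x elsewhere; it runs from x at the empty set to y at \<open>UNIV\<close>.\<close>
    define z where "z S = (\<chi> i. if i \<in> S then y $ i else x $ i)" for S
    have step: "\<bar>Q (z S) - Q (z (insert l S))\<bar> \<le> L' * M * (\<bar>x $ l - y $ l\<bar> / h $ l)" if "l \<notin> S" for l S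
    proof -
      obtain f where f: "degree f \<le> r $ l" "\<And>t. Q (\<chi> i. if i = l then t else z S $ i) = poly f t"
        using coord_polynomial_univariate[OF Q] by blast
      have "(\<chi> i. if i = l then x $ l else z S $ i) = z S" "(\<chi> i. if i = l then y $ l else z S $ i) = z (insert l S)"
        using that by (auto simp: z_def vec_eq_iff)
      with f(2) have "Q (z S) = poly f (x $ l)" "Q (z (insert l S)) = poly f (y $ l)" by metis+
      moreover have "\<bar>poly f t\<bar> \<le> M" if "t \<in> {a $ l..a $ l + h $ l}" for t
        unfolding f(2)[symmetric] using that x y
        by (intro bspec[OF bound]) (auto simp: mem_cbox_plus_vec z_def)
      then have "\<bar>poly f (x $ l) - poly f (y $ l)\<bar> \<le> L l * M * \<bar>x $ l - y $ l\<bar> / h $ l"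
        using f(1) h x y by (intro lip[of f l "h $ l" "a $ l"]) (auto simp: mem_cbox_plus_vec)
      moreover have "L l * M * \<bar>x $ l - y $ l\<bar> / h $ l \<le> L' * M * \<bar>x $ l - y $ l\<bar> / h $ l"
        using L_le[of l] M spec[OF h, of l] by (intro divide_right_mono mult_right_mono) auto
      ultimately show ?thesis by simp
    qed
    have "\<bar>Q (z {}) - Q (z S)\<bar> \<le> (\<Sum>l\<in>S. L' * M * (\<bar>x $ l - y $ l\<bar> / h $ l))" if "finite S" for S
      using that
    proof (induction S)
      case (insert l S)
      then show ?case using step[of l S] by simp
    qed simp
    from this[of UNIV] show ?thesis by (simp add: z_def sum_distrib_left)
  qed
  moreover have "L' \<ge> 0" using L by (simp add: L'_def sum_nonneg)
  ultimately show ?thesis by blast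
qed

text \<open>Near a point where |Q| is maximal, the Lipschitz bound with that maximum as
  \<open>M\<close> keeps |Q| above half of it. The fraction \<rho> is independent of the box, and
  comparison with an arbitrary \<open>x0\<close> follows because |Q x0| is at most the maximum. Open
  boxes are used because they fit into half-open dyadic cells.\<close>

lemma coord_polynomial_large_subbox:
  "\<exists>\<rho>>0. \<forall>(Q :: real^'n \<Rightarrow> real) a h x0. coord_polynomial r Q \<longrightarrow> (\<forall>l. h $ l > 0) \<longrightarrow>
     x0 \<in> cbox a (a+h) \<longrightarrow>
     (\<exists>u. box u (u + \<rho> *\<^sub>R h) \<subseteq> box a (a+h) \<and> (\<forall>x\<in>box u (u + \<rho> *\<^sub>R h). \<bar>Q x\<bar> \<ge> \<bar>Q x0\<bar> / 2))"
proof -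
  obtain L where L: "L \<ge> 0" and lip: "\<And>(Q :: real^'n \<Rightarrow> real) a h M x y. coord_polynomial r Q \<Longrightarrow> \<forall>l. h $ l > 0 \<Longrightarrow>
     \<forall>x\<in>cbox a (a+h). \<bar>Q x\<bar> \<le> M \<Longrightarrow> x \<in> cbox a (a+h) \<Longrightarrow> y\<in>cbox a (a+h) \<Longrightarrow>
     \<bar>Q x - Q y\<bar> \<le> L * M * (\<Sum>l\<in>UNIV. \<bar>x $ l - y $ l\<bar> / h $ l)"
    using coord_polynomial_lipschitz_on_box[of r] by blast
  \<comment> \<open>The variation of Q over the subbox is at most L d \<rho> times the maximum,
    hence at most half of it. The added 1 gives \<rho> <= 1/2, so a subinterval starting or ending
    at the maximum point fits on one of its sides.\<close>
  define \<rho> where "\<rho> = 1 / (2 * (L * CARD('n) + 1))"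
  have Lc: "L * CARD('n) \<ge> 0" using L by simp
  have \<rho>: "\<rho> > 0" "\<rho> \<le> 1 / 2" "L * CARD('n) * \<rho> \<le> 1 / 2"
    using Lc by (auto simp: \<rho>_def field_simps add_pos_nonneg add_nonneg_eq_0_iff)
  have "\<exists>u. box u (u + \<rho> *\<^sub>R h) \<subseteq> box a (a+h) \<and> (\<forall>x\<in>box u (u + \<rho> *\<^sub>R h). \<bar>Q x\<bar> \<ge> \<bar>Q x0\<bar> / 2)"
    if Q: "coord_polynomial r Q" and h: "\<forall>l. h $ l > 0" and x0: "x0 \<in> cbox a (a+h)"
    for Q :: "real^'n \<Rightarrow> real" and a h x0
  proof -
    have "continuous_on (cbox a (a+h)) (\<lambda>x. \<bar>Q x\<bar>)"
      using continuous_on_coord_polynomial[OF Q] by (intro continuous_intros)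
    then obtain x1 where x1: "x1 \<in> cbox a (a+h)" and M: "\<forall>x\<in>cbox a (a+h). \<bar>Q x\<bar> \<le> \<bar>Q x1\<bar>"
      using continuous_attains_sup[of "cbox a (a+h)" "\<lambda>x. \<bar>Q x\<bar>"] x0 by auto
    \<comment> \<open>In each coordinate the subinterval of relative length \<open>\<rho>\<close> lies on the side of the maximum point where there is room.\<close>
    define u where "u = (\<chi> l. if x1 $ l \<le> a $ l + h $ l / 2 then x1 $ l else x1 $ l - \<rho> * h $ l)"
    have u: "a $ l \<le> u $ l \<and> u $ l + \<rho> * h $ l \<le> a $ l + h $ l \<and>
        u $ l \<le> x1 $ l \<and> x1 $ l \<le> u $ l + \<rho> * h $ l" for l
    proof -
      have "\<rho> * h $ l \<le> 1 / 2 * h $ l" "\<rho> * h $ l \<ge> 0" using \<rho> spec[OF h, of l] by (auto intro!: mult_right_mono)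
      moreover have "a $ l \<le> x1 $ l" "x1 $ l \<le> a $ l + h $ l" using x1 by (auto simp: mem_cbox_plus_vec)
      ultimately show ?thesis by (auto simp: u_def)
    qed
    have sub: "box u (u + \<rho> *\<^sub>R h) \<subseteq> box a (a+h)"
    proof
      fix x assume "x \<in> box u (u + \<rho> *\<^sub>R h)"
      then have "u $ l < x $ l" "x $ l < u $ l + \<rho> * h $ l" for l by (auto simp: mem_box_cart)
      then have "a $ l < x $ l \<and> x $ l < a $ l + h $ l" for l
        using u[of l] by (meson le_less_trans less_le_trans)
      then show "x \<in> box a (a + h)" by (simp add: mem_box_cart)
    qed
    moreover have "\<bar>Q x\<bar> \<ge> \<bar>Q x0\<bar> / 2" if x: "x \<in> box u (u + \<rho> *\<^sub>R h)" for x
    proof -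
      have "\<bar>x1 $ l - x $ l\<bar> / h $ l \<le> \<rho>" for l
      proof -
        have "u $ l < x $ l" "x $ l < u $ l + \<rho> * h $ l" using x by (auto simp: mem_box_cart)
        then have "\<bar>x1 $ l - x $ l\<bar> \<le> \<rho> * h $ l" using u[of l] by auto
        then show ?thesis using spec[OF h, of l] by (simp add: field_simps)
      qed
      then have "(\<Sum>l\<in>UNIV. \<bar>x1 $ l - x $ l\<bar> / h $ l) \<le> (\<Sum>l\<in>(UNIV::'n set). \<rho>)"
        by (intro sum_mono)
      then have "L * \<bar>Q x1\<bar> * (\<Sum>l\<in>UNIV. \<bar>x1 $ l - x $ l\<bar> / h $ l) \<le> L * \<bar>Q x1\<bar> * (CARD('n) * \<rho>)"
        using L by (intro mult_left_mono) auto
      also have "\<dots> = \<bar>Q x1\<bar> * (L * CARD('n) * \<rho>)" by simp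
      also have "\<dots> \<le> \<bar>Q x1\<bar> * (1 / 2)" using \<rho> by (intro mult_left_mono) auto
      finally have "\<bar>Q x1 - Q x\<bar> \<le> \<bar>Q x1\<bar> / 2"
        using lip[OF Q h M x1, of x] x sub box_subset_cbox[of a "a+h"] by force
      moreover have "\<bar>Q x0\<bar> \<le> \<bar>Q x1\<bar>" using M x0 by blast
      ultimately show ?thesis by linarith
    qed
    ultimately show ?thesis by blast
  qed
  then show ?thesis using \<rho>(1) by blast
qed

section \<open>Dyadic cells\<close>

lemma dyadic_interval_subset_unit:
  assumes "k < 2 ^ j"
  shows "dyadic_interval j k \<subseteq> {0..1}"
proof -
  have "real (k + 1) \<le> real (2 ^ j)" using assms by (simp only: of_nat_le_iff)
  then have "real k + 1 \<le> 2 ^ j" by simp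
  then have "(real k + 1) * (1/2) ^ j \<le> 1" by (simp add: power_divide)
  moreover have "(1/2::real) ^ j \<le> 1" by (simp add: power_le_one)
  moreover have "0 \<le> x" if "real k * (1/2::real) ^ j < x" for x
    by (rule order_trans[OF _ less_imp_le[OF that]]) simp
  ultimately show ?thesis by (auto simp: dyadic_interval_def)
qed

lemma dyadic_interval_subset_atLeastAtMost:
  "dyadic_interval j k \<subseteq> {real k * (1/2) ^ j..real k * (1/2) ^ j + (1/2) ^ j}"
  by (auto simp: dyadic_interval_def distrib_right)

lemma greaterThanLessThan_subset_dyadic_interval:
  "{real k * (1/2) ^ j<..<real k * (1/2) ^ j + (1/2) ^ j} \<subseteq> dyadic_interval j k"
  by (auto simp: dyadic_interval_def distrib_right)

text \<open>Intervals are open on the left, hence the ceiling minus 1. Truncated subtraction sends x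
  = 0 to index 0, in agreement with the first interval being closed.\<close>

definition dyadic_index :: "nat \<Rightarrow> real \<Rightarrow> nat" where
  "dyadic_index j x = nat \<lceil>x * 2 ^ j\<rceil> - 1"

text \<open>With membership expressed by an index, disjointness and nesting of dyadic intervals
  become arithmetic of natural numbers.\<close>

lemma mem_dyadic_interval_iff:
  assumes "x \<in> {0..1}"
  shows "x \<in> dyadic_interval j k \<longleftrightarrow> k = dyadic_index j x"
proof -
  have eq: "x \<in> dyadic_interval j k \<longleftrightarrow>
      (if k = 0 then x * 2 ^ j \<le> 1 else real k < x * 2 ^ j \<and> x * 2 ^ j \<le> real k + 1)"
    using assms by (simp add: dyadic_interval_def power_divide field_simps)
  show ?thesis
  proof (cases "k = 0")
    case True
    have "0 = nat \<lceil>x * 2 ^ j\<rceil> - 1 \<longleftrightarrow> nat \<lceil>x * 2 ^ j\<rceil> \<le> 1" by auto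
    then show ?thesis unfolding eq dyadic_index_def using True
      by (simp add: nat_le_iff ceiling_le_iff)
  next
    case False
    then have "k = nat \<lceil>x * 2 ^ j\<rceil> - 1 \<longleftrightarrow> \<lceil>x * 2 ^ j\<rceil> = int k + 1"
      by (intro iffI) linarith+
    then show ?thesis unfolding eq dyadic_index_def using False
      by (auto simp: ceiling_eq_iff)
  qed
qed

lemma dyadic_index_less:
  assumes "x \<in> {0..1}"
  shows "dyadic_index j x < 2 ^ j"
proof -
  have "x * 2 ^ j \<le> 1 * 2 ^ j" using assms by (intro mult_right_mono) auto
  then have "\<lceil>x * 2 ^ j\<rceil> \<le> 2 ^ j" by (simp add: ceiling_le_iff)
  then have "nat \<lceil>x * 2 ^ j\<rceil> \<le> 2 ^ j" by (simp add: nat_le_iff)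
  moreover have "(0::nat) < 2 ^ j" by simp
  ultimately show ?thesis unfolding dyadic_index_def by linarith
qed

text \<open>Dropping the last n binary digits of the index gives the ancestor n levels up; both
  endpoint inequalities are those of integer division.\<close>

lemma dyadic_interval_subset_div:
  "dyadic_interval (j + n) k \<subseteq> dyadic_interval j (k div 2 ^ n)"
proof -
  define q where "q = k div 2 ^ n"
  have "q * 2 ^ n \<le> k" by (simp add: q_def)
  then have "real (q * 2 ^ n) \<le> real k" by (simp only: of_nat_le_iff)
  then have "real q * 2 ^ n \<le> real k" by simp
  then have lo: "real q * (1/2) ^ j \<le> real k * (1/2) ^ (j + n)" by (simp add: power_divide field_simps power_add)
  have "k mod 2 ^ n < 2 ^ n" "k = q * 2 ^ n + k mod 2 ^ n"
    by (simp_all add: q_def div_mult_mod_eq)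
  then have "k + 1 \<le> q * 2 ^ n + 2 ^ n" by linarith
  then have "k + 1 \<le> (q + 1) * 2 ^ n" by simp
  then have "real (k + 1) \<le> real ((q + 1) * 2 ^ n)" by (simp only: of_nat_le_iff)
  then have "real k + 1 \<le> (real q + 1) * 2 ^ n" by (simp add: algebra_simps)
  then have "(real k + 1) * (1/2) ^ n \<le> real q + 1" by (simp add: power_divide field_simps)
  then have "(real k + 1) * (1/2) ^ n * (1/2) ^ j \<le> (real q + 1) * (1/2) ^ j"
    by (rule mult_right_mono) simp
  then have hi: "(real k + 1) * (1/2) ^ (j + n) \<le> (real q + 1) * (1/2) ^ j"
    by (simp add: power_add mult_ac)
  show ?thesis
  proof
    fix x assume x: "x \<in> dyadic_interval (j + n) k"
    show "x \<in> dyadic_interval j (k div 2 ^ n)"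
    proof (cases "k = 0")
      case True
      then have "q = 0" "0 \<le> x" "x \<le> (real k + 1) * (1/2) ^ (j + n)"
        using x by (simp_all add: dyadic_interval_def q_def)
      moreover from this(3) have "x \<le> (real q + 1) * (1/2) ^ j" using hi by (rule order_trans)
      ultimately show ?thesis unfolding q_def[symmetric] by (simp add: dyadic_interval_def)
    next
      case False
      then have "real k * (1/2) ^ (j + n) < x" "x \<le> (real k + 1) * (1/2) ^ (j + n)"
        using x by (simp_all add: dyadic_interval_def)
      then have "real q * (1/2) ^ j < x" "x \<le> (real q + 1) * (1/2) ^ j" using lo hi by linarith+
      moreover have "0 \<le> real q * (1/2::real) ^ j" by simp
      ultimately show ?thesis unfolding q_def[symmetric] dyadic_interval_def by (cases "q = 0") auto
    qed
  qed
qed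

lemma dyadic_index_div:
  assumes "x \<in> {0..1}" "i \<le> j"
  shows "dyadic_index i x = dyadic_index j x div 2 ^ (j - i)"
proof -
  have "x \<in> dyadic_interval (i + (j - i)) (dyadic_index j x)"
    using assms by (simp add: mem_dyadic_interval_iff)
  then have "x \<in> dyadic_interval i (dyadic_index j x div 2 ^ (j - i))"
    using dyadic_interval_subset_div by blast
  then show ?thesis using assms(1) by (simp add: mem_dyadic_interval_iff)
qed

lemma dyadic_interval_split:
  assumes "k < 2 ^ j"
  shows "dyadic_interval j k = dyadic_interval (Suc j) (2 * k) \<union> dyadic_interval (Suc j) (2 * k + 1)"
proof (intro equalityI subsetI)
  fix x assume x: "x \<in> dyadic_interval j k"
  then have x01: "x \<in> {0..1}" using dyadic_interval_subset_unit[OF assms] by blast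
  then have "k = dyadic_index (Suc j) x div 2" using x dyadic_index_div[OF x01, of j "Suc j"]
    by (simp add: mem_dyadic_interval_iff)
  then have "dyadic_index (Suc j) x = 2 * k \<or> dyadic_index (Suc j) x = 2 * k + 1" by presburger
  then show "x \<in> dyadic_interval (Suc j) (2 * k) \<union> dyadic_interval (Suc j) (2 * k + 1)"
    using x01 by (auto simp: mem_dyadic_interval_iff)
next
  fix x assume "x \<in> dyadic_interval (Suc j) (2 * k) \<union> dyadic_interval (Suc j) (2 * k + 1)"
  then show "x \<in> dyadic_interval j k"
    using dyadic_interval_subset_div[of j 1 "2 * k"] dyadic_interval_subset_div[of j 1 "2 * k + 1"] by auto
qed

definition cell_index :: "nat^'n \<Rightarrow> real^'n \<Rightarrow> nat^'n" where
  "cell_index j x = (\<chi> l. dyadic_index (j $ l) (x $ l))"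

text \<open>Cells are named by any of their points instead of an index, so that a level can later be
  chosen as a function of the point.\<close>

definition dyadic_cell :: "nat^'n \<Rightarrow> real^'n \<Rightarrow> (real^'n) set" where
  "dyadic_cell j x = dyadic_rectangle j (cell_index j x)"

lemma mem_unit_cube: "x \<in> (unit_cube :: (real^'n) set) \<longleftrightarrow> (\<forall>l. x $ l \<in> {0..1})"
  by (simp add: mem_box_cart)

lemma mem_dyadic_rectangle_iff:
  "x \<in> unit_cube \<Longrightarrow> x \<in> dyadic_rectangle j k \<longleftrightarrow> k = cell_index j x"
  by (auto simp: mem_unit_cube dyadic_rectangle_def cell_index_def mem_dyadic_interval_iff vec_eq_iff)

lemma dyadic_rectangle_subset_unit_cube:
  "(\<And>l. k $ l < 2 ^ (j $ l)) \<Longrightarrow> dyadic_rectangle j k \<subseteq> unit_cube"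
  using dyadic_interval_subset_unit by (fastforce simp: mem_unit_cube dyadic_rectangle_def)

lemma cell_index_less: "x \<in> unit_cube \<Longrightarrow> cell_index j x $ l < 2 ^ (j $ l)"
  by (simp add: cell_index_def mem_unit_cube dyadic_index_less)

lemma dyadic_cell_subset_unit_cube: "x \<in> unit_cube \<Longrightarrow> dyadic_cell j x \<subseteq> unit_cube"
  unfolding dyadic_cell_def by (intro dyadic_rectangle_subset_unit_cube cell_index_less)

lemma mem_dyadic_cell_iff:
  "x \<in> unit_cube \<Longrightarrow> y \<in> dyadic_cell j x \<longleftrightarrow> y \<in> unit_cube \<and> cell_index j y = cell_index j x"
  using mem_dyadic_rectangle_iff[of y j "cell_index j x"] dyadic_cell_subset_unit_cube[of x j]
  unfolding dyadic_cell_def by auto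

lemma self_mem_dyadic_cell: "x \<in> unit_cube \<Longrightarrow> x \<in> dyadic_cell j x"
  by (simp add: mem_dyadic_cell_iff)

lemma cell_index_coarser:
  "x \<in> unit_cube \<Longrightarrow> (\<And>l. i $ l \<le> j $ l) \<Longrightarrow>
     cell_index i x = (\<chi> l. cell_index j x $ l div 2 ^ (j $ l - i $ l))"
  by (simp add: cell_index_def vec_eq_iff mem_unit_cube dyadic_index_div)

lemma cell_index_eq_coarser:
  "x \<in> unit_cube \<Longrightarrow> y \<in> unit_cube \<Longrightarrow> (\<And>l. i $ l \<le> j $ l) \<Longrightarrow>
     cell_index j x = cell_index j y \<Longrightarrow> cell_index i x = cell_index i y"
  using cell_index_coarser[of x i j] cell_index_coarser[of y i j] by simp

text \<open>Squeezing the half-open rectangle between an open and a closed box transfers to it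
  volumes and polynomial estimates known for boxes.\<close>

lemma dyadic_rectangle_between_boxes:
  fixes j k :: "nat^'n"
  defines "a \<equiv> \<chi> l. real (k $ l) * (1/2) ^ (j $ l)" and "h \<equiv> \<chi> l. (1/2) ^ (j $ l)"
  shows "box a (a + h) \<subseteq> dyadic_rectangle j k" "dyadic_rectangle j k \<subseteq> cbox a (a + h)"
  using greaterThanLessThan_subset_dyadic_interval dyadic_interval_subset_atLeastAtMost
  by (fastforce simp: a_def h_def dyadic_rectangle_def mem_box_cart)+

lemma dyadic_rectangle_borel [measurable]: "dyadic_rectangle j k \<in> sets borel"
proof -
  have "dyadic_interval i n \<in> sets borel" for i n by (simp add: dyadic_interval_def)
  then have "(\<lambda>x. x $ l) -` dyadic_interval (j $ l) (k $ l) \<inter> space borel \<in> sets (borel :: (real^'a) measure)" for l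
    by (intro measurable_sets[of _ borel borel] borel_measurable_continuous_onI continuous_intros) auto
  then have "(\<Inter>l. (\<lambda>x. x $ l) -` dyadic_interval (j $ l) (k $ l)) \<in> sets (borel :: (real^'a) measure)"
    by (intro sets.finite_INT) auto
  also have "(\<Inter>l. (\<lambda>x. x $ l) -` dyadic_interval (j $ l) (k $ l)) = dyadic_rectangle j k"
    by (auto simp: dyadic_rectangle_def)
  finally show ?thesis .
qed

lemma emeasure_box_plus_vec:
  fixes u h :: "real^'n"
  assumes "\<And>l. h $ l \<ge> 0"
  shows "emeasure lborel (box u (u + h)) = ennreal (\<Prod>l\<in>UNIV. h $ l)"
    and "emeasure lborel (cbox u (u + h)) = ennreal (\<Prod>l\<in>UNIV. h $ l)"
proof -
  have "x \<in> box u (u + h) \<Longrightarrow> x \<in> cbox u (u + h)" for x by (auto simp: mem_box)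
  have B: "(\<Prod>b\<in>Basis. (u + h - u) \<bullet> b) = (\<Prod>l\<in>UNIV. h $ l)"
    by (simp add: Basis_vec_def prod.UNION_disjoint inner_axis axis_eq_axis)
  have ord: "\<And>b. b \<in> Basis \<Longrightarrow> u \<bullet> b \<le> (u + h) \<bullet> b"
    using assms by (auto simp: Basis_vec_def inner_axis)
  show "emeasure lborel (box u (u + h)) = ennreal (\<Prod>l\<in>UNIV. h $ l)"
    using ord B by (subst emeasure_lborel_box) auto
  show "emeasure lborel (cbox u (u + h)) = ennreal (\<Prod>l\<in>UNIV. h $ l)"
    using ord B by (subst emeasure_lborel_cbox) auto
qed

lemma emeasure_dyadic_rectangle:
  "emeasure lborel (dyadic_rectangle j k) = ennreal (\<Prod>l\<in>UNIV. (1/2) ^ (j $ l))"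
proof (rule antisym)
  let ?a = "\<chi> l. real (k $ l) * (1/2) ^ (j $ l)" and ?h = "\<chi> l. (1/2::real) ^ (j $ l)"
  have "emeasure lborel (dyadic_rectangle j k) \<le> emeasure lborel (cbox ?a (?a + ?h))"
    by (rule emeasure_mono[OF dyadic_rectangle_between_boxes(2)]) simp
  then show "emeasure lborel (dyadic_rectangle j k) \<le> ennreal (\<Prod>l\<in>UNIV. (1/2) ^ (j $ l))"
    by (subst (asm) emeasure_box_plus_vec) auto
  have "emeasure lborel (box ?a (?a + ?h)) \<le> emeasure lborel (dyadic_rectangle j k)"
    by (rule emeasure_mono[OF dyadic_rectangle_between_boxes(1)]) simp
  then show "ennreal (\<Prod>l\<in>UNIV. (1/2) ^ (j $ l)) \<le> emeasure lborel (dyadic_rectangle j k)"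
    by (subst (asm) emeasure_box_plus_vec) auto
qed

section \<open>Refining dyadic partitions\<close>

lemma piecewise_poly_refine:
  assumes "\<And>K'. K' \<in> m' \<Longrightarrow> \<exists>K\<in>m. K' \<subseteq> K"
  shows "piecewise_poly m r \<subseteq> piecewise_poly m' r"
proof
  fix t assume t: "t \<in> piecewise_poly m r"
  have "\<exists>P. coord_polynomial r P \<and> (\<forall>x\<in>K'. t x = P x)" if "K' \<in> m'" for K'
  proof -
    obtain K where "K \<in> m" "K' \<subseteq> K" using assms \<open>K' \<in> m'\<close> by blast
    then show ?thesis using t unfolding piecewise_poly_def by blast
  qed
  then show "t \<in> piecewise_poly m' r" by (simp add: piecewise_poly_def)
qed

lemma half_pow_ge_iff: "(1/2::real) ^ i \<ge> (1/2) ^ J \<longleftrightarrow> i \<le> J"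
  by (simp add: power_decreasing_iff)

lemma dyadic_partitionsD:
  assumes "m \<in> dyadic_partitions D J"
  shows "partition_on unit_cube m" "finite m" "card m = D"
    and "\<And>K. K \<in> m \<Longrightarrow> \<exists>j k. (\<forall>l. k $ l < 2 ^ (j $ l)) \<and> K = dyadic_rectangle j k \<and> (\<forall>l. j $ l \<le> J)"
  using assms unfolding dyadic_partitions_def half_pow_ge_iff by simp_all

lemma sum_emeasure_dyadic_partition:
  fixes m :: "(real^'n) set set"
  assumes "m \<in> dyadic_partitions D J"
  shows "(\<Sum>K\<in>m. emeasure lborel K) = 1"
proof -
  note m = dyadic_partitionsD[OF assms]
  have "m \<subseteq> sets lborel" using m(4) dyadic_rectangle_borel by (metis sets_lborel subsetI)
  then have "(\<Sum>K\<in>m. emeasure lborel K) = emeasure lborel (\<Union>m)"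
    using m sum_emeasure[of "\<lambda>K. K" m lborel]
    by (simp add: partition_on_def disjoint_family_on_def disjoint_def subset_eq)
  also have "\<dots> = emeasure lborel (cbox 0 (0 + 1 :: real^'n))" using m by (simp add: partition_on_def)
  also have "\<dots> = 1" by (subst emeasure_box_plus_vec(2)) auto
  finally show ?thesis .
qed

lemma emeasure_dyadic_partition_cell_ge:
  assumes "m \<in> dyadic_partitions D J" "K \<in> m"
  shows "emeasure lborel (K :: (real^'n) set) \<ge> ennreal ((1/2) ^ (J * CARD('n)))"
proof -
  obtain j k where K: "K = dyadic_rectangle j k" and j: "\<And>l. j $ l \<le> J"
    using dyadic_partitionsD(4)[OF assms] by metis
  have "(1/2::real) ^ (J * CARD('n)) = (\<Prod>l\<in>(UNIV::'n set). (1/2) ^ J)" by (simp add: power_mult)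
  also have "\<dots> \<le> (\<Prod>l\<in>UNIV. (1/2) ^ (j $ l))" by (intro prod_mono) (simp add: half_pow_ge_iff j)
  finally show ?thesis unfolding K emeasure_dyadic_rectangle by (rule ennreal_leI)
qed

text \<open>Every cell has volume at least 2^(-J d) and the volumes sum to 1. This extracts from
  nonemptiness of the set of partitions the upper bound on \<open>D\<close> under which bisection
  can reach exactly \<open>D\<close> cells.\<close>

lemma card_dyadic_partition_le:
  assumes "(m :: (real^'n) set set) \<in> dyadic_partitions D J"
  shows "D \<le> 2 ^ (J * CARD('n))"
proof -
  have D: "card m = D" using assms by (simp add: dyadic_partitions_def)
  have "ennreal (real D * (1/2) ^ (J * CARD('n))) = (\<Sum>K\<in>m. ennreal ((1/2) ^ (J * CARD('n))))"
    by (simp add: D ennreal_mult ennreal_of_nat_eq_real_of_nat)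
  also have "\<dots> \<le> (\<Sum>K\<in>m. emeasure lborel K)"
    by (intro sum_mono emeasure_dyadic_partition_cell_ge[OF assms])
  finally have "real D * (1/2) ^ (J * CARD('n)) \<le> 1"
    by (simp add: sum_emeasure_dyadic_partition[OF assms])
  then have "real D \<le> real (2 ^ (J * CARD('n)))" by (simp add: power_divide field_simps)
  then show ?thesis by (simp only: of_nat_le_iff)
qed

lemma dyadic_rectangle_split:
  fixes j k :: "nat^'n" and l :: 'n
  assumes k: "\<And>l. k $ l < 2 ^ (j $ l)"
  defines "j' \<equiv> \<chi> i. if i = l then Suc (j $ i) else j $ i"
    and "k1 \<equiv> \<chi> i. if i = l then 2 * k $ i else k $ i"
    and "k2 \<equiv> \<chi> i. if i = l then 2 * k $ i + 1 else k $ i"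
  shows "dyadic_rectangle j k = dyadic_rectangle j' k1 \<union> dyadic_rectangle j' k2"
    and "dyadic_rectangle j' k1 \<inter> dyadic_rectangle j' k2 = {}"
    and "k1 $ i < 2 ^ (j' $ i)" "k2 $ i < 2 ^ (j' $ i)"
proof -
  have k': "\<And>i. k1 $ i < 2 ^ (j' $ i)" "\<And>i. k2 $ i < 2 ^ (j' $ i)"
  proof -
    fix i show "k1 $ i < 2 ^ (j' $ i)" "k2 $ i < 2 ^ (j' $ i)"
      using k[of i] by (auto simp: k1_def k2_def j'_def)
  qed
  show "k1 $ i < 2 ^ (j' $ i)" "k2 $ i < 2 ^ (j' $ i)" by (rule k')+
  have "x \<in> dyadic_rectangle j k \<longleftrightarrow> x \<in> dyadic_rectangle j' k1 \<or> x \<in> dyadic_rectangle j' k2" for x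
  proof -
    have "x $ l \<in> dyadic_interval (j $ l) (k $ l) \<longleftrightarrow>
        x $ l \<in> dyadic_interval (Suc (j $ l)) (2 * k $ l) \<or> x $ l \<in> dyadic_interval (Suc (j $ l)) (2 * k $ l + 1)"
      using dyadic_interval_split[OF k[of l]] by auto
    moreover have all: "(\<forall>i. P i) \<longleftrightarrow> P l \<and> (\<forall>i. i \<noteq> l \<longrightarrow> P i)" for P by metis
    have "x \<in> dyadic_rectangle j k \<longleftrightarrow> x $ l \<in> dyadic_interval (j $ l) (k $ l) \<and>
        (\<forall>i. i \<noteq> l \<longrightarrow> x $ i \<in> dyadic_interval (j $ i) (k $ i))"
      "x \<in> dyadic_rectangle j' k1 \<longleftrightarrow> x $ l \<in> dyadic_interval (Suc (j $ l)) (2 * k $ l) \<and>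
        (\<forall>i. i \<noteq> l \<longrightarrow> x $ i \<in> dyadic_interval (j $ i) (k $ i))"
      "x \<in> dyadic_rectangle j' k2 \<longleftrightarrow> x $ l \<in> dyadic_interval (Suc (j $ l)) (2 * k $ l + 1) \<and>
        (\<forall>i. i \<noteq> l \<longrightarrow> x $ i \<in> dyadic_interval (j $ i) (k $ i))"
      unfolding dyadic_rectangle_def mem_Collect_eq
      by (subst all, simp add: j'_def k1_def k2_def)+
    ultimately show ?thesis by blast
  qed
  then show "dyadic_rectangle j k = dyadic_rectangle j' k1 \<union> dyadic_rectangle j' k2" by blast
  have "k1 $ l \<noteq> k2 $ l" by (simp add: k1_def k2_def)
  then have "k1 \<noteq> k2" by metis
  moreover have "x \<in> unit_cube" if "x \<in> dyadic_rectangle j' k1" for x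
    using dyadic_rectangle_subset_unit_cube[of k1 j'] k'(1) that by blast
  ultimately show "dyadic_rectangle j' k1 \<inter> dyadic_rectangle j' k2 = {}"
    using mem_dyadic_rectangle_iff[of _ j' k1] mem_dyadic_rectangle_iff[of _ j' k2] by blast
qed

lemma dyadic_rectangle_nonempty: "dyadic_rectangle j k \<noteq> {}"
proof
  assume "dyadic_rectangle j k = {}"
  then have "(\<Prod>l\<in>UNIV. (1/2::real) ^ (j $ l)) \<le> 0"
    using emeasure_dyadic_rectangle[of j k] by (simp add: ennreal_eq_0_iff eq_commute[of 0])
  moreover have "(\<Prod>l\<in>UNIV. (1/2::real) ^ (j $ l)) > 0" by (intro prod_pos) simp
  ultimately show False by linarith
qed

text \<open>If all sides of all cells were 2^-J, comparing volumes would give D = 2^(J d). Hence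
  some side is longer, and halving that side adds exactly one cell without violating the bound on
  sidelengths.\<close>

lemma dyadic_partition_refine_Suc:
  fixes m :: "(real^'n) set set"
  assumes m: "m \<in> dyadic_partitions D J" and less: "D < 2 ^ (J * CARD('n))"
  shows "\<exists>m'\<in>dyadic_partitions (Suc D) J. piecewise_poly m r \<subseteq> piecewise_poly m' r"
proof -
  note part = dyadic_partitionsD(1)[OF m] and fin = dyadic_partitionsD(2)[OF m]
    and card = dyadic_partitionsD(3)[OF m] and dy = dyadic_partitionsD(4)[OF m]
  have "\<exists>K\<in>m. \<exists>j k l. (\<forall>l. k $ l < 2 ^ (j $ l)) \<and> K = dyadic_rectangle j k \<and> (\<forall>l. j $ l \<le> J) \<and> j $ l < J"
  proof (rule ccontr)
    assume *: "\<not> ?thesis"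
    have "emeasure lborel K = ennreal ((1/2) ^ (J * CARD('n)))" if K: "K \<in> m" for K
    proof -
      obtain j k where jk: "\<forall>l. k $ l < 2 ^ (j $ l)" "K = dyadic_rectangle j k" "\<forall>l. j $ l \<le> J"
        using dy[OF K] by blast
      then have "\<not> j $ l < J" for l using * K by blast
      then have "j $ l = J" for l using jk(3) by (meson le_neq_implies_less)
      then show ?thesis by (simp add: jk(2) emeasure_dyadic_rectangle power_mult)
    qed
    then have "(\<Sum>K\<in>m. emeasure lborel K) = ennreal (real D * (1/2) ^ (J * CARD('n)))"
      by (simp add: card ennreal_mult ennreal_of_nat_eq_real_of_nat)
    then have "real D * (1/2) ^ (J * CARD('n)) = 1"
      by (simp add: sum_emeasure_dyadic_partition[OF m] eq_commute[of 1])
    then have "real D = real (2 ^ (J * CARD('n)))" by (simp add: power_divide field_simps)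
    with less show False by (simp only: of_nat_eq_iff)
  qed
  then obtain K j k l where K: "K \<in> m" "\<And>l. k $ l < 2 ^ (j $ l)" "K = dyadic_rectangle j k"
    and j: "\<And>l. j $ l \<le> J" "j $ l < J" by blast
  define j' where "j' = (\<chi> i. if i = l then Suc (j $ i) else j $ i)"
  define k1 where "k1 = (\<chi> i. if i = l then 2 * k $ i else k $ i)"
  define k2 where "k2 = (\<chi> i. if i = l then 2 * k $ i + 1 else k $ i)"
  define K1 where "K1 = dyadic_rectangle j' k1"
  define K2 where "K2 = dyadic_rectangle j' k2"
  have K12: "K = K1 \<union> K2" "K1 \<inter> K2 = {}" "K1 \<noteq> {}" "K2 \<noteq> {}"
    using dyadic_rectangle_split(1,2)[where l = l, OF K(2)]
    by (auto simp: K(3) K1_def K2_def j'_def k1_def k2_def dyadic_rectangle_nonempty)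
  have k12: "\<And>i. k1 $ i < 2 ^ (j' $ i)" "\<And>i. k2 $ i < 2 ^ (j' $ i)"
    using dyadic_rectangle_split(3,4)[where l = l, OF K(2)]
    by (auto simp: j'_def k1_def k2_def)
  have j': "j' $ i \<le> J" for i using j by (simp add: j'_def Suc_leI)
  define m' where "m' = insert K1 (insert K2 (m - {K}))"
  have disj: "A \<inter> B = {}" if "A \<in> m" "B \<in> m" "A \<noteq> B" for A B
    using part that by (auto simp: partition_on_def disjoint_def)
  \<comment> \<open>Both halves are nonempty and lie in \<open>K\<close>, which is disjoint from the
    other cells; so neither is present already and the count rises by exactly one.\<close>
  have new: "K1 \<notin> m - {K}" "K2 \<notin> m - {K}"
    using disj[OF K(1)] K12 by blast+
  have "partition_on unit_cube m'"
  proof (rule partition_onI)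
    have "\<Union>m = unit_cube" using part by (simp add: partition_on_def)
    moreover have "\<Union>m' = \<Union>m" unfolding m'_def using K(1) K12(1) by blast
    ultimately show "\<Union>m' = unit_cube" by simp
    have old: "K1 \<inter> B = {}" "K2 \<inter> B = {}" if "B \<in> m - {K}" for B
      using disj[OF K(1), of B] that K12(1) by auto
    show "disjnt A B" if "A \<in> m'" "B \<in> m'" "A \<noteq> B" for A B
    proof -
      have "A = K1 \<or> A = K2 \<or> A \<in> m - {K}" "B = K1 \<or> B = K2 \<or> B \<in> m - {K}"
        using \<open>A \<in> m'\<close> \<open>B \<in> m'\<close> unfolding m'_def by blast+
      then show ?thesis
        using \<open>A \<noteq> B\<close> old[of A] old[of B] K12(2) disj[of A B] unfolding disjnt_def
        by (elim disjE) (simp_all add: Int_commute)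
    qed
    show "{} \<notin> m'" using K12 part by (auto simp: m'_def partition_on_def)
  qed
  moreover have "finite m'" using fin by (simp add: m'_def)
  moreover have "card m' = Suc D"
  proof -
    have "K1 \<noteq> K2" using K12 by blast
    then have "card m' = Suc (Suc (card (m - {K})))" using new fin by (simp add: m'_def)
    also have "\<dots> = Suc D" using card K(1) fin by (metis card_Suc_Diff1)
    finally show ?thesis .
  qed
  moreover have "\<exists>j k. (\<forall>l. k $ l < 2 ^ (j $ l)) \<and> A = dyadic_rectangle j k \<and> (\<forall>l. j $ l \<le> J)" if "A \<in> m'" for A
  proof -
    consider "A = K1" | "A = K2" | "A \<in> m" using \<open>A \<in> m'\<close> unfolding m'_def by blast
    then show ?thesis
    proof cases
      case 1 then show ?thesis using k12 j' unfolding K1_def by blast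
    next
      case 2 then show ?thesis using k12 j' unfolding K2_def by blast
    next
      case 3 then show ?thesis by (rule dy)
    qed
  qed
  ultimately have "m' \<in> dyadic_partitions (Suc D) J"
    unfolding dyadic_partitions_def half_pow_ge_iff by simp
  moreover have "piecewise_poly m r \<subseteq> piecewise_poly m' r"
    by (rule piecewise_poly_refine) (use K K12(1) in \<open>auto simp: m'_def\<close>)
  ultimately show ?thesis by blast
qed

text \<open>Adaptive constructions yield at most \<open>D\<close> cells, while the theorem asks for
  exactly \<open>D\<close>; this bridges the difference without losing approximants.\<close>

lemma dyadic_partition_refine:
  fixes m :: "(real^'n) set set"
  assumes "m \<in> dyadic_partitions D' J" "D' \<le> D" "D \<le> 2 ^ (J * CARD('n))"
  shows "\<exists>m'\<in>dyadic_partitions D J. piecewise_poly m r \<subseteq> piecewise_poly m' r"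
  using assms(2,3)
proof (induction D rule: dec_induct)
  case base
  then show ?case using assms(1) by blast
next
  case (step n)
  then obtain m1 where "m1 \<in> dyadic_partitions n J" "piecewise_poly m r \<subseteq> piecewise_poly m1 r" by auto
  moreover from this(1) step.prems obtain m' where
    "m' \<in> dyadic_partitions (Suc n) J" "piecewise_poly m1 r \<subseteq> piecewise_poly m' r"
    using dyadic_partition_refine_Suc[of m1 n J r] by (auto simp: Suc_le_eq)
  ultimately show ?case by (meson order_trans)
qed

lemma dyadic_partitions_mono:
  "J \<le> J' \<Longrightarrow> dyadic_partitions D J \<subseteq> dyadic_partitions D J'"
  unfolding dyadic_partitions_def half_pow_ge_iff by clarsimp (meson order_trans)

section \<open>Adaptive partitions\<close>

lemma finite_cell_index_image: "A \<subseteq> unit_cube \<Longrightarrow> finite (cell_index j ` A)"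
  by (rule finite_subset[OF _ finite_vec_box[of "\<lambda>l. {..<2 ^ (j $ l)}"]]) (auto simp: cell_index_less)

lemma card_cell_index_image_le:
  assumes "A \<subseteq> unit_cube"
  shows "card (cell_index j ` A) \<le> (\<Prod>l\<in>UNIV. (2::nat) ^ (j $ l))"
proof -
  have "cell_index j ` A \<subseteq> {k. \<forall>l. k $ l \<in> {..<(2::nat) ^ (j $ l)}}"
    using assms by (auto simp: cell_index_less)
  then have "card (cell_index j ` A) \<le> card {k. \<forall>l. k $ l \<in> {..<(2::nat) ^ (j $ l)}}"
    by (intro card_mono finite_vec_box) auto
  then show ?thesis by (subst (asm) card_vec_box) auto
qed

text \<open>Each point x receives the cell of its finest active level \<open>lev x\<close>. Activity
  at level k depends only on the cell of level k - 1 and passes to coarser levels, so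
  \<open>lev\<close> is constant on the cell assigned to x and these cells form a partition. For the
  count, an active cell has a parent containing a selected cell of some level j >= k, and a parent
  has at most 2^d children: every selected cell of level j is charged once for each level k from k0
  + 1 to j.\<close>

lemma adaptive_dyadic_partition:
  fixes g :: "nat \<Rightarrow> nat^'n" and sel :: "nat \<Rightarrow> real^'n \<Rightarrow> bool"
  assumes g_mono: "\<And>i j l. i \<le> j \<Longrightarrow> g i $ l \<le> g j $ l"
    and g_step: "\<And>i l. g (Suc i) $ l \<le> Suc (g i $ l)"
    and g_le: "\<And>i l. g i $ l \<le> i"
    and k0: "k0 \<le> J"
  defines "S \<equiv> \<lambda>j. cell_index (g j) ` {x \<in> unit_cube. sel j x}"
  shows "\<exists>m. m \<in> dyadic_partitions (card m) J \<and>
     card m \<le> (\<Prod>l\<in>UNIV. 2 ^ (g k0 $ l)) + 2 ^ CARD('n) * (\<Sum>k\<in>{k0<..J}. \<Sum>j\<in>{k..J}. card (S j)) \<and>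
     (\<forall>K\<in>m. \<exists>\<kappa>\<in>{k0..J}. \<exists>x\<in>unit_cube. K = dyadic_cell (g \<kappa>) x \<and> (\<forall>k\<in>{\<kappa><..J}. \<forall>y\<in>K. \<not> sel k y))"
proof -
  define c where "c k x = cell_index (g k) x" for k x
  have c_coarser: "c i x = c i y" if "x \<in> unit_cube" "y \<in> unit_cube" "i \<le> j" "c j x = c j y" for i j x y
    using cell_index_eq_coarser[OF that(1,2), of "g i" "g j"] that(3,4) g_mono by (auto simp: c_def)
  \<comment> \<open>Level \<open>k\<close> has to be resolved around \<open>x\<close> if the level \<open>k - 1\<close> cell of \<open>x\<close> contains a selected cell of level \<open>\<ge> k\<close>.\<close>
  define active where
    "active k x \<longleftrightarrow> (\<exists>j\<in>{k..J}. \<exists>y\<in>unit_cube. c (k - 1) y = c (k - 1) x \<and> sel j y)" for k x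
  have active_cong: "active k x = active k y" if "c (k - 1) x = c (k - 1) y" for k x y
    using that by (simp add: active_def)
  have active_antimono: "active k' x" if *: "x \<in> unit_cube" "active k x" "k' \<le> k" for k k' x
  proof -
    obtain j y where "j \<in> {k..J}" "y \<in> unit_cube" "c (k - 1) y = c (k - 1) x" "sel j y"
      using *(2) unfolding active_def by blast
    moreover from this have "c (k' - 1) y = c (k' - 1) x"
      using c_coarser[of y x "k' - 1" "k - 1"] * by auto
    ultimately show ?thesis using *(3) unfolding active_def by (meson atLeastAtMost_iff order_trans)
  qed
  define L where "L x = {k\<in>{k0..J}. k = k0 \<or> active k x}" for x
  define lev where "lev x = Max (L x)" for x
  have L_fin: "finite (L x)" "L x \<noteq> {}" for x using k0 by (auto simp: L_def)
  have lev_in: "lev x \<in> L x" for x unfolding lev_def by (rule Max_in[OF L_fin])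
  have lev_ge: "k \<le> lev x" if "k \<in> L x" for k x unfolding lev_def by (rule Max_ge[OF L_fin(1) that])
  have lev_bounds: "k0 \<le> lev x" "lev x \<le> J" for x using lev_in[of x] by (auto simp: L_def)
  have lev_cong: "lev y = lev x" if x: "x \<in> unit_cube" and y: "y \<in> unit_cube" and eq: "c (lev x) y = c (lev x) x" for x y
  proof (rule antisym)
    \<comment> \<open>Activity at level k sees only the cell of level k - 1, so agreement at level
      \<open>lev x\<close> decides activity up to \<open>lev x + 1\<close>. This one extra level is
      what excludes a finer level at y.\<close>
    have act: "active k y = active k x" if "k \<le> lev x + 1" for k
      using c_coarser[OF y x _ eq, of "k - 1"] that by (intro active_cong) auto
    show "lev x \<le> lev y"
      using lev_in[of x] act[of "lev x"] by (intro lev_ge) (auto simp: L_def)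
    show "lev y \<le> lev x"
    proof (rule ccontr)
      assume *: "\<not> lev y \<le> lev x"
      then have "active (lev y) y" using lev_in[of y] lev_bounds[of x] by (auto simp: L_def)
      then have "active (lev x + 1) y" using active_antimono[OF y, of "lev y" "lev x + 1"] * by auto
      then have "lev x + 1 \<in> L x" using act[of "lev x + 1"] * lev_bounds[of x] lev_bounds[of y] by (auto simp: L_def)
      then show False using lev_ge[of "lev x + 1" x] by simp
    qed
  qed
  define m where "m = (\<lambda>x. dyadic_cell (g (lev x)) x) ` unit_cube"
  have lev_cell: "lev y = lev x \<and> c (lev x) y = c (lev x) x \<and> y \<in> unit_cube"
    if "x \<in> unit_cube" "y \<in> dyadic_cell (g (lev x)) x" for x y
    using that lev_cong[of x y] mem_dyadic_cell_iff[of x y "g (lev x)"] by (auto simp: c_def)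
  have part: "partition_on unit_cube m"
  proof (rule partition_onI)
    show "\<Union>m = unit_cube"
      unfolding m_def using self_mem_dyadic_cell dyadic_cell_subset_unit_cube by fast
    show "disjnt A B" if AB: "A \<in> m" "B \<in> m" "A \<noteq> B" for A B
    proof -
      obtain x y where x: "x \<in> unit_cube" "A = dyadic_cell (g (lev x)) x"
        and y: "y \<in> unit_cube" "B = dyadic_cell (g (lev y)) y" using AB by (auto simp: m_def)
      have False if "z \<in> A" "z \<in> B" for z
        using lev_cell[OF x(1), of z] lev_cell[OF y(1), of z] that AB(3) x(2) y(2)
        by (simp add: c_def dyadic_cell_def)
      then show ?thesis by (auto simp: disjnt_def)
    qed
    show "{} \<notin> m" unfolding m_def using self_mem_dyadic_cell by blast
  qed
  define A where "A k = c k ` {x \<in> unit_cube. active k x}" for k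
  have A_fin: "finite (A k)" for k unfolding A_def c_def by (rule finite_cell_index_image) auto
  \<comment> \<open>A superset of the partition that is easy to count: the whole base grid together
    with all active cells of finer levels.\<close>
  define U where "U = dyadic_rectangle (g k0) ` (c k0 ` unit_cube) \<union> (\<Union>k\<in>{k0<..J}. dyadic_rectangle (g k) ` A k)"
  have m_sub: "m \<subseteq> U"
  proof
    fix K assume "K \<in> m"
    then obtain x where x: "x \<in> unit_cube" "K = dyadic_rectangle (g (lev x)) (c (lev x) x)"
      by (auto simp: m_def dyadic_cell_def c_def)
    show "K \<in> U"
    proof (cases "lev x = k0")
      case True
      then show ?thesis using x by (simp add: U_def)
    next
      case False
      then have "lev x \<in> {k0<..J}" "active (lev x) x" using lev_in[of x] by (auto simp: L_def)
      then show ?thesis using x unfolding U_def A_def by blast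
    qed
  qed
  have U_fin: "finite U" unfolding U_def using A_fin finite_cell_index_image[of unit_cube "g k0"]
    by (auto simp: c_def)
  have "card m \<le> card U" by (rule card_mono[OF U_fin m_sub])
  also have "\<dots> \<le> card (c k0 ` unit_cube) + (\<Sum>k\<in>{k0<..J}. card (A k))"
    unfolding U_def using A_fin finite_cell_index_image[of unit_cube "g k0"]
    by (intro order_trans[OF card_Un_le] add_mono order_trans[OF card_UN_le] sum_mono card_image_le)
      (auto simp: c_def)
  also have "\<dots> \<le> (\<Prod>l\<in>UNIV. 2 ^ (g k0 $ l)) + (\<Sum>k\<in>{k0<..J}. 2 ^ CARD('n) * (\<Sum>j\<in>{k..J}. card (S j)))"
  proof (intro add_mono sum_mono)
    show "card (c k0 ` unit_cube) \<le> (\<Prod>l\<in>UNIV. 2 ^ (g k0 $ l))"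
      unfolding c_def by (rule card_cell_index_image_le) simp
    fix k assume k: "k \<in> {k0<..J}"
    define coarse where "coarse j v = (\<chi> l. v $ l div 2 ^ (g j $ l - g (k - 1) $ l))" for j and v :: "nat^'n"
    have c_coarse: "c (k - 1) x = coarse j (c j x)" if "x \<in> unit_cube" "k - 1 \<le> j" for j x
      unfolding c_def coarse_def using that g_mono by (intro cell_index_coarser) auto
    define A' where "A' = c (k - 1) ` {x \<in> unit_cube. active k x}"
    define B where "B = {b :: nat^'n. \<forall>l. b $ l \<in> {..<2}}"
    have A'_fin: "finite A'" unfolding A'_def c_def by (rule finite_cell_index_image) auto
    have B: "finite B" "card B = 2 ^ CARD('n)"
      unfolding B_def by (simp_all only: finite_vec_box card_vec_box finite_lessThan) simp
    \<comment> \<open>An index of level k is determined by its parent and the parities of its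
      coordinates, because each side is halved at most once per level. Where a side is not halved,
      the parent already contains the coordinate. The parities produce the factor 2^d.\<close>
    define \<phi> where "\<phi> v = (coarse k v, \<chi> l. v $ l mod 2)" for v
    have "inj_on \<phi> (A k)"
    proof (rule inj_onI)
      fix v w assume eq: "\<phi> v = \<phi> w"
      have "v $ l = w $ l" for l
      proof -
        have "g k $ l \<le> Suc (g (k - 1) $ l)" using g_step[of "k - 1" l] k by simp
        then have "g k $ l - g (k - 1) $ l = 0 \<or> g k $ l - g (k - 1) $ l = 1" by linarith
        moreover have "v $ l mod 2 = w $ l mod 2"
          "v $ l div 2 ^ (g k $ l - g (k - 1) $ l) = w $ l div 2 ^ (g k $ l - g (k - 1) $ l)"
          using eq by (auto simp: \<phi>_def coarse_def vec_eq_iff)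
        ultimately show ?thesis by (metis div_by_1 div_mult_mod_eq power_0 power_one_right)
      qed
      then show "v = w" by (simp add: vec_eq_iff)
    qed
    moreover have "\<phi> ` A k \<subseteq> A' \<times> B"
      using c_coarse[of _ k] by (force simp: A_def A'_def B_def \<phi>_def)
    ultimately have "card (A k) \<le> card (A' \<times> B)"
      by (rule card_inj_on_le) (use A'_fin B in auto)
    also have "\<dots> = 2 ^ CARD('n) * card A'" by (simp add: card_cartesian_product B)
    also have "card A' \<le> (\<Sum>j\<in>{k..J}. card (S j))"
    proof -
      have fin: "finite (S j)" for j unfolding S_def by (rule finite_cell_index_image) auto
      \<comment> \<open>An active parent is the coarsening of the index of some selected cell of
        level j >= k, so there are no more active parents than such selected cells.\<close>
      have "A' \<subseteq> (\<Union>j\<in>{k..J}. coarse j ` S j)"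
      proof
        fix v assume "v \<in> A'"
        then obtain j y where "j \<in> {k..J}" "y \<in> unit_cube" "v = c (k - 1) y" "sel j y"
          unfolding A'_def active_def by auto
        moreover from this have "v = coarse j (c j y)" using c_coarse[of y j] by auto
        ultimately show "v \<in> (\<Union>j\<in>{k..J}. coarse j ` S j)" unfolding S_def c_def by blast
      qed
      then have "card A' \<le> card (\<Union>j\<in>{k..J}. coarse j ` S j)" using fin by (intro card_mono) auto
      also have "\<dots> \<le> (\<Sum>j\<in>{k..J}. card (S j))"
        using fin by (intro order_trans[OF card_UN_le] sum_mono card_image_le) auto
      finally show ?thesis .
    qed
    finally show "card (A k) \<le> 2 ^ CARD('n) * (\<Sum>j\<in>{k..J}. card (S j))" by simp
  qed
  finally have card_m: "card m \<le> (\<Prod>l\<in>UNIV. 2 ^ (g k0 $ l)) + 2 ^ CARD('n) * (\<Sum>k\<in>{k0<..J}. \<Sum>j\<in>{k..J}. card (S j))"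
    by (simp add: sum_distrib_left)
  have cell: "\<exists>\<kappa>\<in>{k0..J}. \<exists>x\<in>unit_cube. K = dyadic_cell (g \<kappa>) x \<and> (\<forall>k\<in>{\<kappa><..J}. \<forall>y\<in>K. \<not> sel k y)" if K: "K \<in> m" for K
  proof -
    obtain x where x: "x \<in> unit_cube" "K = dyadic_cell (g (lev x)) x" using K by (auto simp: m_def)
    have "\<not> sel k y" if k: "k \<in> {lev x<..J}" and y: "y \<in> K" for k y
    proof
      assume "sel k y"
      have yx: "lev y = lev x" "y \<in> unit_cube" using lev_cell[OF x(1), of y] y x(2) by auto
      then have "active k y" using \<open>sel k y\<close> k unfolding active_def by force
      then have "k \<in> L y" using k lev_bounds[of x] by (auto simp: L_def)
      then show False using lev_ge[of k y] k yx by auto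
    qed
    then show ?thesis using x lev_bounds[of x] by (intro bexI[of _ "lev x"] bexI[of _ x]) auto
  qed
  have "m \<in> dyadic_partitions (card m) J"
  proof -
    have "finite m" using finite_subset[OF m_sub U_fin] .
    moreover have "\<exists>j k. (\<forall>l. k $ l < 2 ^ (j $ l)) \<and> K = dyadic_rectangle j k \<and> (\<forall>l. j $ l \<le> J)" if K: "K \<in> m" for K
    proof -
      obtain x where x: "x \<in> unit_cube" "K = dyadic_rectangle (g (lev x)) (cell_index (g (lev x)) x)"
        using K by (auto simp: m_def dyadic_cell_def)
      moreover have "\<forall>l. g (lev x) $ l \<le> J" using g_le lev_bounds(2) order_trans by blast
      ultimately show ?thesis using cell_index_less[OF x(1)] by blast
    qed
    ultimately show ?thesis using part unfolding dyadic_partitions_def half_pow_ge_iff by simp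
  qed
  then show ?thesis using card_m cell by blast
qed

section \<open>Anisotropic grids and large cells\<close>

definition grid_level :: "real^'n \<Rightarrow> nat \<Rightarrow> nat^'n" where
  "grid_level \<sigma> j = (\<chi> l. nat \<lfloor>real j * smin \<sigma> / \<sigma> $ l\<rfloor>)"

text \<open>This is V = a d / H(\<sigma>), since 1 / H is the mean of the 1 / \<sigma>_l; it is the
  growth exponent of the number of cells per level.\<close>

definition grid_rate :: "real^'n \<Rightarrow> real" where
  "grid_rate \<sigma> = (\<Sum>l\<in>UNIV. smin \<sigma> / \<sigma> $ l)"

lemma smin_le: "smin \<sigma> \<le> \<sigma> $ l"
  unfolding smin_def by (intro Min_le) auto

lemma smin_pos: "(\<And>l. 0 < \<sigma> $ l) \<Longrightarrow> 0 < smin \<sigma>"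
  unfolding smin_def by (subst Min_gr_iff) auto

lemma grid_level_mono:
  assumes "\<And>l. 0 < \<sigma> $ l" "i \<le> j"
  shows "grid_level \<sigma> i $ l \<le> grid_level \<sigma> j $ l"
proof -
  have "real i * smin \<sigma> / \<sigma> $ l \<le> real j * smin \<sigma> / \<sigma> $ l"
    using assms smin_pos[of \<sigma>] less_imp_le[OF assms(1)] by (intro divide_right_mono mult_right_mono) auto
  then show ?thesis by (simp add: grid_level_def nat_mono floor_mono)
qed

text \<open>The increment a / \<sigma>_l is at most 1, so a floor rises by at most one. Two
  consequences matter: a cell has at most 2^d children, and the sides at level k are at least 2^-k,
  which makes levels up to \<open>J\<close> admissible.\<close>

lemma grid_level_Suc_le:
  assumes "\<And>l. 0 < \<sigma> $ l"
  shows "grid_level \<sigma> (Suc i) $ l \<le> Suc (grid_level \<sigma> i $ l)"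
proof -
  have "real (Suc i) * smin \<sigma> / \<sigma> $ l = real i * smin \<sigma> / \<sigma> $ l + smin \<sigma> / \<sigma> $ l"
    by (simp add: add_divide_distrib distrib_right)
  also have "smin \<sigma> / \<sigma> $ l \<le> 1" using smin_le[of \<sigma> l] assms by simp
  finally have "\<lfloor>real (Suc i) * smin \<sigma> / \<sigma> $ l\<rfloor> \<le> \<lfloor>real i * smin \<sigma> / \<sigma> $ l\<rfloor> + 1"
    by linarith
  moreover have "0 \<le> real i * smin \<sigma> / \<sigma> $ l"
    using assms smin_pos[of \<sigma>] by (simp add: less_imp_le)
  ultimately show ?thesis by (simp add: grid_level_def)
qed

lemma grid_level_0 [simp]: "grid_level \<sigma> 0 $ l = 0"
  by (simp add: grid_level_def)

lemma grid_level_le: "(\<And>l. 0 < \<sigma> $ l) \<Longrightarrow> grid_level \<sigma> i $ l \<le> i"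
proof (induction i)
  case (Suc i)
  then show ?case using grid_level_Suc_le[of \<sigma> i l] by simp
qed simp

lemma prod_grid_level_le:
  assumes "\<And>l. 0 < \<sigma> $ l"
  shows "real (\<Prod>l\<in>UNIV. 2 ^ (grid_level \<sigma> j $ l)) \<le> 2 powr (real j * grid_rate \<sigma>)"
proof -
  have "real (grid_level \<sigma> j $ l) \<le> real j * (smin \<sigma> / \<sigma> $ l)" for l
    using assms smin_pos[of \<sigma>] by (simp add: grid_level_def less_imp_le)
  then have "(\<Sum>l\<in>UNIV. real (grid_level \<sigma> j $ l)) \<le> real j * grid_rate \<sigma>"
    unfolding grid_rate_def sum_distrib_left by (intro sum_mono)
  then have "2 powr (\<Sum>l\<in>UNIV. real (grid_level \<sigma> j $ l)) \<le> 2 powr (real j * grid_rate \<sigma>)" by simp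
  also have "2 powr (\<Sum>l\<in>UNIV. real (grid_level \<sigma> j $ l)) = real (\<Prod>l\<in>UNIV. 2 ^ (grid_level \<sigma> j $ l))"
    by (simp add: powr_sum powr_realpow)
  finally show ?thesis .
qed

lemma dyadic_grid_eq: "dyadic_grid \<sigma> j = dyadic_cell (grid_level \<sigma> j) ` unit_cube"
proof (intro equalityI subsetI)
  fix K assume "K \<in> dyadic_grid \<sigma> j"
  then obtain i k where K: "K = dyadic_rectangle i k" "\<And>l. k $ l < 2 ^ (i $ l)" and i: "\<And>l. i $ l = grid_level \<sigma> j $ l"
    by (auto simp: dyadic_grid_def grid_level_def)
  have "i = grid_level \<sigma> j" using i by (simp add: vec_eq_iff)
  obtain x where "x \<in> K" using dyadic_rectangle_nonempty K(1) by blast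
  moreover from this have "x \<in> unit_cube" using dyadic_rectangle_subset_unit_cube[of k i] K by blast
  ultimately show "K \<in> dyadic_cell (grid_level \<sigma> j) ` unit_cube"
    using mem_dyadic_rectangle_iff[of x i k] K(1) \<open>i = _\<close> by (auto simp: dyadic_cell_def)
next
  fix K assume "K \<in> dyadic_cell (grid_level \<sigma> j) ` unit_cube"
  then obtain x where "x \<in> unit_cube" "K = dyadic_rectangle (grid_level \<sigma> j) (cell_index (grid_level \<sigma> j) x)"
    by (auto simp: dyadic_cell_def)
  then show "K \<in> dyadic_grid \<sigma> j"
    using cell_index_less[of x "grid_level \<sigma> j"] unfolding dyadic_grid_def grid_level_def
    by (intro CollectI exI[of _ "\<chi> l. nat \<lfloor>real j * smin \<sigma> / \<sigma> $ l\<rfloor>"] exI) auto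
qed

lemma piecewise_poly_measurable:
  assumes "countable m" "\<And>K. K \<in> m \<Longrightarrow> K \<in> sets borel" "unit_cube \<subseteq> \<Union>m" "t \<in> piecewise_poly m r"
  shows "t \<in> borel_measurable (lebesgue_on unit_cube)"
proof (rule measurable_piecewise_restrict[OF assms(1)])
  fix K assume K: "K \<in> m"
  have "K \<in> sets lebesgue" using assms(2)[OF K] by simp
  then show "K \<inter> space (lebesgue_on unit_cube) \<in> sets (lebesgue_on unit_cube)"
    by (auto simp: sets_restrict_space)
  obtain P where P: "coord_polynomial r P" "\<And>x. x \<in> K \<Longrightarrow> t x = P x"
    using assms(4) K unfolding piecewise_poly_def by blast
  have "P \<in> borel_measurable borel"
    using P(1) by (intro borel_measurable_continuous_onI continuous_on_coord_polynomial)
  then have "P \<in> borel_measurable (lebesgue_on unit_cube)"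
    by (intro measurable_restrict_space1 measurable_completion) simp
  then have "P \<in> borel_measurable (restrict_space (lebesgue_on unit_cube) K)"
    by (rule measurable_restrict_space1)
  then show "t \<in> borel_measurable (restrict_space (lebesgue_on unit_cube) K)"
    by (rule measurable_cong[THEN iffD1, rotated]) (simp add: space_restrict_space P(2))
qed (use assms(3) in simp)

lemma finite_dyadic_cells: "finite (dyadic_cell j ` unit_cube)"
proof -
  have "dyadic_cell j ` unit_cube = dyadic_rectangle j ` cell_index j ` unit_cube"
    by (auto simp: dyadic_cell_def)
  then show ?thesis using finite_cell_index_image[of unit_cube j] by simp
qed

lemma piecewise_poly_dyadic_cells_measurable:
  assumes "t \<in> piecewise_poly (dyadic_cell j ` unit_cube) r"
  shows "t \<in> borel_measurable (lebesgue_on unit_cube)"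
proof (rule piecewise_poly_measurable[OF _ _ _ assms])
  show "countable (dyadic_cell j ` unit_cube)" by (rule countable_finite[OF finite_dyadic_cells])
  show "K \<in> sets borel" if "K \<in> dyadic_cell j ` unit_cube" for K
    using that by (auto simp: dyadic_cell_def)
  show "unit_cube \<subseteq> \<Union>(dyadic_cell j ` unit_cube)" using self_mem_dyadic_cell by blast
qed

text \<open>Each counted cell contains a subbox of a fixed relative volume on which |Q| >= \<tau> /
  2. Subboxes of different cells are disjoint, so their joint contribution to the integral of |Q|^p
  is proportional to the number of counted cells.\<close>

lemma card_large_cells_le:
  "\<exists>\<rho>>0. \<forall>(Q :: real^'n \<Rightarrow> real) j \<tau> p b. Q \<in> piecewise_poly (dyadic_cell j ` unit_cube) r \<longrightarrow> 0 < \<tau> \<longrightarrow> 0 < p \<longrightarrow> 0 \<le> b \<longrightarrow>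
     (\<integral>\<^sup>+x. ennreal (\<bar>Q x\<bar> powr p) \<partial>lebesgue_on unit_cube) \<le> ennreal b \<longrightarrow>
     real (card (cell_index j ` {x \<in> unit_cube. \<exists>z\<in>dyadic_cell j x. \<bar>Q z\<bar> > \<tau>})) * (\<tau> / 2) powr p * \<rho>
       \<le> b * real (\<Prod>l\<in>UNIV. 2 ^ (j $ l))"
proof -
  obtain \<rho> where \<rho>: "\<rho> > 0" and large: "\<And>(Q :: real^'n \<Rightarrow> real) a h x0. coord_polynomial r Q \<Longrightarrow>
      \<forall>l. h $ l > 0 \<Longrightarrow> x0 \<in> cbox a (a+h) \<Longrightarrow>
      \<exists>u. box u (u + \<rho> *\<^sub>R h) \<subseteq> box a (a+h) \<and> (\<forall>x\<in>box u (u + \<rho> *\<^sub>R h). \<bar>Q x\<bar> \<ge> \<bar>Q x0\<bar> / 2)"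
    using coord_polynomial_large_subbox[of r] by blast
  have "real (card (cell_index j ` {x \<in> unit_cube. \<exists>z\<in>dyadic_cell j x. \<bar>Q z\<bar> > \<tau>})) * (\<tau> / 2) powr p * \<rho> ^ CARD('n)
       \<le> b * real (\<Prod>l\<in>UNIV. 2 ^ (j $ l))"
    if Q: "Q \<in> piecewise_poly (dyadic_cell j ` unit_cube) r" and \<tau>: "0 < \<tau>" and p: "0 < p" and b: "0 \<le> b"
      and int: "(\<integral>\<^sup>+x. ennreal (\<bar>Q x\<bar> powr p) \<partial>lebesgue_on unit_cube) \<le> ennreal b"
    for Q :: "real^'n \<Rightarrow> real" and j \<tau> p b
  proof -
    define I where "I = cell_index j ` {x \<in> unit_cube. \<exists>z\<in>dyadic_cell j x. \<bar>Q z\<bar> > \<tau>}"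
    define h :: "real^'n" where "h = (\<chi> l. (1/2) ^ (j $ l))"
    have I_fin: "finite I" unfolding I_def by (rule finite_cell_index_image) auto
    have "\<exists>u. box u (u + \<rho> *\<^sub>R h) \<subseteq> dyadic_rectangle j k \<inter> unit_cube \<and> (\<forall>x\<in>box u (u + \<rho> *\<^sub>R h). \<bar>Q x\<bar> \<ge> \<tau> / 2)"
      if k: "k \<in> I" for k
    proof -
      obtain x z where xz: "x \<in> unit_cube" "k = cell_index j x" "z \<in> dyadic_cell j x" "\<bar>Q z\<bar> > \<tau>"
        using k by (auto simp: I_def)
      obtain P where P: "coord_polynomial r P" "\<And>y. y \<in> dyadic_cell j x \<Longrightarrow> Q y = P y"
        using Q xz(1) unfolding piecewise_poly_def by blast
      define a :: "real^'n" where "a = (\<chi> l. real (k $ l) * (1/2) ^ (j $ l))"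
      have cell: "box a (a + h) \<subseteq> dyadic_cell j x" "dyadic_cell j x \<subseteq> cbox a (a + h)"
        using dyadic_rectangle_between_boxes(1)[of k j] dyadic_rectangle_between_boxes(2)[of j k]
        by (simp_all add: dyadic_cell_def a_def h_def xz(2))
      have "\<forall>l. h $ l > 0" by (simp add: h_def)
      moreover have "z \<in> cbox a (a + h)" using cell(2) xz(3) by blast
      ultimately obtain u where u: "box u (u + \<rho> *\<^sub>R h) \<subseteq> box a (a+h)"
        "\<And>y. y \<in> box u (u + \<rho> *\<^sub>R h) \<Longrightarrow> \<bar>P y\<bar> \<ge> \<bar>P z\<bar> / 2"
        using large[OF P(1)] by blast
      have "\<bar>Q y\<bar> \<ge> \<tau> / 2" if "y \<in> box u (u + \<rho> *\<^sub>R h)" for y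
      proof -
        have "y \<in> dyadic_cell j x" using that u(1) cell(1) by blast
        then show ?thesis using u(2)[OF that] P(2)[of y] P(2)[of z] xz(3,4) by simp
      qed
      moreover have "box u (u + \<rho> *\<^sub>R h) \<subseteq> dyadic_rectangle j k \<inter> unit_cube"
        using u(1) cell(1) dyadic_cell_subset_unit_cube[OF xz(1), of j] xz(2) by (auto simp: dyadic_cell_def)
      ultimately show ?thesis by blast
    qed
    then obtain u where u: "\<And>k. k \<in> I \<Longrightarrow> box (u k) (u k + \<rho> *\<^sub>R h) \<subseteq> dyadic_rectangle j k \<inter> unit_cube"
      and Q_large: "\<And>k x. k \<in> I \<Longrightarrow> x \<in> box (u k) (u k + \<rho> *\<^sub>R h) \<Longrightarrow> \<bar>Q x\<bar> \<ge> \<tau> / 2"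
      by metis
    define W where "W k = box (u k) (u k + \<rho> *\<^sub>R h)" for k
    define h0 where "h0 = (\<Prod>l\<in>(UNIV::'n set). \<rho> * (1/2) ^ (j $ l))"
    have W: "W k \<in> sets borel" "emeasure lborel (W k) = ennreal h0" for k
    proof -
      show "W k \<in> sets borel" by (simp add: W_def)
      have "\<And>l. (\<rho> *\<^sub>R h) $ l \<ge> 0" using \<rho> by (simp add: h_def)
      from emeasure_box_plus_vec(1)[of "\<rho> *\<^sub>R h", OF this] show "emeasure lborel (W k) = ennreal h0"
        by (simp add: W_def h0_def h_def)
    qed
    have disj: "disjoint_family_on W I"
      unfolding disjoint_family_on_def
    proof (intro ballI impI)
      fix k k' assume k: "k \<in> I" "k' \<in> I" "k \<noteq> k'"
      then show "W k \<inter> W k' = {}"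
        using u[OF k(1)] u[OF k(2)] mem_dyadic_rectangle_iff[of _ j k] mem_dyadic_rectangle_iff[of _ j k']
        unfolding W_def by blast
    qed
    define X where "X = (\<Union>k\<in>I. W k)"
    have X: "X \<in> sets borel" unfolding X_def using I_fin W(1) by auto
    have X_sub: "X \<subseteq> unit_cube" unfolding X_def W_def using u by blast
    have "emeasure (lebesgue_on unit_cube) X = emeasure lebesgue X"
      using X_sub by (intro emeasure_restrict_space) auto
    also have "\<dots> = emeasure lborel X" using X by simp
    also have "\<dots> = (\<Sum>k\<in>I. emeasure lborel (W k))"
      unfolding X_def using W(1) disj I_fin by (intro sum_emeasure[symmetric]) auto
    also have "\<dots> = ennreal (real (card I) * h0)"
      using \<rho> by (simp add: W(2) ennreal_mult h0_def prod_nonneg ennreal_of_nat_eq_real_of_nat)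
    finally have em: "emeasure (lebesgue_on unit_cube) X = ennreal (real (card I) * h0)" .
    have X_sets: "X \<in> sets (lebesgue_on unit_cube)"
    proof -
      have "X \<in> sets lebesgue" using X by simp
      then show ?thesis using X_sub by (auto simp: sets_restrict_space image_iff intro!: bexI[of _ X])
    qed
    have "ennreal ((\<tau> / 2) powr p) * emeasure (lebesgue_on unit_cube) X
        = (\<integral>\<^sup>+x. ennreal ((\<tau> / 2) powr p) * indicator X x \<partial>lebesgue_on unit_cube)"
      by (rule nn_integral_cmult_indicator[OF X_sets, symmetric])
    also have "\<dots> \<le> (\<integral>\<^sup>+x. ennreal (\<bar>Q x\<bar> powr p) \<partial>lebesgue_on unit_cube)"
    proof (rule nn_integral_mono)
      fix x
      have "(\<tau> / 2) powr p \<le> \<bar>Q x\<bar> powr p" if "x \<in> X"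
        using that Q_large \<tau> p unfolding X_def W_def by (intro powr_mono2) auto
      then show "ennreal ((\<tau> / 2) powr p) * indicator X x \<le> ennreal (\<bar>Q x\<bar> powr p)"
        by (auto simp: indicator_def intro: ennreal_leI)
    qed
    also have "\<dots> \<le> ennreal b" by (rule int)
    finally have "ennreal ((\<tau> / 2) powr p * (real (card I) * h0)) \<le> ennreal b"
      unfolding em by (simp add: ennreal_mult')
    then have *: "(\<tau> / 2) powr p * (real (card I) * h0) \<le> b" using b by (simp add: ennreal_le_iff)
    \<comment> \<open>\<open>h0\<close> is the volume of one subbox and the product is the
      reciprocal of the volume of a cell. The relative volume \<rho>^d is the constant delivered by
      the lemma.\<close>
    have "h0 * real (\<Prod>l\<in>UNIV. 2 ^ (j $ l)) = \<rho> ^ CARD('n)"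
      by (simp add: h0_def prod.distrib[symmetric] power_divide)
    moreover have "(\<tau> / 2) powr p * (real (card I) * h0) * real (\<Prod>l\<in>UNIV. 2 ^ (j $ l)) \<le> b * real (\<Prod>l\<in>UNIV. 2 ^ (j $ l))"
      using * by (rule mult_right_mono) (simp add: prod_nonneg)
    moreover have "(\<tau> / 2) powr p * (real (card I) * h0) * N = real (card I) * (\<tau> / 2) powr p * (h0 * N)" for N
      by simp
    ultimately show ?thesis unfolding I_def[symmetric] by metis
  qed
  moreover have "\<rho> ^ CARD('n) > 0" using \<rho> by simp
  ultimately show ?thesis by blast
qed

section \<open>Lebesgue norm estimates\<close>

text \<open>The graph of t^q lies above its tangent at F. For F = 0 the convention 0 powr 0 = 0
  makes the left side vanish even when q = 1.\<close>

lemma powr_ge_tangent: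
  fixes y F q :: real
  assumes "q \<ge> 1" "y \<ge> 0" "F \<ge> 0"
  shows "F powr q + q * F powr (q - 1) * (y - F) \<le> y powr q"
proof (cases "F = 0 \<or> y = 0")
  case True
  then show ?thesis
  proof (elim disjE)
    assume "y = 0"
    have "F powr q = F powr (q - 1) * F" if "F > 0" using that by (simp add: powr_diff)
    moreover have "1 * (F powr (q - 1) * F) \<le> q * (F powr (q - 1) * F)"
      using assms by (intro mult_right_mono) auto
    ultimately show ?thesis using \<open>y = 0\<close> assms by (cases "F = 0") (auto simp: mult_ac)
  qed (use assms in auto)
next
  case False
  then have pos: "F > 0" "y > 0" using assms by auto
  define z where "z = y / F"
  \<comment> \<open>Weighted AM-GM applied to z^q and 1 is Bernoulli's inequality 1 + q (z - 1) <=
    z^q in disguise; scaling by F^q turns it into the tangent inequality.\<close>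
  have "(z powr q) powr (1 / q) * 1 powr (1 - 1 / q) \<le> 1 / q * z powr q + (1 - 1 / q) * 1"
    using assms pos by (intro Youngs_inequality_0) (auto simp: z_def)
  then have "z \<le> 1 / q * z powr q + (1 - 1 / q)" using assms pos by (simp add: powr_powr z_def)
  then have "q * z \<le> q * (1 / q * z powr q + (1 - 1 / q))" using assms by (intro mult_left_mono) auto
  also have "\<dots> = z powr q + (q - 1)" using assms by (simp add: distrib_left right_diff_distrib)
  finally have "1 + q * (z - 1) \<le> z powr q" by (simp add: algebra_simps)
  then have "F powr q * (1 + q * (z - 1)) \<le> F powr q * z powr q" by (rule mult_left_mono) simp
  also have "F powr q * z powr q = y powr q" using pos by (simp add: z_def powr_divide)
  also have "F powr q * (1 + q * (z - 1)) = F powr q + q * F powr (q - 1) * (y - F)"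
    using pos by (simp add: z_def powr_diff field_simps)
  finally show ?thesis .
qed

text \<open>Jensen's inequality with infinitely many weights. The tangent is taken at
  \<open>F\<close> instead of the mean: its slope is nonnegative and the mean is at least
  \<open>F\<close>, so summing the tangent inequalities suffices. When the right side is finite, y
  <= 1 + y^q makes the mean converge.\<close>

lemma powr_suminf_convex:
  fixes w y :: "nat \<Rightarrow> real"
  assumes q: "q \<ge> 1" and w: "\<And>k. w k > 0" "w sums 1" and y: "\<And>k. y k \<ge> 0" and F: "F \<ge> 0"
    and le: "ennreal F \<le> (\<Sum>k. ennreal (w k * y k))"
  shows "ennreal (F powr q) \<le> (\<Sum>k. ennreal (w k * y k powr q))"
proof (cases "(\<Sum>k. ennreal (w k * y k powr q)) = top")
  case False
  have nn: "w k * y k powr q \<ge> 0" "w k * y k \<ge> 0" for k using w(1)[of k] y[of k] by auto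
  have s: "summable (\<lambda>k. w k * y k powr q)"
    using False nn by (intro summable_suminf_not_top) auto
  have "y k \<le> 1 + y k powr q" for k
  proof (cases "y k \<le> 1")
    case False
    then have "y k powr 1 \<le> y k powr q" using q by (intro powr_mono) auto
    then show ?thesis using False by simp
  qed (simp add: add_increasing2)
  then have "w k * y k \<le> w k * (1 + y k powr q)" for k
    using w(1)[of k] by (intro mult_left_mono) auto
  then have "norm (w k * y k) \<le> w k + w k * y k powr q" for k
    using nn(2)[of k] by (simp add: distrib_left)
  then have s': "summable (\<lambda>k. w k * y k)"
    using summable_add[OF sums_summable[OF w(2)] s] by (rule summable_comparison_test'[rotated])
  have F_le: "F \<le> (\<Sum>k. w k * y k)"
    using le F nn(2) s' by (simp add: suminf_ennreal2 suminf_nonneg)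
  have sw: "summable (\<lambda>k. w k * c)" for c using sums_summable[OF w(2)] by (rule summable_mult2)
  have "F powr q + q * F powr (q - 1) * ((\<Sum>k. w k * y k) - F)
      = (\<Sum>k. w k * (F powr q) + q * F powr (q - 1) * (w k * y k - w k * F))"
    using s' sw w(2) sums_summable[OF w(2)]
    by (simp add: suminf_add[symmetric] suminf_mult suminf_diff[symmetric] suminf_mult2[symmetric]
        summable_diff summable_mult sums_unique[symmetric])
  also have "\<dots> \<le> (\<Sum>k. w k * y k powr q)"
  proof (rule suminf_le)
    fix k
    have "w k * (F powr q + q * F powr (q - 1) * (y k - F)) \<le> w k * y k powr q"
      using w(1)[of k] powr_ge_tangent[OF q y[of k] F] by (intro mult_left_mono) auto
    then show "w k * (F powr q) + q * F powr (q - 1) * (w k * y k - w k * F) \<le> w k * y k powr q"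
      by (simp add: algebra_simps)
  qed (use s s' sw in \<open>auto intro!: summable_add summable_mult summable_diff\<close>)
  finally have "F powr q + q * F powr (q - 1) * ((\<Sum>k. w k * y k) - F) \<le> (\<Sum>k. w k * y k powr q)" .
  moreover have "q * F powr (q - 1) * ((\<Sum>k. w k * y k) - F) \<ge> 0" using F_le q by simp
  ultimately have "F powr q \<le> (\<Sum>k. w k * y k powr q)" by linarith
  then have "ennreal (F powr q) \<le> ennreal (\<Sum>k. w k * y k powr q)" by (rule ennreal_leI)
  also have "\<dots> = (\<Sum>k. ennreal (w k * y k powr q))" using s nn(1) by (simp add: suminf_ennreal2)
  finally show ?thesis .
qed simp

text \<open>Minkowski's inequality for series. With weights proportional to \<open>E k\<close>, the
  sum of the G_k is the convex combination of the G_k / w_k, and Jensen applies pointwise; these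
  weights make all summands contribute in proportion to \<open>w k\<close> after
  integration.\<close>

lemma nn_integral_powr_suminf_le:
  fixes G :: "nat \<Rightarrow> 'a \<Rightarrow> real"
  assumes q: "q \<ge> 1" and G_nn: "\<And>k x. G k x \<ge> 0" and G_meas [measurable]: "\<And>k. G k \<in> borel_measurable M"
    and E: "\<And>k. E k > 0" "summable E"
    and G_int: "\<And>k. (\<integral>\<^sup>+x. ennreal (G k x powr q) \<partial>M) \<le> ennreal (E k powr q)"
    and f_nn: "\<And>x. f x \<ge> 0" and f_le: "AE x in M. ennreal (f x) \<le> (\<Sum>k. ennreal (G k x))"
  shows "(\<integral>\<^sup>+x. ennreal (f x powr q) \<partial>M) \<le> ennreal ((\<Sum>k. E k) powr q)"
proof -
  define B where "B = (\<Sum>k. E k)"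
  have B: "B > 0" unfolding B_def using E by (intro suminf_pos) auto
  define w where "w k = E k / B" for k
  have w: "w k > 0" for k using E B by (simp add: w_def)
  have "w sums (B / B)" unfolding w_def B_def using E(2) by (intro sums_divide summable_sums)
  then have w1: "w sums 1" using B by simp
  have "(\<integral>\<^sup>+x. ennreal (f x powr q) \<partial>M) \<le> (\<integral>\<^sup>+x. (\<Sum>k. ennreal (w k * (G k x / w k) powr q)) \<partial>M)"
  proof (rule nn_integral_mono_AE, use f_le in eventually_elim)
    fix x assume "ennreal (f x) \<le> (\<Sum>k. ennreal (G k x))"
    moreover have "w k * (G k x / w k) = G k x" for k using w[of k] by simp
    ultimately show "ennreal (f x powr q) \<le> (\<Sum>k. ennreal (w k * (G k x / w k) powr q))"
      by (intro powr_suminf_convex q w w1 f_nn) (auto simp: G_nn less_imp_le[OF w])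
  qed
  also have "\<dots> = (\<Sum>k. \<integral>\<^sup>+x. ennreal (w k * (G k x / w k) powr q) \<partial>M)"
    by (rule nn_integral_suminf) measurable
  also have "\<dots> \<le> (\<Sum>k. ennreal (w k * B powr q))"
  proof (rule suminf_le)
    fix k
    have "ennreal (w k * (G k x / w k) powr q) = ennreal (w k / w k powr q) * ennreal (G k x powr q)" for x
      using w[of k] G_nn by (simp add: powr_divide ennreal_mult'[symmetric] less_imp_le)
    then have "(\<integral>\<^sup>+x. ennreal (w k * (G k x / w k) powr q) \<partial>M)
        = ennreal (w k / w k powr q) * (\<integral>\<^sup>+x. ennreal (G k x powr q) \<partial>M)"
      by (simp add: nn_integral_cmult)
    also have "\<dots> \<le> ennreal (w k / w k powr q) * ennreal (E k powr q)"
      by (intro mult_left_mono G_int) simp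
    also have "\<dots> = ennreal (w k / w k powr q * E k powr q)"
      using w[of k] by (subst ennreal_mult) auto
    also have "E k = w k * B" using B by (simp add: w_def)
    also have "w k / w k powr q * (w k * B) powr q = w k * B powr q"
      using w[of k] B by (simp add: powr_mult)
    finally show "(\<integral>\<^sup>+x. ennreal (w k * (G k x / w k) powr q) \<partial>M) \<le> ennreal (w k * B powr q)" .
  qed auto
  also have "\<dots> = ennreal (\<Sum>k. w k * B powr q)"
    using w w1 by (intro suminf_ennreal2 summable_mult2 sums_summable) (auto simp: less_imp_le)
  also have "(\<Sum>k. w k * B powr q) = B powr q"
    using w1 by (simp add: suminf_mult2[symmetric] sums_unique[symmetric] sums_summable)
  finally show ?thesis by (simp add: B_def)
qed

lemma ennpowr_le:
  assumes "x \<le> ennreal (B powr q)" "B \<ge> 0" "q > 0"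
  shows "ennpowr x (1 / q) \<le> ennreal B"
proof -
  have fin: "x \<noteq> \<infinity>" using assms(1) by (auto simp: top_unique)
  have "enn2real x \<le> B powr q" using assms(1) by (intro enn2real_leI) auto
  then have "enn2real x powr (1 / q) \<le> (B powr q) powr (1 / q)" using assms by (intro powr_mono2) auto
  also have "\<dots> = B" using assms by (simp add: powr_powr)
  finally show ?thesis using fin by (simp add: ennpowr_def ennreal_leI)
qed

lemma le_of_ennpowr_le:
  assumes "ennpowr x (1 / q) \<le> ennreal B" "B \<ge> 0" "q > 0"
  shows "x \<le> ennreal (B powr q)"
proof -
  have fin: "x \<noteq> \<infinity>" using assms(1) by (auto simp: ennpowr_def top_unique)
  then have "enn2real x powr (1 / q) \<le> B" using assms by (simp add: ennpowr_def)
  then have "(enn2real x powr (1 / q)) powr q \<le> B powr q" using assms by (intro powr_mono2) auto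
  then have "enn2real x \<le> B powr q" using assms by (simp add: powr_powr)
  then have "ennreal (enn2real x) \<le> ennreal (B powr q)" by (rule ennreal_leI)
  moreover have "ennreal (enn2real x) = x" using fin by (intro ennreal_enn2real) (simp add: less_top)
  ultimately show ?thesis by simp
qed

text \<open>The two forms of the norm are treated together: pointwise bounds add up for q =
  \<infinity>, and Minkowski's inequality handles finite q.\<close>

lemma Lnorm_le_suminf:
  fixes G :: "nat \<Rightarrow> real^'n \<Rightarrow> real"
  assumes q: "1 \<le> q" and f: "f \<in> borel_measurable (lebesgue_on unit_cube)"
    and G_nn: "\<And>k x. G k x \<ge> 0" and G_meas: "\<And>k. G k \<in> borel_measurable (lebesgue_on unit_cube)"
    and E: "\<And>k. E k > 0" "summable E"
    and G_sup: "\<And>k x. q = \<infinity> \<Longrightarrow> x \<in> unit_cube \<Longrightarrow> G k x \<le> E k"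
    and G_int: "\<And>k. q \<noteq> \<infinity> \<Longrightarrow>
      (\<integral>\<^sup>+x. ennreal (G k x powr enn2real q) \<partial>lebesgue_on unit_cube) \<le> ennreal (E k powr enn2real q)"
    and f_le: "AE x in lebesgue_on unit_cube. ennreal \<bar>f x\<bar> \<le> (\<Sum>k. ennreal (G k x))"
  shows "Lnorm q f \<le> ennreal (\<Sum>k. E k)"
proof (cases "q = \<infinity>")
  case True
  have sum_le: "(\<Sum>k. ennreal (G k x)) \<le> ennreal (\<Sum>k. E k)" if "x \<in> unit_cube" for x
  proof -
    have "(\<Sum>k. ennreal (G k x)) \<le> (\<Sum>k. ennreal (E k))"
      using G_sup[OF True that] by (intro suminf_le ennreal_leI) auto
    also have "\<dots> = ennreal (\<Sum>k. E k)" using E by (intro suminf_ennreal2) (auto simp: less_imp_le)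
    finally show ?thesis .
  qed
  have "AE x in lebesgue_on unit_cube. ennreal \<bar>f x\<bar> \<le> ennreal (\<Sum>k. E k)"
    using f_le AE_space
  proof eventually_elim
    case (elim x)
    then show ?case using sum_le[of x] by (auto intro: order_trans)
  qed
  moreover have "(\<lambda>x. ennreal \<bar>f x\<bar>) \<in> borel_measurable (lebesgue_on unit_cube)" using f by measurable
  ultimately show ?thesis using True by (simp add: Lnorm_def esssup_I)
next
  case False
  have "ennreal 1 \<le> ennreal (enn2real q)" using q False by (simp add: less_top)
  then have q1: "enn2real q \<ge> 1" using enn2real_nonneg[of q] by (subst (asm) ennreal_le_iff) auto
  have "(\<integral>\<^sup>+x. ennreal (\<bar>f x\<bar> powr enn2real q) \<partial>lebesgue_on unit_cube) \<le> ennreal ((\<Sum>k. E k) powr enn2real q)"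
    by (rule nn_integral_powr_suminf_le[OF q1 G_nn G_meas E G_int[OF False] _ f_le]) auto
  moreover have "(\<Sum>k. E k) \<ge> 0" using E by (intro suminf_nonneg) (auto simp: less_imp_le)
  ultimately show ?thesis using False q1 by (simp add: Lnorm_def ennpowr_le)
qed

text \<open>G^q <= \<tau>^(q-p) |Q|^p, that is, interpolation between the sup bound \<tau> and the
  L_p bound. The right side is written as a q-th power to match the shape required by Minkowski's
  inequality.\<close>

lemma nn_integral_truncated_powr_le:
  fixes Q G :: "'a \<Rightarrow> real"
  assumes "0 < p" "p \<le> q" "0 < \<tau>" "0 < b" and Q: "Q \<in> borel_measurable M"
    and G: "\<And>x. x \<in> space M \<Longrightarrow> 0 \<le> G x" "\<And>x. x \<in> space M \<Longrightarrow> G x \<le> \<bar>Q x\<bar>" "\<And>x. x \<in> space M \<Longrightarrow> G x \<le> \<tau>"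
    and int: "(\<integral>\<^sup>+x. ennreal (\<bar>Q x\<bar> powr p) \<partial>M) \<le> ennreal (b powr p)"
  shows "(\<integral>\<^sup>+x. ennreal (G x powr q) \<partial>M) \<le> ennreal ((\<tau> powr (1 - p / q) * b powr (p / q)) powr q)"
proof -
  have "(\<integral>\<^sup>+x. ennreal (G x powr q) \<partial>M) \<le> (\<integral>\<^sup>+x. ennreal (\<tau> powr (q - p)) * ennreal (\<bar>Q x\<bar> powr p) \<partial>M)"
  proof (rule nn_integral_mono)
    fix x assume x: "x \<in> space M"
    have "G x powr q = G x powr (q - p) * G x powr p" by (simp add: powr_add[symmetric])
    also have "\<dots> \<le> \<tau> powr (q - p) * \<bar>Q x\<bar> powr p"
      using G[OF x] assms by (intro mult_mono powr_mono2) auto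
    finally show "ennreal (G x powr q) \<le> ennreal (\<tau> powr (q - p)) * ennreal (\<bar>Q x\<bar> powr p)"
      by (simp add: ennreal_mult'[symmetric] ennreal_leI)
  qed
  also have "\<dots> = ennreal (\<tau> powr (q - p)) * (\<integral>\<^sup>+x. ennreal (\<bar>Q x\<bar> powr p) \<partial>M)"
    using Q by (intro nn_integral_cmult) measurable
  also have "\<dots> \<le> ennreal (\<tau> powr (q - p)) * ennreal (b powr p)" by (intro mult_left_mono int) simp
  also have "\<dots> = ennreal (\<tau> powr (q - p) * b powr p)" by (simp add: ennreal_mult)
  also have "\<tau> powr (q - p) * b powr p = (\<tau> powr (1 - p / q) * b powr (p / q)) powr q"
    using assms by (simp add: powr_mult powr_powr left_diff_distrib)
  finally show ?thesis .
qed

lemma abs_diff_powr_le: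
  fixes a b p :: real
  assumes "p > 0"
  shows "\<bar>a - b\<bar> powr p \<le> 2 powr p * (\<bar>a\<bar> powr p + \<bar>b\<bar> powr p)"
proof -
  have "\<bar>a - b\<bar> powr p \<le> (2 * max \<bar>a\<bar> \<bar>b\<bar>) powr p" using assms by (intro powr_mono2) auto
  also have "\<dots> = 2 powr p * max \<bar>a\<bar> \<bar>b\<bar> powr p" by (simp add: powr_mult)
  also have "\<dots> \<le> 2 powr p * (\<bar>a\<bar> powr p + \<bar>b\<bar> powr p)"
    by (intro mult_left_mono) (auto simp: max_def)
  finally show ?thesis .
qed

text \<open>A quasi-triangle inequality that also covers p < 1. Bounding by twice the larger term
  costs 2, and adding two integrals costs 2 before and 2^(1/p) after taking the p-th root.\<close>

lemma nn_integral_diff_powr_le: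
  fixes f g h :: "'a \<Rightarrow> real"
  assumes p: "p > 0" and meas: "f \<in> borel_measurable M" "g \<in> borel_measurable M" "h \<in> borel_measurable M"
    and int: "(\<integral>\<^sup>+x. ennreal (\<bar>f x - g x\<bar> powr p) \<partial>M) \<le> ennreal (b powr p)"
      "(\<integral>\<^sup>+x. ennreal (\<bar>f x - h x\<bar> powr p) \<partial>M) \<le> ennreal (b powr p)" and b: "b \<ge> 0"
  shows "(\<integral>\<^sup>+x. ennreal (\<bar>g x - h x\<bar> powr p) \<partial>M) \<le> ennreal ((2 * 2 powr (1 / p) * b) powr p)"
proof -
  note [measurable] = meas
  have "(\<integral>\<^sup>+x. ennreal (\<bar>g x - h x\<bar> powr p) \<partial>M)
      \<le> (\<integral>\<^sup>+x. ennreal (2 powr p) * (ennreal (\<bar>f x - g x\<bar> powr p) + ennreal (\<bar>f x - h x\<bar> powr p)) \<partial>M)"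
  proof (rule nn_integral_mono)
    fix x
    have "\<bar>g x - h x\<bar> powr p \<le> 2 powr p * (\<bar>f x - g x\<bar> powr p + \<bar>f x - h x\<bar> powr p)"
      using abs_diff_powr_le[OF p, of "f x - h x" "f x - g x"] by (simp add: add.commute)
    then show "ennreal (\<bar>g x - h x\<bar> powr p)
      \<le> ennreal (2 powr p) * (ennreal (\<bar>f x - g x\<bar> powr p) + ennreal (\<bar>f x - h x\<bar> powr p))"
      by (simp add: ennreal_mult'[symmetric] ennreal_plus[symmetric] ennreal_leI del: ennreal_plus)
  qed
  also have "\<dots> = ennreal (2 powr p) * ((\<integral>\<^sup>+x. ennreal (\<bar>f x - g x\<bar> powr p) \<partial>M) + (\<integral>\<^sup>+x. ennreal (\<bar>f x - h x\<bar> powr p) \<partial>M))"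
    by (simp add: nn_integral_cmult nn_integral_add)
  also have "\<dots> \<le> ennreal (2 powr p) * (ennreal (b powr p) + ennreal (b powr p))"
    by (intro mult_left_mono add_mono int) simp
  also have "\<dots> = ennreal (2 powr p * (2 * b powr p))"
    by (simp add: ennreal_mult'[symmetric] ennreal_plus[symmetric] del: ennreal_plus)
  also have "2 powr p * (2 * b powr p) = (2 * 2 powr (1 / p) * b) powr p"
    using p b by (simp add: powr_mult powr_powr)
  finally show ?thesis .
qed

text \<open>Summable integrals make the series of |s - P_k|^p finite almost everywhere, hence its
  terms vanish in the limit. This supplies the pointwise telescoping expansion of s.\<close>

lemma AE_tendsto_of_summable_powr:
  fixes s :: "'a \<Rightarrow> real" and P :: "nat \<Rightarrow> 'a \<Rightarrow> real"
  assumes p: "p > 0" and [measurable]: "s \<in> borel_measurable M" "\<And>k. P k \<in> borel_measurable M"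
    and int: "\<And>k. (\<integral>\<^sup>+x. ennreal (\<bar>s x - P k x\<bar> powr p) \<partial>M) \<le> ennreal (a k)"
    and a: "\<And>k. a k \<ge> 0" "summable a"
  shows "AE x in M. (\<lambda>k. P k x) \<longlonglongrightarrow> s x"
proof -
  have "(\<integral>\<^sup>+x. (\<Sum>k. ennreal (\<bar>s x - P k x\<bar> powr p)) \<partial>M) = (\<Sum>k. \<integral>\<^sup>+x. ennreal (\<bar>s x - P k x\<bar> powr p) \<partial>M)"
    by (rule nn_integral_suminf) measurable
  also have "\<dots> \<le> (\<Sum>k. ennreal (a k))" by (intro suminf_le int) auto
  also have "\<dots> < \<infinity>" using a by (simp add: suminf_ennreal2)
  finally have "AE x in M. (\<Sum>k. ennreal (\<bar>s x - P k x\<bar> powr p)) \<noteq> \<infinity>"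
    by (intro nn_integral_PInf_AE) auto
  then show ?thesis
  proof eventually_elim
    case (elim x)
    then have "summable (\<lambda>k. \<bar>s x - P k x\<bar> powr p)"
      by (intro summable_suminf_not_top) auto
    then have "(\<lambda>k. \<bar>s x - P k x\<bar> powr p) \<longlonglongrightarrow> 0" by (rule summable_LIMSEQ_zero)
    then have "(\<lambda>k. (\<bar>s x - P k x\<bar> powr p) powr (1 / p)) \<longlonglongrightarrow> 0 powr (1 / p)"
      using p by (intro tendsto_powr2 tendsto_const) auto
    then have "(\<lambda>k. s x - P k x) \<longlonglongrightarrow> 0" using p by (simp add: powr_powr tendsto_rabs_zero_iff)
    then have "(\<lambda>k. s x - (s x - P k x)) \<longlonglongrightarrow> s x - 0" by (intro tendsto_intros)
    then show ?case by simp
  qed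
qed

section \<open>Counts of selected cells, geometric sums and piecewise building blocks\<close>

lemma card_selected_cells_le:
  assumes p: "0 < p"
  shows "\<exists>C\<ge>1. \<forall>(Q :: real^'n \<Rightarrow> real) j \<tau> b. Q \<in> piecewise_poly (dyadic_cell j ` unit_cube) r \<longrightarrow> 0 < \<tau> \<longrightarrow> 0 < b \<longrightarrow>
     (\<integral>\<^sup>+x. ennreal (\<bar>Q x\<bar> powr p) \<partial>lebesgue_on unit_cube) \<le> ennreal (b powr p) \<longrightarrow>
     real (card (cell_index j ` {x \<in> unit_cube. \<exists>z\<in>dyadic_cell j x. \<bar>Q z\<bar> > \<tau>}))
       \<le> (C * b / \<tau>) powr p * real (\<Prod>l\<in>UNIV. 2 ^ (j $ l))"
proof -
  obtain \<rho> where \<rho>: "\<rho> > 0" and large: "\<And>(Q :: real^'n \<Rightarrow> real) j \<tau> b. Q \<in> piecewise_poly (dyadic_cell j ` unit_cube) r \<Longrightarrow> 0 < \<tau> \<Longrightarrow>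
     0 \<le> b \<Longrightarrow> (\<integral>\<^sup>+x. ennreal (\<bar>Q x\<bar> powr p) \<partial>lebesgue_on unit_cube) \<le> ennreal b \<Longrightarrow>
     real (card (cell_index j ` {x \<in> unit_cube. \<exists>z\<in>dyadic_cell j x. \<bar>Q z\<bar> > \<tau>})) * (\<tau> / 2) powr p * \<rho>
       \<le> b * real (\<Prod>l\<in>UNIV. 2 ^ (j $ l))"
    using card_large_cells_le[of r] p by blast
  \<comment> \<open>The 2 undoes the halving of \<tau>, and the power of 1 / \<rho> moves \<rho>
    inside the p-th power. Having C >= 1 later permits replacing C^(1-\<theta>) by C.\<close>
  define C where "C = max 1 (2 * (1 / \<rho>) powr (1 / p))"
  have "real (card (cell_index j ` {x \<in> unit_cube. \<exists>z\<in>dyadic_cell j x. \<bar>Q z\<bar> > \<tau>}))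
       \<le> (C * b / \<tau>) powr p * real (\<Prod>l\<in>UNIV. 2 ^ (j $ l))"
    if Q: "Q \<in> piecewise_poly (dyadic_cell j ` unit_cube) r" and \<tau>: "0 < \<tau>" and b: "0 < b"
      and int: "(\<integral>\<^sup>+x. ennreal (\<bar>Q x\<bar> powr p) \<partial>lebesgue_on unit_cube) \<le> ennreal (b powr p)"
    for Q :: "real^'n \<Rightarrow> real" and j \<tau> b
  proof -
    define N where "N = real (card (cell_index j ` {x \<in> unit_cube. \<exists>z\<in>dyadic_cell j x. \<bar>Q z\<bar> > \<tau>}))"
    define v where "v = real (\<Prod>l\<in>UNIV. 2 ^ (j $ l))"
    have "v \<ge> 0" by (simp add: v_def prod_nonneg)
    have t2: "(\<tau> / 2) powr p > 0" using \<tau> by simp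
    have "N * ((\<tau> / 2) powr p * \<rho>) \<le> b powr p * v"
      using large[OF Q \<tau> _ int] by (simp add: N_def v_def mult.assoc)
    then have "N \<le> b powr p * v / ((\<tau> / 2) powr p * \<rho>)" using t2 \<rho> by (simp add: pos_le_divide_eq)
    also have "\<dots> = (2 * (1 / \<rho>) powr (1 / p) * b / \<tau>) powr p * v"
      using p \<tau> b \<rho> by (simp add: powr_mult powr_divide powr_powr mult_ac)
    also have "\<dots> \<le> (C * b / \<tau>) powr p * v"
      using p \<tau> b \<rho> \<open>v \<ge> 0\<close> by (intro mult_right_mono powr_mono2 divide_right_mono) (auto simp: C_def)
    finally show ?thesis by (simp add: N_def v_def)
  qed
  moreover have "C \<ge> 1" by (simp add: C_def)
  ultimately show ?thesis by blast
qed

text \<open>Used with the threshold C b X and \<theta> = p / q: the error of one level is the size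
  \<open>b\<close> of the increment, enlarged by X^(1-\<theta>) for the relative threshold
  \<open>X\<close>.\<close>

lemma powr_interpolate_le:
  fixes C b X \<theta> :: real
  assumes "C \<ge> 1" "b > 0" "X > 0" "0 \<le> \<theta>" "\<theta> \<le> 1"
  shows "(C * b * X) powr (1 - \<theta>) * b powr \<theta> \<le> C * b * X powr (1 - \<theta>)"
proof -
  have "C powr (1 - \<theta>) \<le> C powr 1" using assms by (intro powr_mono) auto
  then have "C powr (1 - \<theta>) * (b * X powr (1 - \<theta>)) \<le> C * (b * X powr (1 - \<theta>))"
    using assms by (intro mult_right_mono) auto
  moreover have "b powr (1 - \<theta>) * b powr \<theta> = b" using assms by (simp add: powr_add[symmetric])
  then have "(C * b * X) powr (1 - \<theta>) * b powr \<theta> = C powr (1 - \<theta>) * (b * X powr (1 - \<theta>))"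
    using assms by (simp add: powr_mult mult_ac)
  ultimately show ?thesis by (simp add: mult_ac)
qed

lemma sum_geometric_tail_le:
  fixes w :: real
  assumes "0 \<le> w" "w < 1" "c \<le> a"
  shows "(\<Sum>k\<in>{a..b}. w ^ (k - c)) \<le> w ^ (a - c) / (1 - w)"
proof -
  have "(\<Sum>k\<in>{a..b}. w ^ (k - c)) = (\<Sum>k\<in>{a..<a + (Suc b - a)}. w ^ (k - c))"
    by (rule sum.cong) auto
  also have "\<dots> = (\<Sum>i<Suc b - a. w ^ (a - c) * w ^ i)"
    using assms by (subst sum.atLeastLessThan_shift_0)
      (auto simp: power_add[symmetric] atLeast0LessThan intro!: sum.cong)
  also have "\<dots> = w ^ (a - c) * (\<Sum>i<Suc b - a. w ^ i)" by (simp add: sum_distrib_left)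
  also have "(\<Sum>i<Suc b - a. w ^ i) \<le> (\<Sum>i. w ^ i)"
    using assms by (intro sum_le_suminf summable_geometric) auto
  also have "(\<Sum>i. w ^ i) = 1 / (1 - w)" using assms by (intro suminf_geometric) auto
  finally show ?thesis using assms by (simp add: mult_left_mono)
qed

text \<open>Charging a selected cell once for every level above the base costs a factor linear in j
  - k0, which geometric decay absorbs uniformly in \<open>k0\<close> and \<open>J\<close>.\<close>

lemma double_sum_geometric_tail_le:
  fixes w :: real
  assumes w: "0 \<le> w" "w < 1"
  shows "(\<Sum>k\<in>{k0<..J}. \<Sum>j\<in>{k..J}. w ^ (j - k0)) \<le> 1 / (1 - w)\<^sup>2"
proof -
  have "(\<Sum>k\<in>{k0<..J}. \<Sum>j\<in>{k..J}. w ^ (j - k0)) \<le> (\<Sum>k\<in>{k0<..J}. w ^ (k - k0) / (1 - w))"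
    by (intro sum_mono sum_geometric_tail_le w) auto
  also have "\<dots> = (\<Sum>k\<in>{Suc k0..J}. w ^ (k - k0)) / (1 - w)"
    by (simp add: sum_divide_distrib atLeastSucAtMost_greaterThanAtMost)
  also have "\<dots> \<le> w ^ (Suc k0 - k0) / (1 - w) / (1 - w)"
    using w by (intro divide_right_mono sum_geometric_tail_le) auto
  also have "\<dots> \<le> 1 / (1 - w) / (1 - w)"
    using w by (intro divide_right_mono) auto
  finally show ?thesis by (simp add: power2_eq_square)
qed

text \<open>Selection is decided cell by cell, so erasing the selected part keeps the function
  piecewise polynomial and in particular measurable.\<close>

lemma piecewise_poly_if_zero:
  assumes Q: "Q \<in> piecewise_poly (dyadic_cell j ` unit_cube) r"
    and S: "\<And>x y. cell_index j x = cell_index j y \<Longrightarrow> S x = S y"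
  shows "(\<lambda>x. if S x then 0 else Q x) \<in> piecewise_poly (dyadic_cell j ` unit_cube) r"
  unfolding piecewise_poly_def
proof (intro CollectI ballI)
  fix K assume "K \<in> dyadic_cell j ` unit_cube"
  then obtain x where x: "x \<in> unit_cube" "K = dyadic_cell j x" by blast
  obtain P where P: "coord_polynomial r P" "\<And>y. y \<in> K \<Longrightarrow> Q y = P y"
    using Q x unfolding piecewise_poly_def by blast
  have "S y = S x" if "y \<in> K" for y using that x S mem_dyadic_cell_iff by blast
  then show "\<exists>P. coord_polynomial r P \<and> (\<forall>y\<in>K. (if S y then 0 else Q y) = P y)"
    using P coord_polynomial_zero[of r]
    by (intro exI[of _ "if S x then (\<lambda>_. 0) else P"]) simp
qed

lemma grid_poly_diff:
  assumes \<sigma>: "\<And>l. 0 < \<sigma> $ l" and "P \<in> grid_poly r \<sigma> i" "P' \<in> grid_poly r \<sigma> j" "j \<le> i"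
  shows "(\<lambda>x. P x - P' x) \<in> piecewise_poly (dyadic_cell (grid_level \<sigma> i) ` unit_cube) r"
  unfolding piecewise_poly_def
proof (intro CollectI ballI)
  fix K assume "K \<in> dyadic_cell (grid_level \<sigma> i) ` unit_cube"
  then obtain x where x: "x \<in> unit_cube" "K = dyadic_cell (grid_level \<sigma> i) x" by blast
  have "y \<in> dyadic_cell (grid_level \<sigma> j) x" if "y \<in> K" for y
    using that x cell_index_eq_coarser[of y x "grid_level \<sigma> j" "grid_level \<sigma> i"]
      grid_level_mono[OF \<sigma> \<open>j \<le> i\<close>] by (auto simp: mem_dyadic_cell_iff)
  moreover obtain P1 where "coord_polynomial r P1" "\<And>y. y \<in> K \<Longrightarrow> P y = P1 y"
    using assms(2) x unfolding grid_poly_def dyadic_grid_eq piecewise_poly_def by blast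
  moreover obtain P2 where "coord_polynomial r P2" "\<And>y. y \<in> dyadic_cell (grid_level \<sigma> j) x \<Longrightarrow> P' y = P2 y"
    using assms(3) x unfolding grid_poly_def dyadic_grid_eq piecewise_poly_def by blast
  ultimately show "\<exists>Q. coord_polynomial r Q \<and> (\<forall>y\<in>K. P y - P' y = Q y)"
    by (intro exI[of _ "\<lambda>y. P1 y - P2 y"]) (auto intro: coord_polynomial_diff)
qed

lemma sums_geometric_shift:
  fixes v :: real
  assumes "0 < v" "v < 1"
  shows "(\<lambda>i. if n \<le> i then v ^ Suc (i - n) else 0) sums (v / (1 - v))"
proof -
  have "(\<lambda>i. v * v ^ i) sums (v * (1 / (1 - v)))"
    using assms by (intro sums_mult geometric_sums) auto
  then have "(\<lambda>i. (if n \<le> i + n then v ^ Suc (i + n - n) else 0)) sums (v / (1 - v))" by simp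
  then show ?thesis by (subst (asm) sums_zero_iff_shift) auto
qed

section \<open>Adaptive approximation\<close>

text \<open>On a cell of level \<kappa>, each P_k with k <= \<kappa> is a single polynomial because
  the grids are nested and selection is constant there; increments finer than \<kappa> are nowhere
  selected on that cell and drop out.\<close>

lemma adaptive_sum_in_piecewise_poly:
  assumes \<sigma>: "\<And>l. 0 < \<sigma> $ l" and P: "\<And>k. P k \<in> grid_poly r \<sigma> k"
    and sel_cong: "\<And>k x y. cell_index (grid_level \<sigma> k) x = cell_index (grid_level \<sigma> k) y \<Longrightarrow> sel k x = sel k y"
    and m: "\<And>K. K \<in> m \<Longrightarrow> \<exists>\<kappa>\<in>{k0..J}. \<exists>x\<in>unit_cube. K = dyadic_cell (grid_level \<sigma> \<kappa>) x \<and>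
      (\<forall>k\<in>{\<kappa><..J}. \<forall>y\<in>K. \<not> sel k y)"
  shows "(\<lambda>x. P k0 x + (\<Sum>k\<in>{k0<..J}. if sel k x then P k x - P (k - 1) x else 0)) \<in> piecewise_poly m r"
  unfolding piecewise_poly_def
proof (intro CollectI ballI)
  fix K assume "K \<in> m"
  then obtain \<kappa> x where \<kappa>: "k0 \<le> \<kappa>" "\<kappa> \<le> J" and x: "x \<in> unit_cube" "K = dyadic_cell (grid_level \<sigma> \<kappa>) x"
    and unsel: "\<And>k y. k \<in> {\<kappa><..J} \<Longrightarrow> y \<in> K \<Longrightarrow> \<not> sel k y"
    using m by (metis atLeastAtMost_iff)
  have idx: "cell_index (grid_level \<sigma> k) y = cell_index (grid_level \<sigma> k) x" if "y \<in> K" "k \<le> \<kappa>" for y k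
    using that x cell_index_eq_coarser[of y x "grid_level \<sigma> k" "grid_level \<sigma> \<kappa>"]
      grid_level_mono[OF \<sigma> that(2)] by (auto simp: mem_dyadic_cell_iff)
  have "\<exists>q. coord_polynomial r q \<and> (\<forall>y\<in>dyadic_cell (grid_level \<sigma> k) x. P k y = q y)" for k
    using P[of k] x unfolding grid_poly_def dyadic_grid_eq piecewise_poly_def by blast
  then obtain q where q: "\<And>k. coord_polynomial r (q k)"
    and Pq: "\<And>k y. y \<in> dyadic_cell (grid_level \<sigma> k) x \<Longrightarrow> P k y = q k y" by metis
  have Pq: "P k y = q k y" if "y \<in> K" "k \<le> \<kappa>" for k y
    using that x idx[OF that] by (intro Pq) (auto simp: mem_dyadic_cell_iff)
  have sel: "sel k y = sel k x" if "y \<in> K" "k \<le> \<kappa>" for k y using idx[OF that] by (rule sel_cong)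
  let ?T = "\<lambda>y. q k0 y + (\<Sum>k\<in>{k\<in>{k0<..\<kappa>}. sel k x}. q k y - q (k - 1) y)"
  have "P k0 y + (\<Sum>k\<in>{k0<..J}. if sel k y then P k y - P (k - 1) y else 0) = ?T y" if y: "y \<in> K" for y
  proof -
    have "(\<Sum>k\<in>{k0<..J}. if sel k y then P k y - P (k - 1) y else 0)
        = (\<Sum>k\<in>{k\<in>{k0<..\<kappa>}. sel k x}. q k y - q (k - 1) y)"
    proof (rule sum.mono_neutral_cong_right)
      show "{k\<in>{k0<..\<kappa>}. sel k x} \<subseteq> {k0<..J}" using \<kappa> by auto
      show "\<forall>k\<in>{k0<..J} - {k\<in>{k0<..\<kappa>}. sel k x}. (if sel k y then P k y - P (k - 1) y else 0) = 0"
      proof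
        fix k assume "k \<in> {k0<..J} - {k\<in>{k0<..\<kappa>}. sel k x}"
        then have "\<not> sel k y" using unsel[OF _ y, of k] sel[OF y, of k] by (cases "k \<le> \<kappa>") auto
        then show "(if sel k y then P k y - P (k - 1) y else 0) = 0" by simp
      qed
      show "(if sel k y then P k y - P (k - 1) y else 0) = q k y - q (k - 1) y"
        if "k \<in> {k\<in>{k0<..\<kappa>}. sel k x}" for k
        using that sel[OF y, of k] Pq[OF y, of k] Pq[OF y, of "k - 1"] by auto
    qed simp
    then show ?thesis using Pq[OF y \<kappa>(1)] by simp
  qed
  moreover have "coord_polynomial r ?T"
    by (intro coord_polynomial_add coord_polynomial_sum coord_polynomial_diff q)
  ultimately show "\<exists>T. coord_polynomial r T \<and>
      (\<forall>y\<in>K. P k0 y + (\<Sum>k\<in>{k0<..J}. if sel k y then P k y - P (k - 1) y else 0) = T y)"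
    by blast
qed

text \<open>After telescoping, the selected increments cancel and only the others remain. Since
  nothing is selected past \<open>J\<close>, the finite sum already contains all selected
  increments, and the bound for partial sums passes to the limit.\<close>

lemma abs_limit_diff_le_suminf:
  fixes P :: "nat \<Rightarrow> real"
  assumes lim: "P \<longlonglongrightarrow> s" and unsel: "\<And>k. k > J \<Longrightarrow> \<not> sel k" and k0: "k0 \<le> J"
  shows "ennreal \<bar>s - (P k0 + (\<Sum>k\<in>{k0<..J}. if sel k then P k - P (k - 1) else 0))\<bar>
    \<le> (\<Sum>i. ennreal \<bar>if sel (k0 + Suc i) then 0 else P (k0 + Suc i) - P (k0 + i)\<bar>)"
proof -
  define G where "G i = (if sel (k0 + Suc i) then 0 else P (k0 + Suc i) - P (k0 + i))" for i
  define t where "t = P k0 + (\<Sum>k\<in>{k0<..J}. if sel k then P k - P (k - 1) else 0)"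
  have "P (k0 + n) - t = (\<Sum>i<n. G i)" if n: "n \<ge> J - k0" for n
  proof -
    have "t = P k0 + (\<Sum>k\<in>{k0 + 1..<k0 + 1 + n}. if sel k then P k - P (k - 1) else 0)"
      unfolding t_def using n k0 unsel
      by (intro arg_cong2[of _ _ _ _ "(+)"] refl sum.mono_neutral_cong_left) (auto simp: not_le)
    also have "\<dots> = P k0 + (\<Sum>i<n. if sel (k0 + Suc i) then P (k0 + Suc i) - P (k0 + i) else 0)"
      by (subst sum.atLeastLessThan_shift_0) (simp add: atLeast0LessThan cong: if_cong)
    finally have t: "t = \<dots>" .
    have "P (k0 + n) = P k0 + (\<Sum>i<n. P (k0 + Suc i) - P (k0 + i))"
      using sum_lessThan_telescope[of "\<lambda>i. P (k0 + i)" n] by simp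
    then show ?thesis unfolding t G_def by (simp add: sum_subtractf[symmetric] cong: if_cong)
      (rule sum.cong, auto)
  qed
  then have "ennreal \<bar>P (k0 + n) - t\<bar> \<le> (\<Sum>i. ennreal \<bar>G i\<bar>)" if n: "n \<ge> J - k0" for n
  proof -
    have "ennreal \<bar>\<Sum>i<n. G i\<bar> \<le> ennreal (\<Sum>i<n. \<bar>G i\<bar>)" by (intro ennreal_leI sum_abs)
    also have "\<dots> = (\<Sum>i<n. ennreal \<bar>G i\<bar>)" by simp
    also have "\<dots> \<le> (\<Sum>i. ennreal \<bar>G i\<bar>)" by (intro sum_le_suminf) auto
    finally show ?thesis using \<open>\<And>n. n \<ge> J - k0 \<Longrightarrow> P (k0 + n) - t = (\<Sum>i<n. G i)\<close>[OF n] by simp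
  qed
  then have le: "\<exists>N. \<forall>n\<ge>N. ennreal \<bar>P (k0 + n) - t\<bar> \<le> (\<Sum>i. ennreal \<bar>G i\<bar>)" by blast
  have "(\<lambda>n. ennreal \<bar>P (k0 + n) - t\<bar>) \<longlonglongrightarrow> ennreal \<bar>s - t\<bar>"
    using LIMSEQ_ignore_initial_segment[OF lim, of k0]
    by (intro tendsto_intros) (simp add: add.commute)
  from LIMSEQ_le_const2[OF this le] show ?thesis unfolding t_def[symmetric] G_def[symmetric] .
qed

text \<open>The base level and the finest level are left free, to be fitted to \<open>D\<close>
  later. For k0 = J no level remains for selection and the count is that of the full grid with
  factor 1; this matters when \<open>D\<close> only just exceeds the size of that grid.\<close>

lemma adaptive_approximation:
  fixes r :: "nat^'n" and \<sigma> :: "real^'n" and p :: real and q :: ennreal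
  assumes \<sigma>: "\<And>l. 0 < \<sigma> $ l" and p: "0 < p" and q: "1 \<le> q" "ennreal p \<le> q"
  defines "gap \<equiv> 1 / p - enn2real (1 / q)"
  defines "\<eta> \<equiv> smin \<sigma> - grid_rate \<sigma> * gap"
  assumes \<eta>: "\<eta> > 0"
  shows "\<exists>C>0. \<exists>N>0. \<forall>s A P J k0.
     0 < A \<longrightarrow> s \<in> borel_measurable (lebesgue_on unit_cube) \<longrightarrow> (\<forall>k. P k \<in> grid_poly r \<sigma> k) \<longrightarrow>
     (\<forall>k. (\<integral>\<^sup>+x. ennreal (\<bar>s x - P k x\<bar> powr p) \<partial>lebesgue_on unit_cube)
        \<le> ennreal ((A * 2 powr (- real k * smin \<sigma>)) powr p)) \<longrightarrow> k0 \<le> J \<longrightarrow>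
     (\<exists>m t. m \<in> dyadic_partitions (card m) J \<and> t \<in> piecewise_poly m r \<and>
        real (card m) \<le> (if k0 = J then 1 else N) * 2 powr (real k0 * grid_rate \<sigma>) \<and>
        Lnorm q (\<lambda>x. s x - t x)
          \<le> ennreal (C * A * (2 powr (- real k0 * smin \<sigma>) + 2 powr (- real J * \<eta>))))"
proof -
  define sm where "sm = smin \<sigma>"
  define V where "V = grid_rate \<sigma>"
  define M where "M = lebesgue_on (unit_cube :: (real^'n) set)"
  \<comment> \<open>The interpolation exponent p / q, equal to 0 for q = \<infinity>. The identity 1
    - \<theta> = p \<open>gap\<close> is how the gap enters the error of each level.\<close>
  define \<theta> where "\<theta> = p * enn2real (1 / q)"
  have sm: "sm > 0" using smin_pos[OF \<sigma>] by (simp add: sm_def)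
  have V: "V \<ge> 0" unfolding V_def grid_rate_def using sm \<sigma> by (intro sum_nonneg) (auto simp: sm_def less_imp_le)
  have inv_q: "enn2real (1 / q) = 1 / enn2real q" if "q \<noteq> \<infinity>"
    using that q(1) by (cases q) (auto simp: divide_ennreal ennreal_1[symmetric] simp del: ennreal_1)
  have pq: "p \<le> enn2real q" "enn2real q \<ge> 1" if "q \<noteq> \<infinity>"
    using that q p by (cases q; auto)+
  have \<theta>: "0 \<le> \<theta>" "\<theta> \<le> 1" "1 - \<theta> = p * gap" "q \<noteq> \<infinity> \<Longrightarrow> \<theta> = p / enn2real q" "q = \<infinity> \<Longrightarrow> \<theta> = 0"
  proof -
    show "0 \<le> \<theta>" using p by (simp add: \<theta>_def)
    show 1: "\<theta> = p / enn2real q" if "q \<noteq> \<infinity>" using inv_q[OF that] by (simp add: \<theta>_def)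
    show 2: "\<theta> = 0" if "q = \<infinity>" using that by (simp add: \<theta>_def)
    show "\<theta> \<le> 1" using 1 2 pq by (cases "q = \<infinity>") auto
    show "1 - \<theta> = p * gap" using p by (simp add: \<theta>_def gap_def right_diff_distrib)
  qed
  have gap: "gap \<ge> 0" using \<theta>(2,3) p by (metis diff_ge_0_iff_ge zero_le_mult_iff not_less)
  \<comment> \<open>At most half of \<eta> is spent on making the counts decay; the rest stays for
    the errors. The added 1 covers \<open>gap\<close> = 0.\<close>
  define \<epsilon> where "\<epsilon> = \<eta> / (2 * (gap + 1))"
  have \<epsilon>: "\<epsilon> > 0" "\<epsilon> * gap \<le> \<eta> / 2" using gap \<eta> by (auto simp: \<epsilon>_def field_simps)
  \<comment> \<open>Three decay rates per level: \<open>w\<close> for counts of selected cells,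
    \<open>u\<close> for errors up to level \<open>J\<close>, \<open>v\<close> for errors past
    \<open>J\<close>.\<close>
  define w where "w = 2 powr (- \<epsilon>)"
  define u where "u = 2 powr (- \<eta> / 2)"
  define v where "v = 2 powr (- \<eta>)"
  have w: "0 < w" "w < 1" using \<epsilon> by (auto simp: w_def powr_less_one)
  have u: "0 < u" "u < 1" using \<eta> by (auto simp: u_def powr_less_one)
  have v: "0 < v" "v < 1" using \<eta> by (auto simp: v_def powr_less_one)
  obtain C1 where C1: "C1 \<ge> 1" and count: "\<And>(Q :: real^'n \<Rightarrow> real) j \<tau> b.
     Q \<in> piecewise_poly (dyadic_cell j ` unit_cube) r \<Longrightarrow> 0 < \<tau> \<Longrightarrow> 0 < b \<Longrightarrow>
     (\<integral>\<^sup>+x. ennreal (\<bar>Q x\<bar> powr p) \<partial>lebesgue_on unit_cube) \<le> ennreal (b powr p) \<Longrightarrow>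
     real (card (cell_index j ` {x \<in> unit_cube. \<exists>z\<in>dyadic_cell j x. \<bar>Q z\<bar> > \<tau>}))
       \<le> (C1 * b / \<tau>) powr p * real (\<Prod>l\<in>UNIV. 2 ^ (j $ l))"
    using card_selected_cells_le[OF p, of r] by blast
  \<comment> \<open>The quasi-triangle constant for the difference of two approximants, times 2^a
    for expressing the error of level k - 1 through k. The 2 in \<open>C2\<close> covers the doubled
    threshold past \<open>J\<close>.\<close>
  define c1 where "c1 = 2 * 2 powr (1 / p) * 2 powr sm"
  define C2 where "C2 = 2 * C1 * c1"
  define C where "C = C2 * (u / (1 - u) + v / (1 - v))"
  define N where "N = 1 + 2 ^ CARD('n) / (1 - w)\<^sup>2"
  have c1: "c1 > 0" by (simp add: c1_def)
  have C2: "C2 > 0" using C1 c1 by (simp add: C2_def)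
  have C: "C > 0" using C2 u v by (simp add: C_def add_pos_pos)
  have N: "N > 0" by (auto simp: N_def add_pos_nonneg)
  have "\<exists>m t. m \<in> dyadic_partitions (card m) J \<and> t \<in> piecewise_poly m r \<and>
        real (card m) \<le> (if k0 = J then 1 else N) * 2 powr (real k0 * grid_rate \<sigma>) \<and>
        Lnorm q (\<lambda>x. s x - t x)
          \<le> ennreal (C * A * (2 powr (- real k0 * smin \<sigma>) + 2 powr (- real J * \<eta>)))"
    if A: "0 < A" and s: "s \<in> borel_measurable (lebesgue_on unit_cube)" and P: "\<And>k. P k \<in> grid_poly r \<sigma> k"
      and int: "\<And>k. (\<integral>\<^sup>+x. ennreal (\<bar>s x - P k x\<bar> powr p) \<partial>lebesgue_on unit_cube)
        \<le> ennreal ((A * 2 powr (- real k * smin \<sigma>)) powr p)" and k0: "k0 \<le> J"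
    for s A and P :: "nat \<Rightarrow> real^'n \<Rightarrow> real" and J k0
  proof -
    define g where "g = grid_level \<sigma>"
    define Q where "Q k x = P k x - P (k - 1) x" for k x
    define b where "b k = c1 * A * 2 powr (- real k * sm)" for k :: nat
    have b: "b k > 0" for k using c1 A by (simp add: b_def)
    have P_meas: "P k \<in> borel_measurable M" for k
      using P[of k] unfolding M_def grid_poly_def dyadic_grid_eq
      by (rule piecewise_poly_dyadic_cells_measurable)
    have Q_pp: "Q k \<in> piecewise_poly (dyadic_cell (g k) ` unit_cube) r" for k
      unfolding Q_def g_def by (rule grid_poly_diff[OF \<sigma> P P]) simp
    have Q_meas: "Q k \<in> borel_measurable M" for k
      unfolding M_def by (rule piecewise_poly_dyadic_cells_measurable[OF Q_pp])
    have Q_int: "(\<integral>\<^sup>+x. ennreal (\<bar>Q k x\<bar> powr p) \<partial>M) \<le> ennreal (b k powr p)" if k: "k \<ge> 1" for k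
    proof -
      define b' where "b' = A * 2 powr (- real (k - 1) * sm)"
      have "A * 2 powr (- real k * sm) \<le> b'"
        unfolding b'_def using A sm by (intro mult_left_mono powr_mono) (auto simp: mult_right_mono)
      then have "ennreal ((A * 2 powr (- real k * sm)) powr p) \<le> ennreal (b' powr p)"
        using A p by (intro ennreal_leI powr_mono2) auto
      then have "(\<integral>\<^sup>+x. ennreal (\<bar>s x - P k x\<bar> powr p) \<partial>M) \<le> ennreal (b' powr p)"
        using int[of k] unfolding sm_def M_def by (rule order_trans[rotated])
      moreover have "(\<integral>\<^sup>+x. ennreal (\<bar>s x - P (k - 1) x\<bar> powr p) \<partial>M) \<le> ennreal (b' powr p)"
        using int[of "k - 1"] by (simp add: sm_def M_def b'_def)
      ultimately have "(\<integral>\<^sup>+x. ennreal (\<bar>P k x - P (k - 1) x\<bar> powr p) \<partial>M)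
          \<le> ennreal ((2 * 2 powr (1 / p) * b') powr p)"
        using s P_meas A by (intro nn_integral_diff_powr_le[OF p]) (auto simp: M_def b'_def)
      moreover have "2 * 2 powr (1 / p) * b' = b k"
        using k by (simp add: b_def b'_def c1_def of_nat_diff left_diff_distrib powr_add[symmetric] powr_diff[symmetric])
      ultimately show ?thesis by (simp add: Q_def)
    qed
    \<comment> \<open>\<open>X k\<close> is the threshold in units of \<open>C1 * b k\<close>, so at
      most 2^(k V) / X_k^p cells are selected. Up to \<open>J\<close> this equals 2^(k0 V -
      \<epsilon>(k - k0)); past \<open>J\<close> the factor 2 makes it 2^-p < 1, hence there are
      none.\<close>
    define X where "X k = (if k \<le> J then 2 powr (real (k - k0) * (V + \<epsilon>) / p) else 2 * 2 powr (real k * V / p))" for k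
    have X: "X k > 0" for k by (simp add: X_def)
    define \<tau> where "\<tau> k = C1 * b k * X k" for k
    have \<tau>: "\<tau> k > 0" for k using C1 b[of k] X[of k] by (simp add: \<tau>_def)
    define sel where "sel k x \<longleftrightarrow> (\<exists>z\<in>dyadic_cell (g k) x. \<bar>Q k z\<bar> > \<tau> k)" for k x
    have sel_cong: "sel k x = sel k y" if "cell_index (g k) x = cell_index (g k) y" for k x y
      using that by (simp add: sel_def dyadic_cell_def)
    define S where "S k = cell_index (g k) ` {x \<in> unit_cube. sel k x}" for k
    have S_fin: "finite (S k)" for k unfolding S_def by (rule finite_cell_index_image) auto
    have S_card: "real (card (S k)) \<le> 2 powr (real k * V) / X k powr p" if k: "k \<ge> 1" for k
    proof -
      have "real (card (S k)) \<le> (C1 * b k / \<tau> k) powr p * real (\<Prod>l\<in>UNIV. 2 ^ (g k $ l))"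
        unfolding S_def sel_def using Q_int[OF k] by (intro count Q_pp \<tau> b) (simp add: M_def)
      also have "\<dots> \<le> (C1 * b k / \<tau> k) powr p * 2 powr (real k * V)"
        unfolding g_def V_def by (intro mult_left_mono prod_grid_level_le \<sigma>) simp
      also have "C1 * b k / \<tau> k = 1 / X k" using C1 b[of k] X[of k] by (simp add: \<tau>_def)
      finally show ?thesis using X[of k] by (simp add: powr_divide)
    qed
    have S_card_le: "real (card (S k)) \<le> 2 powr (real k0 * V) * w ^ (k - k0)" if k: "k \<in> {k0<..J}" for k
    proof -
      have "real (card (S k)) \<le> 2 powr (real k * V) / X k powr p" using k by (intro S_card) auto
      also have "X k powr p = 2 powr (real (k - k0) * (V + \<epsilon>))"
        using k p by (simp add: X_def powr_powr)
      also have "2 powr (real k * V) / \<dots> = 2 powr (real k0 * V) * w ^ (k - k0)"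
        using k by (simp add: w_def powr_powr powr_realpow[symmetric] powr_diff[symmetric] powr_add[symmetric]
            of_nat_diff algebra_simps)
      finally show ?thesis .
    qed
    have unsel: "\<not> sel k x" if k: "k > J" and x: "x \<in> unit_cube" for k x
    proof
      assume "sel k x"
      then have "card (S k) > 0" using S_fin x unfolding S_def card_gt_0_iff by blast
      then have "1 \<le> real (card (S k))" by simp
      also have "\<dots> \<le> 2 powr (real k * V) / X k powr p" using k by (intro S_card) auto
      also have "X k powr p = 2 powr p * 2 powr (real k * V)"
        using k p by (simp add: X_def powr_mult powr_powr)
      finally have "2 powr p \<le> 1" by simp
      moreover have "2 powr p > 2 powr 0" using p by (intro powr_less_mono) auto
      ultimately show False by simp
    qed
    have "\<exists>m. m \<in> dyadic_partitions (card m) J \<and>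
        card m \<le> (\<Prod>l\<in>UNIV. 2 ^ (g k0 $ l)) + 2 ^ CARD('n) * (\<Sum>k\<in>{k0<..J}. \<Sum>j\<in>{k..J}. card (S j)) \<and>
        (\<forall>K\<in>m. \<exists>\<kappa>\<in>{k0..J}. \<exists>x\<in>unit_cube. K = dyadic_cell (g \<kappa>) x \<and> (\<forall>k\<in>{\<kappa><..J}. \<forall>y\<in>K. \<not> sel k y))"
      unfolding S_def g_def
      by (rule adaptive_dyadic_partition[of "grid_level \<sigma>"])
        (fact grid_level_mono[OF \<sigma>] grid_level_Suc_le[OF \<sigma>] grid_level_le[OF \<sigma>] k0)+
    then obtain m where m_part: "m \<in> dyadic_partitions (card m) J"
      and m_card: "card m \<le> (\<Prod>l\<in>UNIV. 2 ^ (g k0 $ l)) + 2 ^ CARD('n) * (\<Sum>k\<in>{k0<..J}. \<Sum>j\<in>{k..J}. card (S j))"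
      and "\<forall>K\<in>m. \<exists>\<kappa>\<in>{k0..J}. \<exists>x\<in>unit_cube. K = dyadic_cell (g \<kappa>) x \<and> (\<forall>k\<in>{\<kappa><..J}. \<forall>y\<in>K. \<not> sel k y)"
      by (elim exE conjE) (rule that)
    note m_cells = bspec[OF this(3)]
    define t where "t x = P k0 x + (\<Sum>k\<in>{k0<..J}. if sel k x then P k x - P (k - 1) x else 0)" for x
    have t_pp: "t \<in> piecewise_poly m r"
      unfolding t_def[abs_def]
      by (rule adaptive_sum_in_piecewise_poly[OF \<sigma> P sel_cong[unfolded g_def] m_cells[unfolded g_def]])
    have "real (card m) \<le> 2 powr (real k0 * V) + 2 ^ CARD('n) * (\<Sum>k\<in>{k0<..J}. \<Sum>j\<in>{k..J}. real (card (S j)))"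
    proof -
      have "real (card m) \<le> real ((\<Prod>l\<in>UNIV. 2 ^ (g k0 $ l)) + 2 ^ CARD('n) * (\<Sum>k\<in>{k0<..J}. \<Sum>j\<in>{k..J}. card (S j)))"
        using m_card by (simp only: of_nat_le_iff)
      then show ?thesis using prod_grid_level_le[OF \<sigma>, of k0] by (simp add: g_def V_def)
    qed
    also have "(\<Sum>k\<in>{k0<..J}. \<Sum>j\<in>{k..J}. real (card (S j)))
        \<le> (\<Sum>k\<in>{k0<..J}. \<Sum>j\<in>{k..J}. 2 powr (real k0 * V) * w ^ (j - k0))"
      by (intro sum_mono S_card_le) auto
    also have "\<dots> = 2 powr (real k0 * V) * (\<Sum>k\<in>{k0<..J}. \<Sum>j\<in>{k..J}. w ^ (j - k0))"
      by (simp add: sum_distrib_left)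
    finally have card_m: "real (card m) \<le> 2 powr (real k0 * V) *
        (1 + 2 ^ CARD('n) * (\<Sum>k\<in>{k0<..J}. \<Sum>j\<in>{k..J}. w ^ (j - k0)))"
      by (simp add: algebra_simps)
    have card_m': "real (card m) \<le> (if k0 = J then 1 else N) * 2 powr (real k0 * V)"
    proof (cases "k0 = J")
      case False
      have "2 ^ CARD('n) * (\<Sum>k\<in>{k0<..J}. \<Sum>j\<in>{k..J}. w ^ (j - k0)) \<le> 2 ^ CARD('n) * (1 / (1 - w)\<^sup>2)"
        using w by (intro mult_left_mono double_sum_geometric_tail_le) auto
      then have "2 powr (real k0 * V) * (1 + 2 ^ CARD('n) * (\<Sum>k\<in>{k0<..J}. \<Sum>j\<in>{k..J}. w ^ (j - k0))) \<le> 2 powr (real k0 * V) * N"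
        by (intro mult_left_mono) (auto simp: N_def)
      with card_m have "real (card m) \<le> 2 powr (real k0 * V) * N" by (rule order_trans)
      then show ?thesis using False by (simp add: mult.commute)
    qed (use card_m in simp)
    define G where "G i x = \<bar>if sel (k0 + Suc i) x then 0 else Q (k0 + Suc i) x\<bar>" for i x
    have G_meas: "G i \<in> borel_measurable M" for i
    proof -
      have "(\<lambda>x. if sel (k0 + Suc i) x then 0 else Q (k0 + Suc i) x) \<in> borel_measurable M"
        unfolding M_def
        by (rule piecewise_poly_dyadic_cells_measurable[OF piecewise_poly_if_zero[OF Q_pp[of "k0 + Suc i"]]])
          (rule sel_cong)
      then show ?thesis unfolding G_def by measurable
    qed
    have G_le: "0 \<le> G i x" "G i x \<le> \<bar>Q (k0 + Suc i) x\<bar>" "x \<in> unit_cube \<Longrightarrow> G i x \<le> \<tau> (k0 + Suc i)" for i x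
      using \<tau>[of "k0 + Suc i"] self_mem_dyadic_cell[of x "g (k0 + Suc i)"]
      by (auto simp: G_def sel_def not_less less_imp_le)
    \<comment> \<open>Index i stands for level k0 + i + 1, so the condition says that this level
      exceeds \<open>J\<close>, and the exponent is its distance from \<open>J\<close>.\<close>
    define F where "F i = (if J - k0 \<le> i then v ^ Suc (i - (J - k0)) else 0)" for i
    have F_nn: "F i \<ge> 0" for i using v by (simp add: F_def)
    \<comment> \<open>The first part pays for levels up to \<open>J\<close>, the second for those
      past \<open>J\<close>. The first is kept at every level because the weights in Minkowski's
      inequality must be positive.\<close>
    define E where "E i = C2 * A * (2 powr (- real k0 * sm) * u ^ Suc i + 2 powr (- real J * \<eta>) * F i)" for i
    have E_pos: "E i > 0" for i
      using C2 A u F_nn[of i] unfolding E_def by (intro mult_pos_pos add_pos_nonneg) auto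
    have \<tau>_E: "\<tau> k powr (1 - \<theta>) * b k powr \<theta> \<le> E i" if k: "k = k0 + Suc i" for k i
    proof -
      have le: "\<tau> k powr (1 - \<theta>) * b k powr \<theta> \<le> C1 * b k * X k powr (1 - \<theta>)"
        unfolding \<tau>_def using C1 b X \<theta> by (intro powr_interpolate_le) auto
      \<comment> \<open>Up to level \<open>J\<close>, each level gains a from \<open>b\<close> and
        loses (V + \<epsilon>) \<open>gap\<close> through the threshold. By this identity the net
        gain is \<eta> - \<epsilon> \<open>gap\<close> >= \<eta> / 2, the rate of
        \<open>u\<close>.\<close>
      have sm_eq: "sm = V * gap + \<eta>" by (simp add: \<eta>_def V_def sm_def)
      have u_pow: "u ^ Suc n = 2 powr ((- \<eta> / 2) * (real n + 1))" for n
        unfolding u_def by (subst powr_power) (simp_all add: mult.commute add.commute)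
      have v_pow: "v ^ Suc n = 2 powr ((- \<eta>) * (real n + 1))" for n
        unfolding v_def by (subst powr_power) (simp_all add: mult.commute add.commute)
      have cA: "C1 * c1 * A > 0" using C1 c1 A by simp
      show ?thesis
      proof (cases "k \<le> J")
        case True
        have "real (k - k0) = real i + 1" using k by simp
        then have "X k powr (1 - \<theta>) = 2 powr ((real i + 1) * (V + \<epsilon>) * gap)"
          using True p by (simp add: X_def powr_powr \<theta>(3) mult.assoc)
        then have "C1 * b k * X k powr (1 - \<theta>) = C1 * c1 * A * 2 powr (- real k * sm + (real i + 1) * (V + \<epsilon>) * gap)"
          unfolding b_def powr_add by simp
        also have "\<dots> \<le> C1 * c1 * A * 2 powr (- real k0 * sm + (- \<eta> / 2) * (real i + 1))"
        proof (intro mult_left_mono powr_mono)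
          have "(real i + 1) * (\<epsilon> * gap) \<le> (real i + 1) * (\<eta> / 2)" using \<epsilon> by (intro mult_left_mono) auto
          moreover have "- real k * sm + (real i + 1) * (V + \<epsilon>) * gap
              = - real k0 * sm - (real i + 1) * \<eta> + (real i + 1) * (\<epsilon> * gap)"
            unfolding k sm_eq by (simp add: algebra_simps)
          moreover have "(- \<eta> / 2) * (real i + 1) = - ((real i + 1) * \<eta>) + (real i + 1) * (\<eta> / 2)"
            by (simp add: field_simps)
          ultimately show "- real k * sm + (real i + 1) * (V + \<epsilon>) * gap \<le> - real k0 * sm + (- \<eta> / 2) * (real i + 1)"
            by linarith
        qed (use cA in auto)
        also have "\<dots> = C1 * c1 * A * (2 powr (- real k0 * sm) * u ^ Suc i)"
          by (simp only: powr_add u_pow)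
        also have "\<dots> \<le> E i"
        proof -
          have "0 \<le> C1 * c1 * A * (2 powr (- real k0 * sm) * u ^ Suc i)" using C1 c1 A u by (intro mult_nonneg_nonneg) auto
          moreover have "0 \<le> C2 * A * (2 powr (- real J * \<eta>) * F i)"
            using C2 A F_nn[of i] by (intro mult_nonneg_nonneg) auto
          moreover have "E i = 2 * (C1 * c1 * A * (2 powr (- real k0 * sm) * u ^ Suc i))
              + C2 * A * (2 powr (- real J * \<eta>) * F i)"
            unfolding E_def C2_def by (simp only: distrib_left mult.assoc)
          ultimately show ?thesis by linarith
        qed
        finally show ?thesis using le by linarith
      next
        case False
        then have i: "J - k0 \<le> i" "real (i - (J - k0)) + 1 = real k - real J" using k k0 by auto
        have "X k powr (1 - \<theta>) = 2 powr (1 - \<theta>) * 2 powr (real k * V * gap)"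
          using False p by (simp add: X_def powr_powr powr_mult \<theta>(3) mult.assoc)
        also have "\<dots> \<le> 2 powr 1 * 2 powr (real k * V * gap)"
          using \<theta> by (intro mult_right_mono powr_mono) auto
        finally have "C1 * b k * X k powr (1 - \<theta>) \<le> C1 * b k * (2 powr 1 * 2 powr (real k * V * gap))"
          using C1 b[of k] by (intro mult_left_mono) auto
        also have "\<dots> = C2 * A * 2 powr (- real k * sm + real k * V * gap)"
          unfolding b_def C2_def powr_add by simp
        \<comment> \<open>Past \<open>J\<close> the threshold grows from level 0 on and not from
          \<open>k0\<close>, so the whole exponent is -k \<eta>; splitting it at \<open>J\<close>
          leaves 2^(-J \<eta>) and a power of \<open>v\<close>.\<close>
        also have "- real k * sm + real k * V * gap = - real J * \<eta> + (- \<eta>) * (real k - real J)"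
          unfolding sm_eq by (simp add: algebra_simps)
        also have "C2 * A * 2 powr \<dots> = C2 * A * (2 powr (- real J * \<eta>) * F i)"
          using i(1) by (simp only: powr_add F_def v_pow i(2) if_True)
        also have "\<dots> \<le> E i"
        proof -
          have "0 \<le> C2 * A * (2 powr (- real k0 * sm) * u ^ Suc i)" using C2 A u by (intro mult_nonneg_nonneg) auto
          then show ?thesis unfolding E_def distrib_left by linarith
        qed
        finally show ?thesis using le by linarith
      qed
    qed
    have "(\<lambda>i. u * u ^ i) sums (u * (1 / (1 - u)))" using u by (intro sums_mult geometric_sums) auto
    then have "(\<lambda>i. u ^ Suc i) sums (u / (1 - u))" by simp
    then have E_sums: "E sums (C2 * A * (2 powr (- real k0 * sm) * (u / (1 - u)) + 2 powr (- real J * \<eta>) * (v / (1 - v))))"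
      unfolding E_def F_def by (intro sums_mult sums_add sums_geometric_shift v)
    have "Lnorm q (\<lambda>x. s x - t x) \<le> ennreal (\<Sum>i. E i)"
    proof (rule Lnorm_le_suminf[OF q(1) _ G_le(1) _ E_pos sums_summable[OF E_sums]])
      have "t \<in> borel_measurable (lebesgue_on unit_cube)"
      proof (rule piecewise_poly_measurable[OF _ _ _ t_pp])
        show "countable m" using dyadic_partitionsD(2)[OF m_part] by (rule countable_finite)
        show "K \<in> sets borel" if "K \<in> m" for K using m_cells[OF that] by (auto simp: dyadic_cell_def)
        show "unit_cube \<subseteq> \<Union>m" using dyadic_partitionsD(1)[OF m_part] by (simp add: partition_on_def)
      qed
      then show "(\<lambda>x. s x - t x) \<in> borel_measurable (lebesgue_on unit_cube)" using s by measurable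
      show "G k \<in> borel_measurable (lebesgue_on unit_cube)" for k using G_meas by (simp add: M_def)
      show "G i x \<le> E i" if "q = \<infinity>" "x \<in> unit_cube" for i x
        using G_le(3)[OF that(2), of i] \<tau>_E[of "k0 + Suc i" i] \<tau>[of "k0 + Suc i"] b[of "k0 + Suc i"] \<theta>(5)[OF that(1)]
        by simp
      show "(\<integral>\<^sup>+x. ennreal (G i x powr enn2real q) \<partial>lebesgue_on unit_cube) \<le> ennreal (E i powr enn2real q)"
        if "q \<noteq> \<infinity>" for i
      proof -
        let ?k = "k0 + Suc i"
        have "(\<integral>\<^sup>+x. ennreal (G i x powr enn2real q) \<partial>M)
            \<le> ennreal ((\<tau> ?k powr (1 - p / enn2real q) * b ?k powr (p / enn2real q)) powr enn2real q)"
          using Q_int[of ?k] pq[OF that] G_le(1,2)[of i] G_le(3)[of _ i]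
          by (intro nn_integral_truncated_powr_le[OF p _ \<tau> b Q_meas]) (auto simp: M_def)
        also have "\<dots> \<le> ennreal (E i powr enn2real q)"
          using \<tau>_E[of ?k i] \<theta>(4)[OF that] pq[OF that] by (intro ennreal_leI powr_mono2) auto
        finally show ?thesis by (simp add: M_def)
      qed
      have "AE x in M. (\<lambda>k. P k x) \<longlonglongrightarrow> s x"
      proof (rule AE_tendsto_of_summable_powr[OF p])
        show "(\<integral>\<^sup>+x. ennreal (\<bar>s x - P k x\<bar> powr p) \<partial>M) \<le> ennreal (A powr p * (2 powr (- sm * p)) ^ k)" for k
          using int[of k] A by (simp add: M_def sm_def powr_mult powr_powr powr_realpow[symmetric] mult_ac)
        show "summable (\<lambda>k. A powr p * (2 powr (- sm * p)) ^ k)"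
          using sm p by (intro summable_mult summable_geometric) (simp add: powr_less_one)
      qed (use s P_meas in \<open>auto simp: M_def\<close>)
      then show "AE x in lebesgue_on unit_cube. ennreal \<bar>s x - t x\<bar> \<le> (\<Sum>i. ennreal (G i x))"
        unfolding M_def[symmetric] using AE_space
      proof eventually_elim
        case (elim x)
        then have "x \<in> unit_cube" by (simp add: M_def)
        from abs_limit_diff_le_suminf[OF elim(1), of J "\<lambda>k. sel k x" k0, OF unsel[OF _ this] k0]
        show ?case unfolding t_def G_def Q_def by (simp only: add_Suc_right diff_Suc_1)
      qed
    qed
    also have "(\<Sum>i. E i) \<le> C * A * (2 powr (- real k0 * sm) + 2 powr (- real J * \<eta>))"
    proof -
      have prod_le: "x * a + y * c \<le> (a + c) * (x + y)" if "0 \<le> x" "0 \<le> y" "0 \<le> a" "0 \<le> c" for a c x y :: real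
        using mult_nonneg_nonneg[OF that(1,4)] mult_nonneg_nonneg[OF that(2,3)]
        by (simp add: algebra_simps)
      have "2 powr (- real k0 * sm) * (u / (1 - u)) + 2 powr (- real J * \<eta>) * (v / (1 - v))
          \<le> (u / (1 - u) + v / (1 - v)) * (2 powr (- real k0 * sm) + 2 powr (- real J * \<eta>))"
        using u v by (intro prod_le) auto
      then have "C2 * A * (2 powr (- real k0 * sm) * (u / (1 - u)) + 2 powr (- real J * \<eta>) * (v / (1 - v)))
          \<le> C2 * A * ((u / (1 - u) + v / (1 - v)) * (2 powr (- real k0 * sm) + 2 powr (- real J * \<eta>)))"
        using C2 A by (intro mult_left_mono) auto
      then show ?thesis using sums_unique[OF E_sums] by (simp add: C_def mult_ac)
    qed
    finally have "Lnorm q (\<lambda>x. s x - t x) \<le> ennreal (C * A * (2 powr (- real k0 * sm) + 2 powr (- real J * \<eta>)))"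
      by (simp add: ennreal_leI)
    then show ?thesis using m_part t_pp card_m' unfolding sm_def V_def
      by (intro exI[of _ m] exI[of _ t] conjI)
  qed
  note main = this
  show ?thesis
    by (intro exI[of _ C] exI[of _ N] conjI C N allI impI, rule main) (assumption | erule spec)+
qed

section \<open>Near-best approximants and change of exponent\<close>

lemma smoothness_ball_approx_error_le:
  assumes s: "s \<in> smoothness_ball r \<sigma> (ennreal p) p' R" and p': "p' = \<infinity> \<or> p' = ennreal p" and p: "p > 0" and R: "R > 0"
  shows "ennreal (2 powr (real k * smin \<sigma>)) * approx_error r \<sigma> (ennreal p) k s \<le> ennreal R"
proof -
  define x where "x k = ennreal (2 powr (real k * smin \<sigma>)) * approx_error r \<sigma> (ennreal p) k s" for k
  have norm: "smoothness_norm r \<sigma> (ennreal p) p' s \<le> ennreal R" using s by (simp add: smoothness_ball_def)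
  from p' have "x k \<le> ennreal R"
  proof
    assume "p' = \<infinity>"
    then have "(SUP k. x k) \<le> ennreal R" using norm by (simp add: smoothness_norm_def x_def)
    then show ?thesis by (rule order_trans[OF SUP_upper, rotated]) simp
  next
    assume "p' = ennreal p"
    then have "ennpowr (\<Sum>k. ennpowr (x k) p) (1 / p) \<le> ennreal R"
      using norm p by (simp add: smoothness_norm_def x_def)
    then have "(\<Sum>k. ennpowr (x k) p) \<le> ennreal (R powr p)" by (rule le_of_ennpowr_le) (use R p in auto)
    moreover have "ennpowr (x k) p = (\<Sum>k\<in>{k}. ennpowr (x k) p)" by simp
    moreover have "(\<Sum>k\<in>{k}. ennpowr (x k) p) \<le> (\<Sum>k. ennpowr (x k) p)" by (rule sum_le_suminf) auto
    \<comment> \<open>Writing p as 1 / (1 / p) lets the same inversion rule strip the inner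
      power.\<close>
    ultimately have "ennpowr (x k) (1 / (1 / p)) \<le> ennreal (R powr p)" by simp
    then have "x k \<le> ennreal ((R powr p) powr (1 / p))" by (rule le_of_ennpowr_le) (use R p in auto)
    then show ?thesis using R p by (simp add: powr_powr)
  qed
  then show ?thesis by (simp add: x_def)
qed

text \<open>The infimum need not be attained; the factor 2 together with R > 0 leaves strict room
  above it.\<close>

lemma smoothness_ball_near_best:
  assumes s: "s \<in> smoothness_ball r \<sigma> (ennreal p) p' R" and p': "p' = \<infinity> \<or> p' = ennreal p" and p: "p > 0" and R: "R > 0"
  shows "\<exists>P\<in>grid_poly r \<sigma> k. (\<integral>\<^sup>+x. ennreal (\<bar>s x - P x\<bar> powr p) \<partial>lebesgue_on unit_cube)
    \<le> ennreal ((2 * R * 2 powr (- real k * smin \<sigma>)) powr p)"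
proof -
  define a where "a = 2 powr (real k * smin \<sigma>)"
  define B where "B = 2 * R * 2 powr (- real k * smin \<sigma>)"
  have a: "a > 0" by (simp add: a_def)
  have B: "B > 0" "a * B = 2 * R" using R by (simp_all add: B_def a_def powr_minus)
  have "approx_error r \<sigma> (ennreal p) k s < ennreal B"
  proof (rule ccontr)
    assume "\<not> ?thesis"
    then have "ennreal a * ennreal B \<le> ennreal a * approx_error r \<sigma> (ennreal p) k s"
      by (intro mult_left_mono) auto
    also have "\<dots> \<le> ennreal R" unfolding a_def by (rule smoothness_ball_approx_error_le[OF assms])
    finally have "ennreal (a * B) \<le> ennreal R" by (subst ennreal_mult) (use a B in auto)
    then show False using R unfolding B by (simp add: ennreal_le_iff)
  qed
  then obtain P where P: "P \<in> grid_poly r \<sigma> k" "Lnorm (ennreal p) (\<lambda>x. s x - P x) < ennreal B"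
    unfolding approx_error_def INF_less_iff by blast
  have "ennpowr (\<integral>\<^sup>+x. ennreal (\<bar>s x - P x\<bar> powr p) \<partial>lebesgue_on unit_cube) (1 / p) \<le> ennreal B"
    using less_imp_le[OF P(2)] p by (simp add: Lnorm_def)
  from le_of_ennpowr_le[OF this less_imp_le[OF B(1)] p] show ?thesis using P(1) unfolding B_def by blast
qed

text \<open>The pointwise inequality y^q <= 1 + y^p replaces Hoelder's inequality on a space of
  measure 1, at the cost of 2^(1/q). It reduces the case p > q to equal exponents.\<close>

lemma nn_integral_powr_le_of_larger_exponent:
  fixes f :: "'a \<Rightarrow> real"
  assumes f: "f \<in> borel_measurable M" and M: "emeasure M (space M) = 1" and q: "0 < q" "q \<le> p" and B: "B > 0"
    and int: "(\<integral>\<^sup>+x. ennreal (\<bar>f x\<bar> powr p) \<partial>M) \<le> ennreal (B powr p)"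
  shows "(\<integral>\<^sup>+x. ennreal (\<bar>f x\<bar> powr q) \<partial>M) \<le> ennreal ((2 powr (1 / q) * B) powr q)"
proof -
  note [measurable] = f
  have le: "\<bar>f x\<bar> powr q \<le> B powr q + B powr q / B powr p * \<bar>f x\<bar> powr p" for x
  proof -
    define y where "y = \<bar>f x\<bar> / B"
    have "y powr q \<le> 1 + y powr p"
    proof (cases "y \<le> 1")
      case True
      then have "y powr q \<le> 1 powr q" using q B by (intro powr_mono2) (auto simp: y_def)
      then show ?thesis by (simp add: add_increasing2)
    next
      case False
      then have "y powr q \<le> y powr p" using q by (intro powr_mono) auto
      then show ?thesis by simp
    qed
    then have "B powr q * y powr q \<le> B powr q * (1 + y powr p)" by (rule mult_left_mono) simp
    then show ?thesis using B by (simp add: y_def powr_divide distrib_left)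
  qed
  have "(\<integral>\<^sup>+x. ennreal (\<bar>f x\<bar> powr q) \<partial>M)
      \<le> (\<integral>\<^sup>+x. ennreal (B powr q) + ennreal (B powr q / B powr p) * ennreal (\<bar>f x\<bar> powr p) \<partial>M)"
  proof (rule nn_integral_mono)
    fix x
    show "ennreal (\<bar>f x\<bar> powr q) \<le> ennreal (B powr q) + ennreal (B powr q / B powr p) * ennreal (\<bar>f x\<bar> powr p)"
      using ennreal_leI[OF le[of x]] by (simp add: ennreal_mult'[symmetric])
  qed
  also have "\<dots> = ennreal (B powr q) + ennreal (B powr q / B powr p) * (\<integral>\<^sup>+x. ennreal (\<bar>f x\<bar> powr p) \<partial>M)"
    by (simp add: nn_integral_add nn_integral_cmult M)
  also have "\<dots> \<le> ennreal (B powr q) + ennreal (B powr q / B powr p) * ennreal (B powr p)"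
    by (intro add_left_mono mult_left_mono int) simp
  also have "\<dots> = ennreal (B powr q + B powr q / B powr p * B powr p)"
    by (simp add: ennreal_mult'[symmetric])
  also have "B powr q + B powr q / B powr p * B powr p = (2 powr (1 / q) * B) powr q"
    using q B by (simp add: powr_mult powr_powr)
  finally show ?thesis .
qed

lemma emeasure_unit_cube: "emeasure (lebesgue_on (unit_cube :: (real^'n) set)) (space (lebesgue_on unit_cube)) = 1"
proof -
  have "emeasure (lebesgue_on (unit_cube :: (real^'n) set)) (space (lebesgue_on unit_cube))
      = emeasure lborel (cbox 0 (0 + 1 :: real^'n))"
    by (simp add: emeasure_restrict_space)
  also have "\<dots> = 1" by (subst emeasure_box_plus_vec(2)) auto
  finally show ?thesis .
qed

section \<open>Fitting the base level to the prescribed number of cells\<close>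

lemma level_for_cardinality:
  fixes N V D :: real
  assumes "N > 0" "V > 0" "N \<le> D"
  shows "\<exists>k::nat. N * 2 powr (real k * V) \<le> D \<and> D < N * 2 powr (real (Suc k) * V)"
proof -
  define z where "z = log 2 (D / N) / V"
  have D: "D / N \<ge> 1" using assms by simp
  then have z: "z \<ge> 0" using assms by (simp add: z_def)
  have "real (nat \<lfloor>z\<rfloor>) \<le> z" "z < real (Suc (nat \<lfloor>z\<rfloor>))" using z by linarith+
  then have "real (nat \<lfloor>z\<rfloor>) * V \<le> log 2 (D / N)" "log 2 (D / N) < real (Suc (nat \<lfloor>z\<rfloor>)) * V"
    using assms(2) by (simp_all only: z_def pos_le_divide_eq pos_divide_less_eq)
  then have "2 powr (real (nat \<lfloor>z\<rfloor>) * V) \<le> D / N" "D / N < 2 powr (real (Suc (nat \<lfloor>z\<rfloor>)) * V)"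
    using D by (simp_all only: le_log_iff log_less_iff)
  then show ?thesis using assms(1) by (intro exI[of _ "nat \<lfloor>z\<rfloor>"]) (simp add: field_simps)
qed

lemma uniform_approximation_bound:
  fixes r :: "nat^'n" and \<sigma> :: "real^'n" and p :: real and q :: ennreal
  assumes \<sigma>: "\<And>l. 0 < \<sigma> $ l" and p: "0 < p" and q: "1 \<le> q"
    and gap: "exponent_gap p q < harmonic_mean \<sigma> / real CARD('n)"
  shows "\<exists>C>0. \<forall>J R D s p'. 0 < R \<longrightarrow> 1 \<le> real D \<longrightarrow> (dyadic_partitions D J :: (real^'n) set set set) \<noteq> {} \<longrightarrow>
     p' = \<infinity> \<or> p' = ennreal p \<longrightarrow> s \<in> smoothness_ball r \<sigma> (ennreal p) p' R \<longrightarrow>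
     (\<exists>m\<in>dyadic_partitions D J. \<exists>t\<in>piecewise_poly m r. Lnorm q (\<lambda>x. s x - t x) \<le> ennreal (C * R *
       (2 powr (- (real J * real CARD('n) * (harmonic_mean \<sigma> / real CARD('n) - exponent_gap p q) * smin \<sigma> / harmonic_mean \<sigma>))
        + real D powr (- (harmonic_mean \<sigma> / real CARD('n))))))"
proof -
  define sm where "sm = smin \<sigma>"
  define V where "V = grid_rate \<sigma>"
  define h where "h = harmonic_mean \<sigma> / real CARD('n)"
  \<comment> \<open>The minimum of p and q. If p > q, both the positive part and 1 / p0 - 1 / q
    vanish, so the same \<eta> serves both cases.\<close>
  define p0 where "p0 = (if ennreal p \<le> q then p else enn2real q)"
  define \<eta> where "\<eta> = sm - V * exponent_gap p q"
  have sm: "sm > 0" using smin_pos[OF \<sigma>] by (simp add: sm_def)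
  define T where "T = (\<Sum>l\<in>UNIV. 1 / \<sigma> $ l)"
  have T: "T > 0" unfolding T_def using \<sigma> by (intro sum_pos) auto
  have VT: "V = sm * T" by (simp add: V_def grid_rate_def sm_def T_def sum_distrib_left)
  have H: "harmonic_mean \<sigma> = real CARD('n) / T" by (simp add: harmonic_mean_def T_def)
  have h: "h = 1 / T" by (simp add: h_def H)
  have V: "V > 0" "V * h = sm" using sm T by (simp_all add: VT h)
  have h_pos: "h > 0" using T by (simp add: h)
  \<comment> \<open>Since V = a d / H, the exponent in the theorem is J (a - V times the
    gap).\<close>
  have exponent: "real J * real CARD('n) * (h - exponent_gap p q) * smin \<sigma> / harmonic_mean \<sigma> = real J * \<eta>" for J
    using T by (simp add: H \<eta>_def h VT sm_def[symmetric] field_simps)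
  have "\<eta> = V * (h - exponent_gap p q)" using V(2) by (simp add: \<eta>_def algebra_simps)
  then have \<eta>: "\<eta> > 0" using V gap by (simp add: h_def)
  have \<eta>_le: "\<eta> \<le> sm" using V by (simp add: \<eta>_def exponent_gap_def)
  have q_fin: "q \<noteq> \<infinity>" "enn2real q \<le> p" "enn2real q > 0" "ennreal (enn2real q) = q" if "\<not> ennreal p \<le> q"
    using that q p by (cases q; auto simp: ennreal_le_iff2)+
  have p0: "0 < p0" "p0 \<le> p" "ennreal p0 \<le> q" using p q_fin by (auto simp: p0_def)
  have gap0: "exponent_gap p q = 1 / p0 - enn2real (1 / q)"
  proof (cases "ennreal p \<le> q")
    case True
    then have "enn2real (1 / q) \<le> 1 / p"
      using p q by (cases q) (auto simp: divide_ennreal ennreal_1[symmetric] frac_le simp del: ennreal_1)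
    then show ?thesis using True by (simp add: exponent_gap_def p0_def)
  next
    case False
    from q_fin[OF this] have "enn2real (1 / q) = 1 / enn2real q"
      by (cases q) (auto simp: divide_ennreal ennreal_1[symmetric] simp del: ennreal_1)
    moreover have "1 / p \<le> 1 / enn2real q" using q_fin[OF False] by (intro divide_left_mono) auto
    ultimately show ?thesis using False by (simp add: exponent_gap_def p0_def)
  qed
  have "smin \<sigma> - grid_rate \<sigma> * (1 / p0 - enn2real (1 / q)) > 0"
    using \<eta> by (simp add: \<eta>_def gap0 sm_def V_def)
  from adaptive_approximation[OF \<sigma> p0(1) q p0(3) this, of r]
  have "\<exists>C>0. \<exists>N>0. \<forall>s A P J k0.
     0 < A \<longrightarrow> s \<in> borel_measurable (lebesgue_on unit_cube) \<longrightarrow> (\<forall>k. P k \<in> grid_poly r \<sigma> k) \<longrightarrow>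
     (\<forall>k. (\<integral>\<^sup>+x. ennreal (\<bar>s x - P k x\<bar> powr p0) \<partial>lebesgue_on unit_cube)
        \<le> ennreal ((A * 2 powr (- real k * sm)) powr p0)) \<longrightarrow> k0 \<le> J \<longrightarrow>
     (\<exists>m t. m \<in> dyadic_partitions (card m) J \<and> t \<in> piecewise_poly m r \<and>
        real (card m) \<le> (if k0 = J then 1 else N) * 2 powr (real k0 * V) \<and>
        Lnorm q (\<lambda>x. s x - t x)
          \<le> ennreal (C * A * (2 powr (- real k0 * sm) + 2 powr (- real J * \<eta>))))"
    unfolding gap0[symmetric] sm_def[symmetric] V_def[symmetric] \<eta>_def[symmetric] .
  then obtain C N where C: "C > 0" and "N > 0" and "\<forall>s A P J k0.
     0 < A \<longrightarrow> s \<in> borel_measurable (lebesgue_on unit_cube) \<longrightarrow> (\<forall>k. P k \<in> grid_poly r \<sigma> k) \<longrightarrow>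
     (\<forall>k. (\<integral>\<^sup>+x. ennreal (\<bar>s x - P k x\<bar> powr p0) \<partial>lebesgue_on unit_cube)
        \<le> ennreal ((A * 2 powr (- real k * sm)) powr p0)) \<longrightarrow> k0 \<le> J \<longrightarrow>
     (\<exists>m t. m \<in> dyadic_partitions (card m) J \<and> t \<in> piecewise_poly m r \<and>
        real (card m) \<le> (if k0 = J then 1 else N) * 2 powr (real k0 * V) \<and>
        Lnorm q (\<lambda>x. s x - t x)
          \<le> ennreal (C * A * (2 powr (- real k0 * sm) + 2 powr (- real J * \<eta>))))"
    by (elim exE conjE) (rule that)
  note adapt = this(3)[rule_format]
  define N1 where "N1 = max N 1"
  have N1: "N1 \<ge> 1" "N \<le> N1" by (auto simp: N1_def)
  \<comment> \<open>Collects the losses in comparing D^(-h) with errors at dyadic levels: N1^h from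
    the constant in the cell count, 2^a from rounding down to a level, and 2 for two error terms of
    the same order.\<close>
  define K where "K = 2 * N1 powr h * 2 powr sm"
  have N1_h: "N1 powr h \<ge> 1" using N1 h_pos by (intro ge_one_powr_ge_zero) auto
  moreover have sm_1: "2 powr sm \<ge> 1" using sm by (intro ge_one_powr_ge_zero) auto
  ultimately have "N1 powr h * 1 \<le> N1 powr h * 2 powr sm" by (intro mult_left_mono) auto
  then have K: "K \<ge> 2" "2 * N1 powr h \<le> K" "N1 powr h * 2 powr sm \<le> K" "K \<ge> 1"
    using N1_h unfolding K_def mult.assoc by linarith+
  define A0 where "A0 = 2 powr (1 / p0) * 2"
  have A0: "A0 > 0" by (simp add: A0_def)
  have "\<exists>m\<in>dyadic_partitions D J. \<exists>t\<in>piecewise_poly m r. Lnorm q (\<lambda>x. s x - t x)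
      \<le> ennreal (C * A0 * K * R * (2 powr (- (real J * \<eta>)) + real D powr (- h)))"
    if R: "0 < R" and D: "1 \<le> real D" and ne: "(dyadic_partitions D J :: (real^'n) set set set) \<noteq> {}"
      and p': "p' = \<infinity> \<or> p' = ennreal p" and s: "s \<in> smoothness_ball r \<sigma> (ennreal p) p' R" for J R D s p'
  proof -
    have s_meas: "s \<in> borel_measurable (lebesgue_on unit_cube)"
      using s by (simp add: smoothness_ball_def Lspace_def)
    define near where "near k Q \<longleftrightarrow> Q \<in> grid_poly r \<sigma> k \<and>
      (\<integral>\<^sup>+x. ennreal (\<bar>s x - Q x\<bar> powr p) \<partial>lebesgue_on unit_cube)
        \<le> ennreal ((2 * R * 2 powr (- real k * smin \<sigma>)) powr p)" for k Q
    define P where "P k = (SOME Q. near k Q)" for k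
    have "\<exists>Q. near k Q" for k
      using smoothness_ball_near_best[OF s p' p R, of k] unfolding near_def Bex_def .
    then have "near k (P k)" for k unfolding P_def by (rule someI_ex)
    then have P: "P k \<in> grid_poly r \<sigma> k"
      and P_int: "(\<integral>\<^sup>+x. ennreal (\<bar>s x - P k x\<bar> powr p) \<partial>lebesgue_on unit_cube)
        \<le> ennreal ((2 * R * 2 powr (- real k * smin \<sigma>)) powr p)" for k
      by (simp_all only: near_def)
    have P_int0: "(\<integral>\<^sup>+x. ennreal (\<bar>s x - P k x\<bar> powr p0) \<partial>lebesgue_on unit_cube)
        \<le> ennreal ((A0 * R * 2 powr (- real k * sm)) powr p0)" for k
    proof -
      have "P k \<in> borel_measurable (lebesgue_on unit_cube)"
        using P[of k] unfolding grid_poly_def dyadic_grid_eq by (rule piecewise_poly_dyadic_cells_measurable)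
      then have "(\<lambda>x. s x - P k x) \<in> borel_measurable (lebesgue_on unit_cube)" using s_meas by measurable
      from nn_integral_powr_le_of_larger_exponent[OF this emeasure_unit_cube p0(1,2) _ P_int]
      show ?thesis using R by (simp add: A0_def sm_def mult_ac)
    qed
    have A: "A0 * R > 0" using A0 R by simp
    \<comment> \<open>The finest level J' actually used may be smaller than the permitted
      \<open>J\<close>. Here the partition is bisected to exactly \<open>D\<close> cells.\<close>
    have finish: "\<exists>m\<in>dyadic_partitions D J. \<exists>t\<in>piecewise_poly m r. Lnorm q (\<lambda>x. s x - t x)
        \<le> ennreal (C * A0 * K * R * (2 powr (- (real J * \<eta>)) + real D powr (- h)))"
      if k0: "k0 \<le> J'" and J': "J' \<le> J" and card: "(if k0 = J' then 1 else N) * 2 powr (real k0 * V) \<le> real D"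
        and err: "2 powr (- real k0 * sm) + 2 powr (- real J' * \<eta>) \<le> K * (2 powr (- (real J * \<eta>)) + real D powr (- h))"
      for k0 J'
    proof -
      obtain m t where m: "m \<in> dyadic_partitions (card m) J'" and t: "t \<in> piecewise_poly m r"
        and m_card: "real (card m) \<le> (if k0 = J' then 1 else N) * 2 powr (real k0 * V)"
        and norm: "Lnorm q (\<lambda>x. s x - t x) \<le> ennreal (C * (A0 * R) * (2 powr (- real k0 * sm) + 2 powr (- real J' * \<eta>)))"
        using adapt[OF A s_meas P P_int0 k0] by (elim exE conjE) (rule that)
      have "real (card m) \<le> real D" using m_card card by (rule order_trans)
      then have "card m \<le> D" by simp
      moreover have "m \<in> dyadic_partitions (card m) J" using m dyadic_partitions_mono[OF J'] by blast
      moreover have "D \<le> 2 ^ (J * CARD('n))" using ne card_dyadic_partition_le by blast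
      ultimately obtain m' where m': "m' \<in> dyadic_partitions D J" "piecewise_poly m r \<subseteq> piecewise_poly m' r"
        using dyadic_partition_refine by metis
      have "C * (A0 * R) * (2 powr (- real k0 * sm) + 2 powr (- real J' * \<eta>))
          \<le> C * (A0 * R) * (K * (2 powr (- (real J * \<eta>)) + real D powr (- h)))"
        using C A by (intro mult_left_mono err) auto
      then have "Lnorm q (\<lambda>x. s x - t x) \<le> ennreal (C * A0 * K * R * (2 powr (- (real J * \<eta>)) + real D powr (- h)))"
        by (intro order_trans[OF norm] ennreal_leI) (simp add: mult_ac)
      then show ?thesis using m' t by blast
    qed
    have D_h: "1 / Y powr h \<le> real D powr (- h)" if "real D \<le> Y" for Y
    proof -
      have "real D powr h \<le> Y powr h" using that h_pos D by (intro powr_mono2) auto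
      then have "1 / Y powr h \<le> 1 / real D powr h" using D by (intro frac_le) auto
      then show ?thesis by (simp add: powr_minus_divide)
    qed
    show ?thesis
    proof (cases "real D < N1")
      case True
      \<comment> \<open>Too few cells for any base level with factor \<open>N1\<close>: a single
        cell is used. The two error terms add up to 2, and D^(-h) is bounded below by
        N1^(-h).\<close>
      show ?thesis
      proof (rule finish[of 0 0])
        have "2 = 2 * N1 powr h * (1 / N1 powr h)" using N1 by simp
        also have "\<dots> \<le> K * real D powr (- h)"
          using K True by (intro mult_mono D_h) auto
        also have "\<dots> \<le> K * (2 powr (- (real J * \<eta>)) + real D powr (- h))" using K by (intro mult_left_mono) auto
        finally show "2 powr (- real 0 * sm) + 2 powr (- real 0 * \<eta>) \<le> K * (2 powr (- (real J * \<eta>)) + real D powr (- h))"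
          by simp
      qed (use D in auto)
    next
      case False
      then obtain k where k: "N1 * 2 powr (real k * V) \<le> real D" "real D < N1 * 2 powr (real (Suc k) * V)"
        using level_for_cardinality[of N1 V "real D"] N1 V by auto
      show ?thesis
      proof (cases "k < J")
        case True
        \<comment> \<open>The generic case: \<open>k\<close> is the largest level affordable with
          \<open>D\<close> cells, and V h = a turns 2^(-k a) into a multiple of D^(-h).\<close>
        show ?thesis
        proof (rule finish[of k J])
          have "N * 2 powr (real k * V) \<le> N1 * 2 powr (real k * V)" using N1 by (intro mult_right_mono) auto
          also note k(1)
          finally show "(if k = J then 1 else N) * 2 powr (real k * V) \<le> real D" using True by simp
          have "(N1 * 2 powr (real (Suc k) * V)) powr h = N1 powr h * 2 powr (real (Suc k) * (V * h))"
            using N1 by (simp add: powr_mult powr_powr mult.assoc)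
          also have "\<dots> = N1 powr h * 2 powr sm * 2 powr (real k * sm)"
            unfolding V(2) by (simp add: distrib_right powr_add)
          finally have Y: "(N1 * 2 powr (real (Suc k) * V)) powr h = N1 powr h * 2 powr sm * 2 powr (real k * sm)" .
          have "2 powr (- real k * sm) = N1 powr h * 2 powr sm * (1 / (N1 * 2 powr (real (Suc k) * V)) powr h)"
            unfolding Y using N1 by (simp add: powr_minus_divide)
          also have "\<dots> \<le> K * real D powr (- h)" using K k(2) by (intro mult_mono D_h) auto
          finally have "2 powr (- real k * sm) \<le> K * real D powr (- h)" .
          moreover have "1 * 2 powr (- real J * \<eta>) \<le> K * 2 powr (- real J * \<eta>)" using K by (intro mult_right_mono) auto
          ultimately show "2 powr (- real k * sm) + 2 powr (- real J * \<eta>) \<le> K * (2 powr (- (real J * \<eta>)) + real D powr (- h))"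
            unfolding distrib_left mult_minus_left by linarith
        qed (use True in auto)
      next
        case False
        show ?thesis
        proof (rule finish[of J J])
          have "1 * 2 powr (real J * V) \<le> N1 * 2 powr (real k * V)"
            using N1 False V by (intro mult_mono powr_mono mult_right_mono) auto
          then show "(if J = J then 1 else N) * 2 powr (real J * V) \<le> real D" using k(1) by simp
          have "2 powr (- real J * sm) \<le> 2 powr (- real J * \<eta>)"
            using \<eta>_le by (intro powr_mono) (auto intro: mult_left_mono)
          moreover have "2 * 2 powr (- real J * \<eta>) \<le> K * 2 powr (- real J * \<eta>)" using K by (intro mult_right_mono) auto
          moreover have "0 \<le> K * real D powr (- h)" using K by simp
          ultimately show "2 powr (- real J * sm) + 2 powr (- real J * \<eta>) \<le> K * (2 powr (- (real J * \<eta>)) + real D powr (- h))"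
            unfolding distrib_left mult_minus_left by linarith
        qed auto
      qed
    qed
  qed
  note main = this
  have "C * A0 * K > 0" using C A0 K by simp
  then show ?thesis unfolding h_def[symmetric] exponent
    by (intro exI[of _ "C * A0 * K"] conjI allI impI, assumption) (rule main)
qed

theorem corollary2:
  "\<exists>(C1 :: real^'n \<Rightarrow> real \<Rightarrow> real) (C3 :: nat^'n \<Rightarrow> real^'n \<Rightarrow> real \<Rightarrow> ennreal \<Rightarrow> real).
     \<forall>(r :: nat^'n) (\<sigma> :: real^'n) (p :: real) (q :: ennreal).
       (\<forall>l. 0 < \<sigma> $ l \<and> \<sigma> $ l < real (r $ l) + 1) \<and> 0 < p \<and> 1 \<le> q \<and>
       harmonic_mean \<sigma> / real CARD('n) > exponent_gap p q \<longrightarrow>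
       0 < C1 \<sigma> p \<and> 0 < C3 r \<sigma> p q \<and>
       (\<forall>(J :: nat) (R :: real) (D :: nat).
          0 < R \<and> real D \<ge> C1 \<sigma> p \<and> (dyadic_partitions D J :: (real^'n) set set set) \<noteq> {} \<longrightarrow>
          (SUP s \<in> smoothness_ball r \<sigma> (ennreal p)
                     (if p \<le> 1 \<or> ennreal p \<ge> q then \<infinity> else ennreal p) R.
             INF t \<in> (\<Union>m \<in> dyadic_partitions D J. piecewise_poly m r).
               Lnorm q (\<lambda>x. s x - t x))
          \<le> ennreal (C3 r \<sigma> p q * R *
               (2 powr (- (real J * real CARD('n)
                             * (harmonic_mean \<sigma> / real CARD('n) - exponent_gap p q)
                             * smin \<sigma> / harmonic_mean \<sigma>))
                + real D powr (- (harmonic_mean \<sigma> / real CARD('n))))))"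
proof -
  define bound where "bound \<sigma> p q J D =
      2 powr (- (real J * real CARD('n) * (harmonic_mean \<sigma> / real CARD('n) - exponent_gap p q) * smin \<sigma> / harmonic_mean \<sigma>))
        + real D powr (- (harmonic_mean \<sigma> / real CARD('n)))" for \<sigma> :: "real^'n" and p q J D
  define good where "good r \<sigma> p q C \<longleftrightarrow> C > 0 \<and>
     (\<forall>J R D s p'. 0 < R \<longrightarrow> 1 \<le> real D \<longrightarrow> (dyadic_partitions D J :: (real^'n) set set set) \<noteq> {} \<longrightarrow>
     p' = \<infinity> \<or> p' = ennreal p \<longrightarrow> s \<in> smoothness_ball r \<sigma> (ennreal p) p' R \<longrightarrow>
     (\<exists>m\<in>dyadic_partitions D J. \<exists>t\<in>piecewise_poly m r.
        Lnorm q (\<lambda>x. s x - t x) \<le> ennreal (C * R * bound \<sigma> p q J D)))"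
    for r :: "nat^'n" and \<sigma> p q C
  \<comment> \<open>The predicate \<open>good\<close> quantifies over J, R, D, s and both admissible
    p', so one choice per (r, \<sigma>, p, q) yields a constant depending on the permitted
    parameters only.\<close>
  define C3 where "C3 r \<sigma> p q = (SOME C. good r \<sigma> p q C)" for r :: "nat^'n" and \<sigma> p q
  \<comment> \<open>\<open>C1\<close> is constantly 1: the bound already holds for every D >= 1,
    with small \<open>D\<close> absorbed by \<open>C3\<close>.\<close>
  show ?thesis
  proof (rule exI[of _ "\<lambda>_ _. 1"], rule exI[of _ C3], intro allI impI)
    fix r :: "nat^'n" and \<sigma> p q
    assume asm: "(\<forall>l. 0 < \<sigma> $ l \<and> \<sigma> $ l < real (r $ l) + 1) \<and> 0 < p \<and> 1 \<le> q \<and>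
       harmonic_mean \<sigma> / real CARD('n) > exponent_gap p q"
    then have "\<exists>C. good r \<sigma> p q C"
      using uniform_approximation_bound[of \<sigma> p q r] unfolding good_def bound_def by blast
    then have C3: "good r \<sigma> p q (C3 r \<sigma> p q)" unfolding C3_def by (rule someI_ex)
    have "(SUP s \<in> smoothness_ball r \<sigma> (ennreal p) p' R.
             INF t \<in> (\<Union>m \<in> dyadic_partitions D J. piecewise_poly m r). Lnorm q (\<lambda>x. s x - t x))
        \<le> ennreal (C3 r \<sigma> p q * R * bound \<sigma> p q J D)"
      if *: "0 < R \<and> real D \<ge> 1 \<and> (dyadic_partitions D J :: (real^'n) set set set) \<noteq> {}"
        and p': "p' = \<infinity> \<or> p' = ennreal p" for J R D p'
    proof (rule SUP_least)
      fix s assume s: "s \<in> smoothness_ball r \<sigma> (ennreal p) p' R"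
      then obtain m t where "m \<in> dyadic_partitions D J" "t \<in> piecewise_poly m r"
        "Lnorm q (\<lambda>x. s x - t x) \<le> ennreal (C3 r \<sigma> p q * R * bound \<sigma> p q J D)"
        using C3[unfolded good_def, THEN conjunct2, rule_format, OF _ _ _ p' s] * by blast
      then show "(INF t \<in> (\<Union>m \<in> dyadic_partitions D J. piecewise_poly m r). Lnorm q (\<lambda>x. s x - t x))
          \<le> ennreal (C3 r \<sigma> p q * R * bound \<sigma> p q J D)"
        by (intro INF_lower2[of t]) blast+
    qed
    then show "0 < (1::real) \<and> 0 < C3 r \<sigma> p q \<and>
       (\<forall>(J :: nat) (R :: real) (D :: nat).
          0 < R \<and> real D \<ge> 1 \<and> (dyadic_partitions D J :: (real^'n) set set set) \<noteq> {} \<longrightarrow>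
          (SUP s \<in> smoothness_ball r \<sigma> (ennreal p)
                     (if p \<le> 1 \<or> ennreal p \<ge> q then \<infinity> else ennreal p) R.
             INF t \<in> (\<Union>m \<in> dyadic_partitions D J. piecewise_poly m r).
               Lnorm q (\<lambda>x. s x - t x))
          \<le> ennreal (C3 r \<sigma> p q * R *
               (2 powr (- (real J * real CARD('n)
                             * (harmonic_mean \<sigma> / real CARD('n) - exponent_gap p q)
                             * smin \<sigma> / harmonic_mean \<sigma>))
                + real D powr (- (harmonic_mean \<sigma> / real CARD('n))))))"
      using C3 unfolding good_def bound_def[symmetric] by simp
  qed
qed

end
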